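(* Assume $\gamma>0$ and $\int^{\infty}\frac{\mathrm{d}x}{x\Psi(1/x)R(x)}<\infty$. Let $\varphi(b)=\frac{1}{\gamma}\int_b^\infty\frac{\mathrm{d}x}{R(x)}$ for $b>0$, and suppose: (H1) $\limsup_{h\to1+}\liminf_{x\to\infty}\frac{\varphi(hx)}{\varphi(x)}=1$; (H2) for every $h>1$, $\liminf_{x\to\infty}\frac{\varphi(x)}{\varphi(hx)}>1$; (H3) $\limsup_{\rho\to0+}\lim_{z\to\infty}V(z,\rho)=0$, where $V(z,\rho)=\sup_{x\ge z}\left(\frac{R(x)}{R(x+\rho z)}-1\right)_+$ and $(y)_+=\max(y,0)$. Then $\frac{X_t}{\varphi^{-1}(t)}\to1$ in $\mathbb{P}_\infty$-probability as $t\to0+$.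
   Context: Let $\Psi(\lambda)=\gamma\lambda+\frac{\sigma^2}{2}\lambda^2+\int_0^\infty(e^{-\lambda z}-1+\lambda z)\,\pi(\mathrm{d}z)$ for $\lambda\ge0$, where $\gamma\in\mathbb{R}$, $\sigma\ge0$ and $\pi$ is a measure on $(0,\infty)$ with $\int_0^\infty (z\wedge z^2)\pi(\mathrm{d}z)<\infty$. Let $Z$ be a spectrally positive Lévy process with $\mathbb{E}[e^{-\lambda Z_1}\mid Z_0=x]=e^{-\lambda x+\Psi(\lambda)}$ for $\lambda\ge0$. Let $R$ be continuous on $[0,\infty)$ and strictly positive on $(0,\infty)$. Let $\tau_0^-=\inf\{t\ge0:Z_t<0\}$, $\eta(s)=\int_0^{s\wedge\tau_0^-}\frac{\mathrm{d}r}{R(Z_r)}$, $\eta^{-1}(t)=\inf\{s\ge0:\eta(s)>t\}$, and $X_t=Z_{\eta^{-1}(t)\wedge\tau_0^-}$. Under the stated integral condition (with $\gamma\ge0$), $\infty$ is an instantaneous entrance boundary for $X$, i.e. $X$ does not explode and for every $t>0$, $\lim_{b\to\infty}\liminf_{x\to\infty}\mathbb{P}_x(T_b\le t)=1$ where $T_b=\inf\{t\ge0:X_t<b\}$ and $\mathbb{P}_x$ is the law of $X$ started at $x$; $\mathbb{P}_\infty$ denotes the law of the càdlàg strong Markov process on $[0,\infty]$ started at $\infty$, leaving $\infty$ instantaneously, and evolving from finite states as $X$. $\varphi^{-1}$ is the inverse of the strictly decreasing function $\varphi$. *)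

theory Defs
  imports "HOL-Probability.Probability"
begin

definition levy_measure :: "real measure \<Rightarrow> bool" where
  "levy_measure \<pi> \<longleftrightarrow> sets \<pi> = sets borel \<and> emeasure \<pi> {..0} = 0 \<and>
     integrable \<pi> (\<lambda>z. min z (z\<^sup>2))"

definition laplace_exponent :: "real \<Rightarrow> real \<Rightarrow> real measure \<Rightarrow> real \<Rightarrow> real" where
  "laplace_exponent \<gamma> \<sigma> \<pi> lam =
     \<gamma> * lam + \<sigma>\<^sup>2 / 2 * lam\<^sup>2 + (\<integral>z. exp (- lam * z) - 1 + lam * z \<partial>\<pi>)"

definition cadlag_on_nonneg :: "(real \<Rightarrow> 'a::topological_space) \<Rightarrow> bool" where
  "cadlag_on_nonneg f \<longleftrightarrow>
     (\<forall>t\<ge>0. continuous (at_right t) f \<and> (0 < t \<longrightarrow> (\<exists>l. (f \<longlongrightarrow> l) (at_left t))))"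

text \<open>L is a Levy process started at 0 under M with E[exp(-lambda L_t)] = exp(t Psi(lambda)).
  Then x + L is the process Z under P_x.\<close>
definition spos_levy :: "'a measure \<Rightarrow> (real \<Rightarrow> 'a \<Rightarrow> real) \<Rightarrow> (real \<Rightarrow> real) \<Rightarrow> bool" where
  "spos_levy M L \<Psi> \<longleftrightarrow> prob_space M \<and>
     (\<forall>t\<ge>0. L t \<in> borel_measurable M) \<and>
     (\<forall>\<omega>\<in>space M. L 0 \<omega> = 0) \<and>
     (AE \<omega> in M. cadlag_on_nonneg (\<lambda>t. L t \<omega>)) \<and>
     (\<forall>ts. sorted ts \<and> (\<forall>t\<in>set ts. 0 \<le> t) \<longrightarrow>
        prob_space.indep_vars M (\<lambda>_. borel) (\<lambda>i \<omega>. L (ts ! Suc i) \<omega> - L (ts ! i) \<omega>)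
          {..<length ts - 1}) \<and>
     (\<forall>s t lam. 0 \<le> s \<and> s \<le> t \<and> 0 \<le> lam \<longrightarrow>
        (\<integral>\<^sup>+\<omega>. ennreal (exp (- lam * (L t \<omega> - L s \<omega>))) \<partial>M) = ennreal (exp ((t - s) * \<Psi> lam)))"

definition tau0 :: "(real \<Rightarrow> 'a \<Rightarrow> real) \<Rightarrow> real \<Rightarrow> 'a \<Rightarrow> ereal" where
  "tau0 L x \<omega> = Inf (ereal ` {s. 0 \<le> s \<and> x + L s \<omega> < 0})"

definition eta :: "(real \<Rightarrow> real) \<Rightarrow> (real \<Rightarrow> 'a \<Rightarrow> real) \<Rightarrow> real \<Rightarrow> 'a \<Rightarrow> real \<Rightarrow> ennreal" where
  "eta R L x \<omega> s = (\<integral>\<^sup>+ r. indicator {r. 0 \<le> r \<and> r \<le> s \<and> ereal r \<le> tau0 L x \<omega>} r *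
       inverse (ennreal (R (x + L r \<omega>))) \<partial>lborel)"

definition eta_inv :: "(real \<Rightarrow> real) \<Rightarrow> (real \<Rightarrow> 'a \<Rightarrow> real) \<Rightarrow> real \<Rightarrow> 'a \<Rightarrow> real \<Rightarrow> ereal" where
  "eta_inv R L x \<omega> t = Inf (ereal ` {s. 0 \<le> s \<and> eta R L x \<omega> s > ennreal t})"

definition Xproc :: "(real \<Rightarrow> real) \<Rightarrow> (real \<Rightarrow> 'a \<Rightarrow> real) \<Rightarrow> real \<Rightarrow> real \<Rightarrow> 'a \<Rightarrow> ereal" where
  "Xproc R L x t \<omega> =
     (let u = min (eta_inv R L x \<omega> t) (tau0 L x \<omega>)
      in if u = \<infinity> then \<infinity> else ereal (x + L (real_of_ereal u) \<omega>))"

definition is_filtration :: "'b measure \<Rightarrow> (real \<Rightarrow> 'b measure) \<Rightarrow> bool" where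
  "is_filtration N F \<longleftrightarrow> (\<forall>t. space (F t) = space N \<and> sets (F t) \<subseteq> sets N) \<and>
     (\<forall>s t. s \<le> t \<longrightarrow> sets (F s) \<subseteq> sets (F t))"

definition is_stopping_time :: "(real \<Rightarrow> 'b measure) \<Rightarrow> ('b \<Rightarrow> ereal) \<Rightarrow> bool" where
  "is_stopping_time F T \<longleftrightarrow> (\<forall>t. \<forall>\<omega>\<in>space (F t). 0 \<le> T \<omega>) \<and>
     (\<forall>t\<ge>0. {\<omega>\<in>space (F t). T \<omega> \<le> ereal t} \<in> sets (F t))"

definition stopped_sets :: "'b measure \<Rightarrow> (real \<Rightarrow> 'b measure) \<Rightarrow> ('b \<Rightarrow> ereal) \<Rightarrow> 'b set set" where
  "stopped_sets N F T = {A \<in> sets N. \<forall>t\<ge>0. {\<omega>\<in>A. T \<omega> \<le> ereal t} \<in> sets (F t)}"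

text \<open>Y (under N, adapted to F) is a cadlag strong Markov process on [0,infinity], started at
  infinity, leaving infinity instantaneously, and evolving from finite states as X
  (law of X under P_x given by Xproc R L x under M).\<close>
definition entrance_from_infinity ::
  "'a measure \<Rightarrow> (real \<Rightarrow> 'a \<Rightarrow> real) \<Rightarrow> (real \<Rightarrow> real) \<Rightarrow>
   'b measure \<Rightarrow> (real \<Rightarrow> 'b measure) \<Rightarrow> (real \<Rightarrow> 'b \<Rightarrow> ereal) \<Rightarrow> bool" where
  "entrance_from_infinity M L R N F Y \<longleftrightarrow>
     prob_space N \<and> is_filtration N F \<and>
     (\<forall>t\<ge>0. Y t \<in> measurable (F t) borel) \<and>
     (\<forall>t\<ge>0. \<forall>\<omega>\<in>space N. 0 \<le> Y t \<omega>) \<and>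
     (\<forall>\<omega>\<in>space N. Y 0 \<omega> = \<infinity>) \<and>
     (AE \<omega> in N. cadlag_on_nonneg (\<lambda>t. Y t \<omega>)) \<and>
     (AE \<omega> in N. \<forall>\<epsilon>>0. \<exists>t. 0 < t \<and> t < \<epsilon> \<and> Y t \<omega> < \<infinity>) \<and>
     (\<forall>T. is_stopping_time F T \<longrightarrow>
        (\<forall>A \<in> stopped_sets N F T. \<forall>tBs :: (real \<times> ereal set) list.
           (\<forall>(t, B) \<in> set tBs. 0 \<le> t \<and> B \<in> sets borel) \<longrightarrow>
           emeasure N {\<omega> \<in> A. T \<omega> < \<infinity> \<and> Y (real_of_ereal (T \<omega>)) \<omega> < \<infinity> \<and>
               (\<forall>(t, B) \<in> set tBs. Y (real_of_ereal (T \<omega>) + t) \<omega> \<in> B)}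
           = (\<integral>\<^sup>+\<omega>. indicator {\<omega> \<in> A. T \<omega> < \<infinity> \<and> Y (real_of_ereal (T \<omega>)) \<omega> < \<infinity>} \<omega> *
                emeasure M {\<omega>' \<in> space M. \<forall>(t, B) \<in> set tBs.
                   Xproc R L (real_of_ereal (Y (real_of_ereal (T \<omega>)) \<omega>)) t \<omega>' \<in> B} \<partial>N)))"

definition phi :: "real \<Rightarrow> (real \<Rightarrow> real) \<Rightarrow> real \<Rightarrow> real" where
  "phi \<gamma> R b = (1 / \<gamma>) * integral {b..} (\<lambda>x. 1 / R x)"

definition phi_inv :: "real \<Rightarrow> (real \<Rightarrow> real) \<Rightarrow> real \<Rightarrow> real" where
  "phi_inv \<gamma> R = inv_into {0<..} (phi \<gamma> R)"

definition Vfun :: "(real \<Rightarrow> real) \<Rightarrow> real \<Rightarrow> real \<Rightarrow> ereal" where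
  "Vfun R z \<rho> = (SUP x\<in>{z..}. ereal (max (R x / R (x + \<rho> * z) - 1) 0))"

end

(* Write g = 1/R, so that phi(b) is 1/gamma times the integral of g over [b, infinity), and let beta = phi^{-1}(t).

   Since Y is right-continuous at t and at 0, the Markov property at deterministic times s -> 0 reduces the claim
   to: for t small and then x large, X_t lies in [(1-eps) beta, (1+eps) beta] with P_x-probability close to 1.

   Let f be a smoothed version of phi, with f' close to - g / gamma, and let lam = K / phi(beta). For a point y of
   order at least beta, the process Z sees the scale y, on which f is smooth by H1-H3, while
   Psi(l) / l -> gamma as l -> 0 says that on that scale Z is almost a deterministic drift - gamma. Hence
   exp(- lam f(Z) + (1-delta) lam A) and exp(lam f(Z) - (1+delta) lam A), with A the integral of g(Z) (the clock of
   the time change), are supermartingales until Z falls below beta/2. When A = t, Markov's inequality turns them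
   into bounds of the form exp(- c K) for f(X_t) to be much smaller or much larger than t, and K is arbitrary.

   Z is sampled on a grid and A is replaced by Riemann sums, so that only independence of finitely many increments
   is used; right-continuity of the paths allows the mesh to tend to 0. *)
theory Submission
  imports Defs
begin

section \<open>Behaviour of the Laplace exponent at zero\<close>

section \<open>Laplace exponent\<close>

text \<open>H3 controls g only from above and only across steps of a minimal length, so g itself may
  oscillate. Therefore f is built from averages of g over \<open>[y, r * y]\<close>, and in two
  versions: with the interval to the left of y the average nearly dominates g, with the interval to
  the right g nearly dominates it. Z may lack second moments and only Laplace transforms at
  nonnegative arguments are given, so a move v from y is measured by
  \<open>1 - exp (- v / y)\<close>; its square has expectation of smaller order than the drift
  because \<open>\<Psi> (2 * l) - 2 * \<Psi> l\<close> is o(l). Above beta/4 the product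
  \<open>lam * f\<close> is bounded by a constant free of beta, and so are all Taylor constants. The
  start from infinity is cheap: \<open>f \<ge> 0\<close> bounds the first exponential by 1 for every
  x, and f tends to 0 at infinity, which bounds the second one for large x. A deep fall within one
  grid step lowers the first exponential but raises the second; this asymmetry accounts for the
  extra term in the downward estimate.\<close>

lemma exp_minus_quadratic_bound:
  fixes x :: real assumes "x \<ge> 0"
  shows "0 \<le> exp (- x) - 1 + x" "exp (- x) - 1 + x \<le> x" "exp (- x) - 1 + x \<le> x\<^sup>2"
proof -
  show "0 \<le> exp (- x) - 1 + x" using exp_ge_add_one_self[of "-x"] by simp
  show le: "exp (- x) - 1 + x \<le> x" using assms by simp
  have "exp (- x) \<le> 1 - x + x\<^sup>2"
  proof (cases "x \<le> 1")
    case True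
    have "exp (-x) = inverse (exp x)" by (simp add: exp_minus)
    also have "\<dots> \<le> inverse (1 + x)" using assms exp_ge_add_one_self[of x] by (intro le_imp_inverse_le) auto
    also have "\<dots> \<le> 1 - x + x\<^sup>2"
    proof -
      \<comment> \<open>The product equals \<open>1 + x ^ 3\<close>.\<close>
      have "1 \<le> (1 - x + x\<^sup>2) * (1 + x)" using assms by (simp add: algebra_simps power2_eq_square)
      then show ?thesis using assms by (simp add: field_simps)
    qed
    finally show ?thesis .
  next
    case False
    then have "x \<le> x\<^sup>2" by (simp add: power2_eq_square)
    moreover have "exp (-x) \<le> 1" using assms by simp
    ultimately show ?thesis by linarith
  qed
  then show "exp (- x) - 1 + x \<le> x\<^sup>2" by linarith
qed

lemma levy_measure_AE_pos:
  assumes "levy_measure \<pi>" shows "AE z in \<pi>. z > 0"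
proof -
  have "{..0} \<in> null_sets \<pi>" using assms unfolding levy_measure_def null_sets_def by auto
  then show ?thesis by (rule AE_I') (auto simp: not_less)
qed

lemma laplace_exponent_ge:
  assumes "levy_measure \<pi>" "lam \<ge> 0"
  shows "\<gamma> * lam \<le> laplace_exponent \<gamma> \<sigma> \<pi> lam"
proof -
  have "0 \<le> (\<integral>z. exp (- lam * z) - 1 + lam * z \<partial>\<pi>)"
    using exp_ge_add_one_self[of "- lam * _"] by (intro integral_nonneg_AE) (auto simp: algebra_simps)
  then show ?thesis unfolding laplace_exponent_def by simp
qed

text \<open>Dominated convergence: the compensated exponential is at most \<open>lam * z\<close> and
  at most \<open>(lam * z)\<^sup>2\<close>. After division by \<open>lam < 1\<close> it is therefore
  below \<open>min z (z\<^sup>2)\<close>, and the second bound makes it vanish pointwise.\<close>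

lemma laplace_exponent_quotient_tendsto:
  assumes \<pi>: "levy_measure \<pi>"
  shows "((\<lambda>lam. laplace_exponent \<gamma> \<sigma> \<pi> lam / lam) \<longlongrightarrow> \<gamma>) (at_right 0)"
proof -
  have sets: "sets \<pi> = sets borel" and int: "integrable \<pi> (\<lambda>z. min z (z\<^sup>2))"
    using \<pi> unfolding levy_measure_def by auto
  have meas: "(\<lambda>z. (exp (- lam * z) - 1 + lam * z) / lam) \<in> borel_measurable \<pi>" for lam :: real
    using sets by (simp cong: measurable_cong_sets)
  have "((\<lambda>lam. \<integral>z. (exp (- lam * z) - 1 + lam * z) / lam \<partial>\<pi>) \<longlongrightarrow> (\<integral>z. 0 \<partial>\<pi>)) (at_right 0)"
  proof (rule tendsto_at_right_sequentially[of _ 1])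
    fix S :: "nat \<Rightarrow> real"
    assume S: "\<And>n. 0 < S n" "\<And>n. S n < 1" "decseq S" "S \<longlonglongrightarrow> 0"
    show "(\<lambda>n. \<integral>z. (exp (- S n * z) - 1 + S n * z) / S n \<partial>\<pi>) \<longlonglongrightarrow> (\<integral>z. 0 \<partial>\<pi>)"
    proof (rule integral_dominated_convergence[where w = "\<lambda>z. min z (z\<^sup>2)"])
      show "AE z in \<pi>. (\<lambda>n. (exp (- S n * z) - 1 + S n * z) / S n) \<longlonglongrightarrow> 0"
        using levy_measure_AE_pos[OF \<pi>]
      proof eventually_elim
        case (elim z)
        have bd: "\<bar>(exp (- S n * z) - 1 + S n * z) / S n\<bar> \<le> S n * z\<^sup>2" for n
        proof -
          have "0 \<le> exp (- (S n * z)) - 1 + S n * z" "exp (- (S n * z)) - 1 + S n * z \<le> (S n * z\<^sup>2) * S n"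
            using exp_minus_quadratic_bound(1,3)[of "S n * z"] S(1)[of n] elim
            by (simp_all add: power2_eq_square mult_ac)
          then show ?thesis using S(1)[of n] by (simp add: divide_le_eq)
        qed
        have lim0: "(\<lambda>n. S n * z\<^sup>2) \<longlonglongrightarrow> 0" using tendsto_mult_left_zero[OF S(4), of "z\<^sup>2"] by simp
        show ?case by (rule Lim_null_comparison[OF always_eventually lim0]) (use bd in \<open>simp only: real_norm_def, blast\<close>)
      qed
    next
      fix n
      show "AE z in \<pi>. norm ((exp (- S n * z) - 1 + S n * z) / S n) \<le> min z (z\<^sup>2)"
        using levy_measure_AE_pos[OF \<pi>]
      proof eventually_elim
        case (elim z)
        have "(exp (- S n * z) - 1 + S n * z) / S n \<le> z"
          using exp_minus_quadratic_bound(2)[of "S n * z"] S(1)[of n] elim by (simp add: divide_le_eq mult_ac)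
        moreover have "(exp (- S n * z) - 1 + S n * z) / S n \<le> S n * z\<^sup>2"
          using exp_minus_quadratic_bound(3)[of "S n * z"] S(1)[of n] elim by (simp add: divide_le_eq power2_eq_square mult_ac)
        moreover have "S n * z\<^sup>2 \<le> z\<^sup>2" using S(2)[of n] mult_right_mono[of "S n" 1 "z\<^sup>2"] by simp
        moreover have "0 \<le> (exp (- S n * z) - 1 + S n * z) / S n"
          using exp_minus_quadratic_bound(1)[of "S n * z"] S(1)[of n] elim by simp
        ultimately show ?case unfolding real_norm_def by (subst abs_of_nonneg) auto
      qed
    next show "(\<lambda>z. 0) \<in> borel_measurable \<pi>" by simp next show "integrable \<pi> (\<lambda>z. min z (z\<^sup>2))" by (rule int) next fix n show "(\<lambda>z. (exp (- S n * z) - 1 + S n * z) / S n) \<in> borel_measurable \<pi>" by (rule meas) qed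
  qed simp
  then have "((\<lambda>lam. \<integral>z. (exp (- lam * z) - 1 + lam * z) / lam \<partial>\<pi>) \<longlongrightarrow> 0) (at_right 0)"
    by simp
  from tendsto_add[OF tendsto_add[OF tendsto_const[of \<gamma>] tendsto_mult[OF tendsto_const[of "\<sigma>\<^sup>2 / 2"] tendsto_ident_at]] this]
  have lim: "((\<lambda>lam. \<gamma> + \<sigma>\<^sup>2 / 2 * lam + (\<integral>z. (exp (- lam * z) - 1 + lam * z) / lam \<partial>\<pi>)) \<longlongrightarrow> \<gamma>) (at_right 0)"
    by simp
  have "laplace_exponent \<gamma> \<sigma> \<pi> lam / lam
      = \<gamma> + \<sigma>\<^sup>2 / 2 * lam + (\<integral>z. (exp (- lam * z) - 1 + lam * z) / lam \<partial>\<pi>)" if "lam > 0" for lam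
  proof -
    have "(\<integral>z. (exp (- lam * z) - 1 + lam * z) / lam \<partial>\<pi>) = (\<integral>z. exp (- lam * z) - 1 + lam * z \<partial>\<pi>) / lam"
      by (rule integral_divide_zero)
    then show ?thesis using that unfolding laplace_exponent_def by (simp only: add_divide_distrib) (simp add: power2_eq_square)
  qed
  then have "\<forall>\<^sub>F lam in at_right 0. \<gamma> + \<sigma>\<^sup>2 / 2 * lam + (\<integral>z. (exp (- lam * z) - 1 + lam * z) / lam \<partial>\<pi>)
      = laplace_exponent \<gamma> \<sigma> \<pi> lam / lam"
    using eventually_at_right_less[of 0] by (auto elim: eventually_mono)
  with lim show ?thesis by (rule Lim_transform_eventually)
qed

lemma exp_le_quadratic:
  fixes x :: real assumes "0 \<le> x" "x \<le> 1" shows "exp x \<le> 1 + x + x\<^sup>2"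
  using assms exp_bound by blast

text \<open>For an increment \<open>\<xi>\<close> with Laplace transform
  \<open>exp (\<Delta> * \<Psi> lam)\<close> the first expression is the expectation of
  \<open>(1 - exp (- lam * \<xi>))\<^sup>2\<close>. It is of smaller order than
  \<open>\<Delta> * lam\<close> because near zero \<open>\<Psi> (2 * lam)\<close> is almost twice
  \<open>\<Psi> lam\<close>. One \<open>l0\<close> serves all \<open>\<Delta> \<le> 1\<close>, as
  the mesh is refined later.\<close>

lemma laplace_step_bounds:
  assumes \<gamma>: "\<gamma> > 0" and lim: "((\<lambda>lam. \<Psi> lam / lam) \<longlongrightarrow> \<gamma>) (at_right 0)"
    and ge: "\<And>lam. lam \<ge> 0 \<Longrightarrow> \<gamma> * lam \<le> \<Psi> lam" and \<epsilon>: "\<epsilon> > (0::real)"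
  obtains l0 where "l0 > 0" "\<And>lam \<Delta>. 0 < lam \<Longrightarrow> lam \<le> l0 \<Longrightarrow> 0 < \<Delta> \<Longrightarrow> \<Delta> \<le> 1 \<Longrightarrow>
      1 - 2 * exp (\<Delta> * \<Psi> lam) + exp (\<Delta> * \<Psi> (2 * lam)) \<le> \<epsilon> * \<Delta> * lam \<and>
      exp (\<Delta> * \<Psi> lam) - 1 \<le> \<Delta> * lam * (\<gamma> + \<epsilon>)"
proof -
  \<comment> \<open>Three multiples of \<open>\<Delta> * lam * e\<close> accumulate in the first
    estimate and two in the second.\<close>
  define e where "e = \<epsilon> / 4"
  have e: "e > 0" using \<epsilon> by (simp add: e_def)
  have "\<forall>\<^sub>F lam in at_right 0. \<Psi> lam / lam < \<gamma> + e" using lim e by (intro order_tendstoD) auto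
  then obtain b where b: "b > 0" "\<And>lam. 0 < lam \<Longrightarrow> lam < b \<Longrightarrow> \<Psi> lam / lam < \<gamma> + e"
    unfolding eventually_at_right_field by auto
  define B where "B = \<gamma> + e"
  have B: "B > 0" using \<gamma> e by (simp add: B_def)
  \<comment> \<open>The three caps keep \<open>2 * lam\<close> where \<open>\<Psi> lam / lam\<close>
    is below \<open>B\<close>, keep the exponents at most 1 for the quadratic bound of
    \<open>exp\<close>, and make their squares at most \<open>\<Delta> * lam * e\<close>.\<close>
  define l0 where "l0 = min (b / 3) (min (1 / (2 * B)) (e / (4 * B\<^sup>2)))"
  have l0: "l0 > 0" using b e B by (simp add: l0_def)
  show ?thesis
  proof (rule that[OF l0])
    fix lam \<Delta> :: real assume l: "0 < lam" "lam \<le> l0" and d: "0 < \<Delta>" "\<Delta> \<le> 1"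
    have lb: "2 * lam < b" using l b(1) unfolding l0_def by linarith
    have p1: "\<Psi> lam \<le> lam * B" using b(2)[of lam] lb l by (simp add: B_def field_simps)
    have p2: "\<Psi> (2 * lam) \<le> 2 * lam * B" using b(2)[of "2 * lam"] lb l by (simp add: B_def field_simps)
    have lB: "2 * lam * B \<le> 1"
    proof -
      have "lam \<le> 1 / (2 * B)" using l unfolding l0_def by linarith
      then show ?thesis using B by (simp add: field_simps)
    qed
    have lB2: "4 * lam * B\<^sup>2 \<le> e"
    proof -
      have "lam \<le> e / (4 * B\<^sup>2)" using l unfolding l0_def by linarith
      then show ?thesis using B by (simp add: field_simps)
    qed
    define u where "u = \<Delta> * \<Psi> lam" define w where "w = \<Delta> * \<Psi> (2 * lam)"
    have u0: "\<Delta> * (\<gamma> * lam) \<le> u" using ge[of lam] l d unfolding u_def by (intro mult_left_mono) auto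
    have "0 \<le> \<gamma> * (2 * lam)" using l \<gamma> by simp
    then have w0: "0 \<le> w" using ge[of "2 * lam"] l d unfolding w_def by (intro mult_nonneg_nonneg) linarith+
    have u1: "u \<le> \<Delta> * (lam * B)" unfolding u_def using p1 d by (intro mult_left_mono) auto
    have w1: "w \<le> \<Delta> * (2 * lam * B)" unfolding w_def using p2 d by (intro mult_left_mono) auto
    have "0 \<le> \<Delta> * (\<gamma> * lam)" using d l \<gamma> by simp
    then have u00: "0 \<le> u" using u0 by linarith
    have lB0: "0 \<le> 2 * lam * B" using l B by simp
    have "\<Delta> * (2 * lam * B) \<le> 1" using mult_le_one[OF d(2) lB0 lB] .
    then have wle: "w \<le> 1" using w1 by linarith
    have "\<Delta> * (lam * B) \<le> 1" using lB lB0 by (intro mult_le_one[OF d(2)]) linarith+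
    then have ule: "u \<le> 1" using u1 by linarith
    have wsq: "w\<^sup>2 \<le> \<Delta> * lam * e"
    proof -
      have "w\<^sup>2 \<le> (\<Delta> * (2 * lam * B))\<^sup>2" using w0 w1 by (intro power_mono)
      also have "\<dots> = \<Delta> * (\<Delta> * lam * (4 * lam * B\<^sup>2))" by (simp add: power2_eq_square)
      also have "\<dots> \<le> 1 * (\<Delta> * lam * (4 * lam * B\<^sup>2))" using d l by (intro mult_right_mono) auto
      also have "\<dots> \<le> \<Delta> * lam * e" using lB2 d l by (simp add: mult_left_mono)
      finally show ?thesis .
    qed
    have usq: "u\<^sup>2 \<le> \<Delta> * lam * e"
    proof -
      have "u\<^sup>2 \<le> (\<Delta> * (lam * B))\<^sup>2" using u00 u1 by (intro power_mono)
      also have "\<dots> \<le> (\<Delta> * (2 * lam * B))\<^sup>2" using d l B by (intro power_mono mult_left_mono) auto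
      also have "\<dots> = \<Delta> * (\<Delta> * lam * (4 * lam * B\<^sup>2))" by (simp add: power2_eq_square)
      also have "\<dots> \<le> 1 * (\<Delta> * lam * (4 * lam * B\<^sup>2))" using d l by (intro mult_right_mono) auto
      also have "\<dots> \<le> \<Delta> * lam * e" using lB2 d l by (simp add: mult_left_mono)
      finally show ?thesis .
    qed
    have "exp w \<le> 1 + w + w\<^sup>2" using exp_le_quadratic[OF w0 wle] .
    moreover have "1 + u \<le> exp u" by (rule exp_ge_add_one_self)
    ultimately have "1 - 2 * exp u + exp w \<le> w - 2 * u + w\<^sup>2" by linarith
    also have "\<dots> \<le> \<Delta> * (2 * lam * B) - 2 * (\<Delta> * (\<gamma> * lam)) + \<Delta> * lam * e" using w1 u0 wsq by linarith
    also have "\<dots> = 3 * (\<Delta> * lam * e)" by (simp add: B_def algebra_simps)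
    also have "\<dots> \<le> 4 * (\<Delta> * lam * e)" using e d l by simp
    also have "\<dots> = \<epsilon> * \<Delta> * lam" by (simp add: e_def)
    finally have 1: "1 - 2 * exp u + exp w \<le> \<epsilon> * \<Delta> * lam" .
    have "exp u - 1 \<le> u + u\<^sup>2" using exp_le_quadratic[OF u00 ule] by simp
    also have "\<dots> \<le> \<Delta> * (lam * B) + \<Delta> * lam * e" using u1 usq by linarith
    also have "\<dots> = \<Delta> * lam * (\<gamma> + 2 * e)" by (simp add: B_def algebra_simps)
    also have "\<dots> \<le> \<Delta> * lam * (\<gamma> + \<epsilon>)" using d l e by (intro mult_left_mono) (auto simp: e_def)
    finally show "1 - 2 * exp (\<Delta> * \<Psi> lam) + exp (\<Delta> * \<Psi> (2 * lam)) \<le> \<epsilon> * \<Delta> * lam \<and>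
      exp (\<Delta> * \<Psi> lam) - 1 \<le> \<Delta> * lam * (\<gamma> + \<epsilon>)" using 1 unfolding u_def w_def by simp
  qed
qed

section \<open>Exponential supermartingales from finitely many independent increments\<close>

section \<open>Supermartingales of the sampled process\<close>

text \<open>A state is the pair of the sampled position and the Riemann sum of the clock.\<close>
definition chain_step :: "(real \<Rightarrow> real) \<Rightarrow> real \<Rightarrow> real \<Rightarrow> real \<Rightarrow> real \<times> real \<Rightarrow> real \<Rightarrow> real \<times> real" where
  "chain_step g a T \<Delta> s \<xi> =
     (if fst s < a \<or> T < snd s then s else (fst s + \<xi>, snd s + \<Delta> * g (fst s)))"

primrec chain :: "(real \<Rightarrow> real) \<Rightarrow> real \<Rightarrow> real \<Rightarrow> real \<Rightarrow> (nat \<Rightarrow> real) \<Rightarrow> real \<Rightarrow> nat \<Rightarrow> real \<times> real" where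
  "chain g a T \<Delta> \<xi> x 0 = (x, 0)"
| "chain g a T \<Delta> \<xi> x (Suc k) = chain_step g a T \<Delta> (chain g a T \<Delta> \<xi> x k) (\<xi> k)"

lemma chain_cong:
  "(\<And>i. i < k \<Longrightarrow> \<xi> i = \<xi>' i) \<Longrightarrow> chain g a T \<Delta> \<xi> x k = chain g a T \<Delta> \<xi>' x k"
  by (induction k) auto

lemma measurable_chain_step:
  assumes [measurable]: "g \<in> borel_measurable borel"
  shows "(\<lambda>p. chain_step g a T \<Delta> (fst p) (snd p)) \<in> (borel \<Otimes>\<^sub>M borel) \<Otimes>\<^sub>M borel \<rightarrow>\<^sub>M borel \<Otimes>\<^sub>M borel"
  unfolding chain_step_def by measurable

lemma measurable_chain_PiM:
  assumes g: "g \<in> borel_measurable borel" and "k \<le> n"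
  shows "(\<lambda>\<xi>. chain g a T \<Delta> \<xi> x k) \<in> PiM {..<n} (\<lambda>_. borel) \<rightarrow>\<^sub>M borel \<Otimes>\<^sub>M borel"
  using \<open>k \<le> n\<close>
proof (induction k)
  case (Suc k)
  then have "(\<lambda>\<xi>. (chain g a T \<Delta> \<xi> x k, \<xi> k)) \<in> PiM {..<n} (\<lambda>_. borel) \<rightarrow>\<^sub>M (borel \<Otimes>\<^sub>M borel) \<Otimes>\<^sub>M borel"
    by (intro measurable_Pair measurable_component_singleton) auto
  from measurable_compose[OF this measurable_chain_step[OF g, of a T \<Delta>]] show ?case by simp
qed simp

lemma measurable_chain:
  assumes g: "g \<in> borel_measurable borel" and \<xi>: "\<And>i. i < k \<Longrightarrow> \<xi> i \<in> borel_measurable M"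
  shows "(\<lambda>\<omega>. chain g a T \<Delta> (\<lambda>i. \<xi> i \<omega>) x k) \<in> M \<rightarrow>\<^sub>M borel \<Otimes>\<^sub>M borel"
proof -
  have "(\<lambda>\<omega>. restrict (\<lambda>i. \<xi> i \<omega>) {..<k}) \<in> M \<rightarrow>\<^sub>M PiM {..<k} (\<lambda>_. borel)"
    using \<xi> by (intro measurable_restrict) auto
  from measurable_compose[OF this measurable_chain_PiM[OF g order_refl, of a T \<Delta> x]]
  show ?thesis by (simp cong: chain_cong)
qed

text \<open>The state after \<open>k\<close> steps is a function of the first \<open>k\<close>
  increments, hence independent of the next one, which Fubini on the product law integrates out.
  This takes the place of filtrations and conditional expectations; with values in
  \<open>ennreal\<close> no integrability has to be checked.\<close>

lemma (in prob_space) chain_supermartingale: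
  fixes H :: "real \<times> real \<Rightarrow> ennreal"
  assumes g: "g \<in> borel_measurable borel" and ind: "indep_vars (\<lambda>_. borel) \<xi> {..<n}"
    and H: "H \<in> borel_measurable (borel \<Otimes>\<^sub>M borel)"
    and step: "\<And>i s. i < n \<Longrightarrow> (\<integral>\<^sup>+\<omega>. H (chain_step g a T \<Delta> s (\<xi> i \<omega>)) \<partial>M) \<le> H s"
    and "k \<le> n"
  shows "(\<integral>\<^sup>+\<omega>. H (chain g a T \<Delta> (\<lambda>i. \<xi> i \<omega>) x k) \<partial>M) \<le> H (x, 0)"
  using \<open>k \<le> n\<close>
proof (induction k)
  case 0
  then show ?case by (simp add: emeasure_space_1)
next
  case (Suc k)
  define P where "P = PiM {..<k} (\<lambda>_::nat. borel :: real measure)"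
  define X where "X = (\<lambda>\<omega>. restrict (\<lambda>i. \<xi> i \<omega>) {..<k})"
  define C where "C = (\<lambda>f. chain g a T \<Delta> f x k)"
  have rv: "\<xi> i \<in> borel_measurable M" if "i < n" for i using ind that unfolding indep_vars_def by auto
  have C[measurable]: "C \<in> P \<rightarrow>\<^sub>M borel \<Otimes>\<^sub>M borel" unfolding P_def C_def by (rule measurable_chain_PiM[OF g order_refl])
  have CX: "C (X \<omega>) = chain g a T \<Delta> (\<lambda>i. \<xi> i \<omega>) x k" for \<omega> unfolding C_def X_def by (rule chain_cong) simp
  have X[measurable]: "X \<in> M \<rightarrow>\<^sub>M P" unfolding X_def P_def using rv Suc.prems by (intro measurable_restrict) auto
  \<comment> \<open>The single next increment is kept as a family over \<open>{k}\<close>, the form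
    in which \<open>indep_var_restrict\<close> delivers its independence of the earlier
    ones.\<close>
  define Q where "Q = PiM {k} (\<lambda>_::nat. borel :: real measure)"
  define Y where "Y = (\<lambda>\<omega>. restrict (\<lambda>i. \<xi> i \<omega>) {k})"
  have Y[measurable]: "Y \<in> M \<rightarrow>\<^sub>M Q" unfolding Y_def Q_def using rv Suc.prems by (intro measurable_restrict) auto
  have Yk: "Y \<omega> k = \<xi> k \<omega>" for \<omega> by (simp add: Y_def)
  have Qk[measurable]: "(\<lambda>f. f k) \<in> borel_measurable Q" unfolding Q_def by simp
  have "indep_var P X Q Y"
    unfolding P_def X_def Q_def Y_def using Suc.prems by (intro indep_var_restrict[OF ind]) auto
  then have dist: "distr M P X \<Otimes>\<^sub>M distr M Q Y = distr M (P \<Otimes>\<^sub>M Q) (\<lambda>\<omega>. (X \<omega>, Y \<omega>))"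
    by (simp add: indep_var_distribution_eq)
  interpret Y: prob_space "distr M Q Y" by (rule prob_space_distr) simp
  define f where "f = (\<lambda>p. H (chain_step g a T \<Delta> (C (fst p)) (snd p k)))"
  have f[measurable]: "f \<in> borel_measurable (P \<Otimes>\<^sub>M Q)"
  proof -
    have "(\<lambda>p. (C (fst p), snd p k)) \<in> P \<Otimes>\<^sub>M Q \<rightarrow>\<^sub>M (borel \<Otimes>\<^sub>M borel) \<Otimes>\<^sub>M borel" by measurable
    from measurable_compose[OF measurable_compose[OF this measurable_chain_step[OF g, of a T \<Delta>]] H]
    show ?thesis unfolding f_def by simp
  qed
  have f': "f \<in> borel_measurable (distr M P X \<Otimes>\<^sub>M distr M Q Y)" unfolding dist by simp
  have "(\<integral>\<^sup>+\<omega>. H (chain g a T \<Delta> (\<lambda>i. \<xi> i \<omega>) x (Suc k)) \<partial>M) = (\<integral>\<^sup>+\<omega>. f (X \<omega>, Y \<omega>) \<partial>M)"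
    by (simp add: f_def CX Yk)
  also have "\<dots> = (\<integral>\<^sup>+p. f p \<partial>distr M (P \<Otimes>\<^sub>M Q) (\<lambda>\<omega>. (X \<omega>, Y \<omega>)))"
    by (subst nn_integral_distr) auto
  also have "\<dots> = (\<integral>\<^sup>+u. \<integral>\<^sup>+v. f (u, v) \<partial>distr M Q Y \<partial>distr M P X)"
    unfolding dist[symmetric] by (rule Y.nn_integral_fst[OF f', symmetric])
  also have "\<dots> \<le> (\<integral>\<^sup>+u. H (C u) \<partial>distr M P X)"
  proof (rule nn_integral_mono)
    fix u assume "u \<in> space (distr M P X)"
    then have u: "u \<in> space P" by simp
    have "(\<integral>\<^sup>+v. f (u, v) \<partial>distr M Q Y) = (\<integral>\<^sup>+\<omega>. f (u, Y \<omega>) \<partial>M)"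
      using u by (subst nn_integral_distr) auto
    also have "\<dots> \<le> H (C u)" using step[of k "C u"] Suc.prems by (simp add: f_def Yk)
    finally show "(\<integral>\<^sup>+v. f (u, v) \<partial>distr M Q Y) \<le> H (C u)" .
  qed
  also have "\<dots> = (\<integral>\<^sup>+\<omega>. H (C (X \<omega>)) \<partial>M)"
    using H by (subst nn_integral_distr) (auto intro: measurable_compose)
  also have "\<dots> \<le> H (x, 0)" using Suc by (simp add: CX)
  finally show ?case .
qed

text \<open>Until the chain stops, one step costs \<open>h\<close> the factor
  \<open>exp (- (c * \<Delta> * g z))\<close>, which the advance of the clock gives back, so
  \<open>h (position) * exp (c * clock)\<close> is a supermartingale and Markov's inequality at
  level \<open>m\<close> applies. The sign of \<open>c\<close> is free: positive to exclude a late
  clock at a high position, negative to exclude a low position.\<close>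

lemma (in prob_space) chain_exp_bound:
  assumes g: "g \<in> borel_measurable borel" and ind: "indep_vars (\<lambda>_. borel) \<xi> {..<n}"
    and h[measurable]: "h \<in> borel_measurable borel" and h0: "\<And>z. 0 \<le> h z"
    and step: "\<And>i z. i < n \<Longrightarrow> a \<le> z \<Longrightarrow>
      (\<integral>\<^sup>+\<omega>. ennreal (h (z + \<xi> i \<omega>)) \<partial>M) \<le> ennreal (h z * exp (- (c * \<Delta> * g z)))"
    and B[measurable]: "B \<in> sets (borel \<Otimes>\<^sub>M borel)" and m: "m > 0"
    and hB: "\<And>\<omega>. \<omega> \<in> space M \<Longrightarrow> chain g a T \<Delta> (\<lambda>i. \<xi> i \<omega>) x n \<in> B \<Longrightarrow>
      m \<le> h (fst (chain g a T \<Delta> (\<lambda>i. \<xi> i \<omega>) x n)) * exp (c * snd (chain g a T \<Delta> (\<lambda>i. \<xi> i \<omega>) x n))"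
  shows "prob {\<omega> \<in> space M. chain g a T \<Delta> (\<lambda>i. \<xi> i \<omega>) x n \<in> B} \<le> h x / m"
proof -
  define H where "H = (\<lambda>s. ennreal (h (fst s) * exp (c * snd s)))"
  have H[measurable]: "H \<in> borel_measurable (borel \<Otimes>\<^sub>M borel)" unfolding H_def by measurable
  have rv: "\<xi> i \<in> borel_measurable M" if "i < n" for i using ind that unfolding indep_vars_def by auto
  have "(\<integral>\<^sup>+\<omega>. H (chain g a T \<Delta> (\<lambda>i. \<xi> i \<omega>) x n) \<partial>M) \<le> H (x, 0)"
  proof (rule chain_supermartingale[OF g ind H _ order_refl])
    fix i s assume i: "i < n"
    show "(\<integral>\<^sup>+\<omega>. H (chain_step g a T \<Delta> s (\<xi> i \<omega>)) \<partial>M) \<le> H s"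
    proof (cases "fst s < a \<or> T < snd s")
      case True
      then show ?thesis by (simp add: chain_step_def emeasure_space_1)
    next
      case False
      define E where "E = exp (c * (snd s + \<Delta> * g (fst s)))"
      have "(\<integral>\<^sup>+\<omega>. H (chain_step g a T \<Delta> s (\<xi> i \<omega>)) \<partial>M) = (\<integral>\<^sup>+\<omega>. ennreal E * ennreal (h (fst s + \<xi> i \<omega>)) \<partial>M)"
        using False h0 by (simp add: chain_step_def H_def E_def ennreal_mult' ennreal_mult'' mult.commute)
      also have "\<dots> = ennreal E * (\<integral>\<^sup>+\<omega>. ennreal (h (fst s + \<xi> i \<omega>)) \<partial>M)"
        using rv[OF i] by (intro nn_integral_cmult) measurable
      also have "\<dots> \<le> ennreal E * ennreal (h (fst s) * exp (- (c * \<Delta> * g (fst s))))"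
        using step[OF i, of "fst s"] False by (intro mult_left_mono) auto
      also have "\<dots> = ennreal (E * (h (fst s) * exp (- (c * \<Delta> * g (fst s)))))"
        by (subst ennreal_mult) (auto simp: E_def h0)
      also have "E * (h (fst s) * exp (- (c * \<Delta> * g (fst s)))) = h (fst s) * exp (c * snd s)"
        by (simp add: E_def algebra_simps flip: exp_add)
      finally show ?thesis by (simp add: H_def)
    qed
  qed
  then have le: "(\<integral>\<^sup>+\<omega>. H (chain g a T \<Delta> (\<lambda>i. \<xi> i \<omega>) x n) \<partial>M) \<le> ennreal (h x)" by (simp add: H_def)
  define S where "S = {\<omega> \<in> space M. chain g a T \<Delta> (\<lambda>i. \<xi> i \<omega>) x n \<in> B}"
  have [measurable]: "(\<lambda>\<omega>. chain g a T \<Delta> (\<lambda>i. \<xi> i \<omega>) x n) \<in> M \<rightarrow>\<^sub>M borel \<Otimes>\<^sub>M borel"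
    by (rule measurable_chain[OF g rv])
  have S: "S \<in> sets M" unfolding S_def by measurable
  have "ennreal m * emeasure M S = (\<integral>\<^sup>+\<omega>. ennreal m * indicator S \<omega> \<partial>M)"
    using S by (simp add: nn_integral_cmult_indicator)
  also have "\<dots> \<le> (\<integral>\<^sup>+\<omega>. H (chain g a T \<Delta> (\<lambda>i. \<xi> i \<omega>) x n) \<partial>M)"
    using hB by (intro nn_integral_mono) (auto simp: S_def H_def ennreal_leI split: split_indicator)
  finally have "ennreal m * emeasure M S \<le> ennreal (h x)" using le by simp
  then have "m * prob S \<le> h x" using m h0[of x] by (simp add: emeasure_eq_measure ennreal_mult[symmetric])
  then show ?thesis using m by (simp add: S_def field_simps)
qed

text \<open>The bound on \<open>h\<close> uses \<open>1 - exp (- v / y)\<close> in place of \<open>v / y\<close>, so that Laplace transforms suffice and no moments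
  of the increments are needed.\<close>
lemma (in prob_space) exponential_moment_bound:
  fixes \<xi> :: "'a \<Rightarrow> real"
  assumes \<xi>[measurable]: "\<xi> \<in> borel_measurable M"
    and lap: "\<And>lam. 0 \<le> lam \<Longrightarrow> (\<integral>\<^sup>+\<omega>. ennreal (exp (- lam * \<xi> \<omega>)) \<partial>M) = ennreal (E lam)"
    and E0: "\<And>lam. 0 \<le> E lam"
    and y: "y > 0" and a: "a > 0" and h0: "\<And>v. 0 \<le> h (y + v)"
    and bd: "\<And>v. h (y + v) \<le> \<alpha> + \<beta> * (1 - exp (- v / y)) + \<kappa> * (1 - exp (- v / y))\<^sup>2 + \<kappa>' * (1 - exp (- v / a))\<^sup>2"
  shows "(\<integral>\<^sup>+\<omega>. ennreal (h (y + \<xi> \<omega>)) \<partial>M) \<le> ennreal (\<alpha> + \<beta> * (1 - E (1 / y)) +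
      \<kappa> * (1 - 2 * E (1 / y) + E (2 / y)) + \<kappa>' * (1 - 2 * E (1 / a) + E (2 / a)))"
proof -
  have hb: "has_bochner_integral M (\<lambda>\<omega>. exp (- (l * \<xi> \<omega>))) (E l)" if "0 \<le> l" for l
    using lap[OF that] E0 by (intro has_bochner_integral_nn_integral) auto
  have one: "has_bochner_integral M (\<lambda>\<omega>. 1) (1::real)"
    by (simp add: has_bochner_integral_iff prob_space)
  have q: "has_bochner_integral M (\<lambda>\<omega>. (1 - exp (- \<xi> \<omega> / b))\<^sup>2) (1 - 2 * E (1 / b) + E (2 / b))" if "b > 0" for b
  proof -
    have "(1 - exp (- \<xi> \<omega> / b))\<^sup>2 = 1 - 2 * exp (- (1 / b * \<xi> \<omega>)) + exp (- (2 / b * \<xi> \<omega>))" for \<omega>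
    proof -
      have "exp (- (2 / b * \<xi> \<omega>)) = exp (- (1 / b * \<xi> \<omega>)) * exp (- (1 / b * \<xi> \<omega>))"
        by (simp flip: exp_add)
      then show ?thesis by (simp add: power2_eq_square algebra_simps)
    qed
    then show ?thesis using that
      by (simp only:) (intro has_bochner_integral_add has_bochner_integral_diff one has_bochner_integral_mult_right hb; simp)
  qed
  have l: "has_bochner_integral M (\<lambda>\<omega>. 1 - exp (- \<xi> \<omega> / y)) (1 - E (1 / y))"
    using has_bochner_integral_diff[OF one hb[of "1 / y"]] y by simp
  define r where "r = (\<lambda>\<omega>. \<alpha> * 1 + \<beta> * (1 - exp (- \<xi> \<omega> / y)) + \<kappa> * (1 - exp (- \<xi> \<omega> / y))\<^sup>2 + \<kappa>' * (1 - exp (- \<xi> \<omega> / a))\<^sup>2)"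
  have r: "has_bochner_integral M r (\<alpha> * 1 + \<beta> * (1 - E (1 / y)) +
      \<kappa> * (1 - 2 * E (1 / y) + E (2 / y)) + \<kappa>' * (1 - 2 * E (1 / a) + E (2 / a)))"
    unfolding r_def by (intro has_bochner_integral_add has_bochner_integral_mult_right one l q y a)
  have hr: "h (y + \<xi> \<omega>) \<le> r \<omega>" for \<omega> using bd[of "\<xi> \<omega>"] by (simp add: r_def)
  have "(\<integral>\<^sup>+\<omega>. ennreal (h (y + \<xi> \<omega>)) \<partial>M) \<le> (\<integral>\<^sup>+\<omega>. ennreal (r \<omega>) \<partial>M)"
    using hr by (intro nn_integral_mono ennreal_leI)
  also have "\<dots> = ennreal (integral\<^sup>L M r)"
    using r order_trans[OF h0 hr] by (intro nn_integral_eq_integral) (auto simp: has_bochner_integral_iff)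
  finally show ?thesis using r by (simp add: has_bochner_integral_iff)
qed

section \<open>The chain driven by a fixed path\<close>

section \<open>Riemann sums of the clock\<close>

text \<open>Left endpoints, because \<open>chain_step\<close> advances the clock by the rate at the
  position before the move.\<close>

definition riemann_clock :: "(real \<Rightarrow> real) \<Rightarrow> real \<Rightarrow> nat \<Rightarrow> real" where
  "riemann_clock G \<Delta> k = \<Delta> * (\<Sum>j<k. G (real j * \<Delta>))"

lemma riemann_clock_mono:
  assumes "\<And>r. 0 \<le> G r" "0 \<le> \<Delta>" "k \<le> l" shows "riemann_clock G \<Delta> k \<le> riemann_clock G \<Delta> l"
  unfolding riemann_clock_def using assms by (intro mult_left_mono sum_mono2) auto

lemma chain_eq_path:
  assumes \<xi>: "\<And>i. \<xi> i = z (real (Suc i) * \<Delta>) - z (real i * \<Delta>)"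
    and running: "\<And>j. j < k \<Longrightarrow> \<not> z (real j * \<Delta>) < a \<and> \<not> T < riemann_clock (\<lambda>r. g (z r)) \<Delta> j"
  shows "chain g a T \<Delta> \<xi> (z 0) k = (z (real k * \<Delta>), riemann_clock (\<lambda>r. g (z r)) \<Delta> k)"
  using running
proof (induction k)
  case 0
  then show ?case by (simp add: riemann_clock_def)
next
  case (Suc k)
  then have "chain g a T \<Delta> \<xi> (z 0) k = (z (real k * \<Delta>), riemann_clock (\<lambda>r. g (z r)) \<Delta> k)" by simp
  then show ?case using Suc.prems[of k] \<xi>[of k]
    by (simp add: chain_step_def riemann_clock_def distrib_left)
qed

text \<open>The chain follows the path up to the least index at which the sampled path meets the
  stopping condition, and is constant afterwards; \<open>k\<close> only bounds that index.\<close>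

lemma chain_stopped:
  assumes \<xi>: "\<And>i. \<xi> i = z (real (Suc i) * \<Delta>) - z (real i * \<Delta>)"
    and stop: "z (real k * \<Delta>) < a \<or> T < riemann_clock (\<lambda>r. g (z r)) \<Delta> k" and "k \<le> K"
  obtains k0 where "k0 \<le> k" "z (real k0 * \<Delta>) < a \<or> T < riemann_clock (\<lambda>r. g (z r)) \<Delta> k0"
    "chain g a T \<Delta> \<xi> (z 0) K = (z (real k0 * \<Delta>), riemann_clock (\<lambda>r. g (z r)) \<Delta> k0)"
proof -
  define P where "P = (\<lambda>k. z (real k * \<Delta>) < a \<or> T < riemann_clock (\<lambda>r. g (z r)) \<Delta> k)"
  define k0 where "k0 = (LEAST k. P k)"
  have Pk: "P k" using stop by (simp add: P_def)
  have P0: "P k0" unfolding k0_def by (rule LeastI[of P, OF Pk])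
  have le: "k0 \<le> k" unfolding k0_def by (rule Least_le[of P, OF Pk])
  have nP: "\<not> P j" if "j < k0" for j using that unfolding k0_def by (rule not_less_Least)
  have "chain g a T \<Delta> \<xi> (z 0) (k0 + i) = (z (real k0 * \<Delta>), riemann_clock (\<lambda>r. g (z r)) \<Delta> k0)" for i
  proof (induction i)
    case 0
    show ?case using chain_eq_path[OF \<xi>, of k0 a T g] nP by (simp add: P_def)
  next
    case (Suc i)
    then show ?case using P0 by (simp add: chain_step_def P_def)
  qed
  from this[of "K - k0"] show ?thesis using that[of k0] le P0 \<open>k \<le> K\<close> by (simp add: P_def)
qed

text \<open>Strictly to the right of \<open>r\<close> even when \<open>r\<close> is a grid point, so
  that right-continuity gives convergence at every point as the mesh shrinks.\<close>

definition next_grid_point :: "real \<Rightarrow> real \<Rightarrow> real" where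
  "next_grid_point \<Delta> r = (real (nat \<lfloor>r / \<Delta>\<rfloor>) + 1) * \<Delta>"

lemma next_grid_point_bounds:
  assumes "\<Delta> > 0" "r \<ge> 0" shows "r < next_grid_point \<Delta> r" "next_grid_point \<Delta> r \<le> r + \<Delta>"
proof -
  have "r / \<Delta> < of_int \<lfloor>r / \<Delta>\<rfloor> + 1" "of_int \<lfloor>r / \<Delta>\<rfloor> \<le> r / \<Delta>" by linarith+
  moreover have "real (nat \<lfloor>r / \<Delta>\<rfloor>) = of_int \<lfloor>r / \<Delta>\<rfloor>" using assms by simp
  ultimately have "r / \<Delta> < real (nat \<lfloor>r / \<Delta>\<rfloor>) + 1" "real (nat \<lfloor>r / \<Delta>\<rfloor>) \<le> r / \<Delta>" by simp_all
  then have "r < (real (nat \<lfloor>r / \<Delta>\<rfloor>) + 1) * \<Delta>" "real (nat \<lfloor>r / \<Delta>\<rfloor>) * \<Delta> \<le> r"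
    using pos_divide_less_eq[OF assms(1)] pos_le_divide_eq[OF assms(1)] by blast+
  then show "r < next_grid_point \<Delta> r" "next_grid_point \<Delta> r \<le> r + \<Delta>"
    unfolding next_grid_point_def by (simp_all add: distrib_right)
qed

lemma integral_step_function:
  assumes \<Delta>: "\<Delta> > 0"
  shows "has_bochner_integral lborel (\<lambda>r. indicator {0..<real k * \<Delta>} r * G (next_grid_point \<Delta> r))
    (\<Delta> * (\<Sum>j<k. G ((real j + 1) * \<Delta>)) :: real)"
proof (induction k)
  case 0
  show ?case by (simp add: has_bochner_integral_zero)
next
  case (Suc k)
  have step: "has_bochner_integral lborel (\<lambda>r. indicator {real k * \<Delta>..<real (Suc k) * \<Delta>} r * G ((real k + 1) * \<Delta>))
      (measure lborel {real k * \<Delta>..<real (Suc k) * \<Delta>} * G ((real k + 1) * \<Delta>))"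
    by (intro has_bochner_integral_mult_left has_bochner_integral_real_indicator) (use \<Delta> in \<open>auto simp: emeasure_lborel_Ico distrib_right\<close>)
  have "measure lborel {real k * \<Delta>..<real (Suc k) * \<Delta>} = \<Delta>"
    using \<Delta> by (simp add: measure_def emeasure_lborel_Ico distrib_right)
  note sum = has_bochner_integral_add[OF Suc step[unfolded this]]
  have "indicator {0..<real k * \<Delta>} r * G (next_grid_point \<Delta> r) + indicator {real k * \<Delta>..<real (Suc k) * \<Delta>} r * G ((real k + 1) * \<Delta>)
     = indicator {0..<real (Suc k) * \<Delta>} r * G (next_grid_point \<Delta> r)" for r
  proof (cases "r \<in> {real k * \<Delta>..<real (Suc k) * \<Delta>}")
    case True
    then have "real k \<le> r / \<Delta>" "r / \<Delta> < real k + 1" using \<Delta> by (simp_all add: field_simps)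
    then have "\<lfloor>r / \<Delta>\<rfloor> = int k" by (simp add: floor_unique)
    moreover have "0 \<le> r" using True \<Delta> by (auto intro: order_trans[rotated])
    ultimately show ?thesis using True by (simp add: next_grid_point_def)
  next
    case False
    then have "r \<in> {0..<real (Suc k) * \<Delta>} \<longleftrightarrow> r \<in> {0..<real k * \<Delta>}"
      using \<Delta> by (auto simp: algebra_simps)
    then show ?thesis using False by (simp add: indicator_def)
  qed
  then show ?case using sum by (simp add: algebra_simps)
qed

section \<open>The integral clock of a bounded right-continuous rate\<close>

context
  fixes G :: "real \<Rightarrow> real" and C :: real
  assumes right_cont: "\<And>s. 0 \<le> s \<Longrightarrow> continuous (at_right s) G"
    and G_pos: "\<And>s. 0 < G s" and G_le: "\<And>s. G s \<le> C"
begin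

lemma tendsto_next_grid_point:
  assumes "0 \<le> r" shows "(\<lambda>n. G (next_grid_point (1 / real (Suc n)) r)) \<longlonglongrightarrow> G r"
proof -
  have "(\<lambda>n. next_grid_point (1 / real (Suc n)) r) \<longlonglongrightarrow> r"
  proof (rule tendsto_sandwich[of "\<lambda>_. r" _ _ "\<lambda>n. r + 1 / real (Suc n)"])
    show "(\<lambda>n. r + 1 / real (Suc n)) \<longlonglongrightarrow> r"
      using tendsto_add[OF tendsto_const LIMSEQ_inverse_real_of_nat, of r] by (simp add: inverse_eq_divide)
  qed (use next_grid_point_bounds[of "1 / real (Suc _)" r] assms in \<open>auto intro!: always_eventually less_imp_le\<close>)
  moreover have "r < next_grid_point (1 / real (Suc n)) r" for n
    using assms by (intro next_grid_point_bounds) auto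
  then have "next_grid_point (1 / real (Suc n)) r \<in> {r<..} \<and> next_grid_point (1 / real (Suc n)) r \<noteq> r" for n
    using less_imp_neq by (metis greaterThan_iff)
  ultimately have "filterlim (\<lambda>n. next_grid_point (1 / real (Suc n)) r) (at_right r) sequentially"
    unfolding filterlim_at by (simp add: always_eventually)
  moreover have "(G \<longlongrightarrow> G r) (at_right r)" using right_cont[OF assms] by (simp add: continuous_within)
  ultimately show ?thesis by (rule filterlim_compose[rotated])
qed

lemma measurable_next_grid_point [measurable]:
  "(\<lambda>r. G (next_grid_point \<Delta> r)) \<in> borel_measurable borel"
proof -
  have "(\<lambda>r::real. nat \<lfloor>r / \<Delta>\<rfloor>) \<in> borel \<rightarrow>\<^sub>M count_space UNIV" by measurable
  from measurable_compose[OF this, of "\<lambda>i. G ((real i + 1) * \<Delta>)" borel] show ?thesis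
    unfolding next_grid_point_def by simp
qed

text \<open>The step functions on the grid converge at every point by right-continuity, so the set
  of discontinuities need not be examined.\<close>

lemma right_continuous_measurable:
  "(\<lambda>r. indicator {0..s} r * G r) \<in> borel_measurable borel"
proof (rule borel_measurable_LIMSEQ_real)
  fix r :: real
  show "(\<lambda>n. indicator {0..s} r * G (next_grid_point (1 / real (Suc n)) r)) \<longlonglongrightarrow> indicator {0..s} r * G r"
    using tendsto_mult[OF tendsto_const tendsto_next_grid_point[of r]] by (cases "0 \<le> r") auto
qed measurable

definition "clock s = (\<integral>r. indicator {0..s} r * G r \<partial>lborel)"

lemma integrable_clock: "integrable lborel (\<lambda>r. indicator {0..s} r * G r)"
proof (rule Bochner_Integration.integrable_bound)
  show "integrable lborel (\<lambda>r. indicator {0..s} r * C)"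
    by (intro integrable_mult_left) (auto simp: emeasure_lborel_Icc_eq)
  have "\<bar>indicator {0..s} r * G r\<bar> \<le> \<bar>indicator {0..s} r * C\<bar>" for r
    using G_pos[of r] G_le[of r] by (auto split: split_indicator)
  then show "AE r in lborel. norm (indicator {0..s} r * G r) \<le> norm (indicator {0..s} r * C)" by simp
qed (use right_continuous_measurable in simp)

lemma nn_integral_clock:
  "(\<integral>\<^sup>+r. ennreal (indicator {0..s} r * G r) \<partial>lborel) = ennreal (clock s)"
  unfolding clock_def using less_imp_le[OF G_pos]
  by (intro nn_integral_eq_integral integrable_clock) auto

lemma clock_nonneg: "0 \<le> clock s"
  unfolding clock_def using less_imp_le[OF G_pos] by (intro integral_nonneg_AE) auto

lemma clock_0: "clock 0 = 0"
proof -
  have "clock 0 = (\<integral>r. 0 \<partial>(lborel :: real measure))" unfolding clock_def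
  proof (rule integral_cong_AE)
    show "AE r in lborel. indicator {0..0} r * G r = 0"
      using AE_lborel_singleton[of "0::real"] by eventually_elim simp
  qed (use right_continuous_measurable[of 0] in simp_all)
  then show ?thesis by simp
qed

lemma clock_diff:
  assumes "0 \<le> s" "s \<le> s'"
  shows "clock s' - clock s = (\<integral>r. indicator {s<..s'} r * G r \<partial>lborel)"
proof -
  have "clock s' - clock s = (\<integral>r. indicator {0..s'} r * G r - indicator {0..s} r * G r \<partial>lborel)"
    unfolding clock_def by (rule Bochner_Integration.integral_diff[symmetric]) (rule integrable_clock)+
  also have "\<dots> = (\<integral>r. indicator {s<..s'} r * G r \<partial>lborel)"
    using assms by (intro Bochner_Integration.integral_cong) (auto split: split_indicator)
  finally show ?thesis .
qed

lemma integrable_clock_diff: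
  assumes "0 \<le> s" "s \<le> s'" shows "integrable lborel (\<lambda>r. indicator {s<..s'} r * G r)"
proof -
  have "integrable lborel (\<lambda>r. indicator {0..s'} r * G r - indicator {0..s} r * G r)"
    by (intro Bochner_Integration.integrable_diff integrable_clock)
  also have "(\<lambda>r. indicator {0..s'} r * G r - indicator {0..s} r * G r) = (\<lambda>r. indicator {s<..s'} r * G r)"
    using assms by (auto split: split_indicator simp: fun_eq_iff)
  finally show ?thesis .
qed

lemma clock_lipschitz:
  assumes "0 \<le> s" "s \<le> s'" shows "clock s' - clock s \<le> C * (s' - s)"
proof -
  have "clock s' - clock s \<le> (\<integral>r. indicator {s<..s'} r * C \<partial>lborel)" unfolding clock_diff[OF assms]
    using assms G_le by (intro integral_mono integrable_clock_diff integrable_mult_left)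
      (auto simp: emeasure_lborel_Ioc split: split_indicator)
  also have "\<dots> = C * (s' - s)" using assms by (simp add: measure_def)
  finally show ?thesis .
qed

text \<open>Right-continuity keeps \<open>G\<close> above \<open>G s / 2\<close> on a short interval
  after \<open>s\<close>, and the rest of the integral is nonnegative.\<close>

lemma clock_strict_mono:
  assumes "0 \<le> s" "s < s'" shows "clock s < clock s'"
proof -
  have "(G \<longlongrightarrow> G s) (at_right s)" using right_cont[OF assms(1)] by (simp add: continuous_within)
  then have "\<forall>\<^sub>F r in at_right s. G s / 2 < G r" using G_pos[of s] by (intro order_tendstoD) auto
  then obtain b where b: "b > s" "\<And>r. s < r \<Longrightarrow> r < b \<Longrightarrow> G s / 2 < G r"
    unfolding eventually_at_right_field by auto
  define e where "e = min ((s + b) / 2) s'"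
  have e: "s < e" "e < b" "e \<le> s'" using b assms by (auto simp: e_def min_def)
  have "0 < G s / 2 * (e - s)" using e G_pos[of s] by simp
  also have "\<dots> = (\<integral>r. indicator {s<..e} r * (G s / 2) \<partial>lborel)" using e by (simp add: measure_def)
  also have "\<dots> \<le> (\<integral>r. indicator {s<..s'} r * G r \<partial>lborel)"
    using e b assms less_imp_le[OF G_pos] by (intro integral_mono integrable_clock_diff integrable_mult_left)
      (auto simp: emeasure_lborel_Ioc intro: less_imp_le split: split_indicator)
  also have "\<dots> = clock s' - clock s" using clock_diff assms by simp
  finally show ?thesis by simp
qed

lemma clock_continuous: "continuous_on {0..} clock"
proof (rule continuous_on_subset[OF lipschitz_on_continuous_on[of "\<bar>C\<bar>"]])
  show "lipschitz_on \<bar>C\<bar> {0..} clock"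
  proof (rule lipschitz_onI)
    have *: "\<bar>clock s - clock s'\<bar> \<le> \<bar>C\<bar> * \<bar>s - s'\<bar>" if "0 \<le> s" "s \<le> s'" for s s'
    proof -
      have "clock s \<le> clock s'" using clock_strict_mono[of s s'] that by (cases "s = s'") auto
      moreover have "C * (s' - s) \<le> \<bar>C\<bar> * (s' - s)" using that by (intro mult_right_mono) auto
      ultimately show ?thesis using clock_lipschitz[OF that] that by simp
    qed
    show "dist (clock s) (clock s') \<le> \<bar>C\<bar> * dist s s'" if "s \<in> {0..}" "s' \<in> {0..}" for s s'
      using *[of s s'] *[of s' s] that by (cases "s \<le> s'") (auto simp: dist_real_def abs_minus_commute)
  qed simp
qed simp

text \<open>Shifting the left-endpoint sums by one step costs at most \<open>2 C \<Delta>\<close> and turns them into right-endpoint sums, for which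
  right-continuity gives pointwise convergence at every time.\<close>
lemma riemann_clock_tendsto:
  assumes s: "0 \<le> s"
  shows "(\<lambda>n. riemann_clock G (1 / real (Suc n)) (nat \<lfloor>s * real (Suc n)\<rfloor>)) \<longlonglongrightarrow> clock s"
proof -
  define \<Delta> where "\<Delta> = (\<lambda>n. 1 / real (Suc n))"
  define k where "k = (\<lambda>n. nat \<lfloor>s * real (Suc n)\<rfloor>)"
  define I where "I = (\<lambda>n. \<integral>r. indicator {0..s} r * G (next_grid_point (\<Delta> n) r) \<partial>lborel)"
  have C0: "0 < C" using G_pos[of 0] G_le[of 0] by linarith
  have \<Delta>0: "\<Delta> n > 0" for n by (simp add: \<Delta>_def)
  have \<Delta>lim: "\<Delta> \<longlonglongrightarrow> 0" unfolding \<Delta>_def using LIMSEQ_inverse_real_of_nat by (simp add: inverse_eq_divide)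
  have intC: "integrable lborel (\<lambda>r. indicator {u..v} r * C)" for u v :: real
    by (intro integrable_mult_left) (auto simp: emeasure_lborel_Icc_eq)
  have int: "integrable lborel (\<lambda>r. indicator {0..s} r * G (next_grid_point (\<Delta> n) r))" for n
    by (rule Bochner_Integration.integrable_bound[OF intC[of 0 s]])
      (use G_le less_imp_le[OF G_pos] in \<open>auto simp: abs_of_nonneg abs_mult intro!: AE_I2 mult_left_mono order_trans[OF _ abs_ge_self]\<close>)
  have "I \<longlonglongrightarrow> clock s" unfolding I_def clock_def
  proof (rule integral_dominated_convergence[OF _ _ intC[of 0 s]])
    show "AE r in lborel. (\<lambda>n. indicator {0..s} r * G (next_grid_point (\<Delta> n) r)) \<longlonglongrightarrow> indicator {0..s} r * G r"
    proof (rule AE_I2)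
      fix r :: real
      show "(\<lambda>n. indicator {0..s} r * G (next_grid_point (\<Delta> n) r)) \<longlonglongrightarrow> indicator {0..s} r * G r"
        using tendsto_mult[OF tendsto_const tendsto_next_grid_point[of r]] unfolding \<Delta>_def by (cases "0 \<le> r") auto
    qed
    show "AE r in lborel. norm (indicator {0..s} r * G (next_grid_point (\<Delta> n) r)) \<le> indicator {0..s} r * C" for n
      using G_le less_imp_le[OF G_pos] by (auto simp: abs_mult intro!: AE_I2 mult_left_mono)
    show "(\<lambda>r. indicator {0..s} r * G r) \<in> borel_measurable lborel" using right_continuous_measurable by simp
  qed measurable
  moreover have "(\<lambda>n. riemann_clock G (\<Delta> n) (k n) - I n) \<longlonglongrightarrow> 0"
  proof (rule Lim_null_comparison[OF always_eventually])
    \<comment> \<open>One \<open>C * \<Delta> n\<close> for the shift of endpoints and one for the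
      cell that \<open>s\<close> cuts; the third is slack.\<close>
    show "\<forall>n. norm (riemann_clock G (\<Delta> n) (k n) - I n) \<le> 3 * C * \<Delta> n"
    proof
      fix n
      define d where "d = \<Delta> n" define K where "K = k n"
      have d: "d > 0" by (simp add: d_def \<Delta>0)
      have "real K = of_int \<lfloor>s / d\<rfloor>" using s by (simp add: K_def k_def d_def \<Delta>_def)
      then have "real K \<le> s / d" "s / d < real K + 1" by linarith+
      then have K: "real K * d \<le> s" "s < real K * d + d" using d by (simp_all add: field_simps)
      define J where "J = (\<integral>r. indicator {real K * d..s} r * G (next_grid_point d r) \<partial>lborel)"
      have hb: "has_bochner_integral lborel (\<lambda>r. indicator {0..<real K * d} r * G (next_grid_point d r)) (d * (\<Sum>j<K. G ((real j + 1) * d)))"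
        by (rule integral_step_function[OF d])
      have "I n - d * (\<Sum>j<K. G ((real j + 1) * d)) = (\<integral>r. indicator {0..s} r * G (next_grid_point d r)
          - indicator {0..<real K * d} r * G (next_grid_point d r) \<partial>lborel)"
        using hb int[of n] unfolding I_def d_def[symmetric]
        by (subst Bochner_Integration.integral_diff) (auto simp: has_bochner_integral_iff)
      also have "\<dots> = J" unfolding J_def using K d
        by (intro Bochner_Integration.integral_cong) (auto split: split_indicator intro: order_trans[rotated])
      finally have I: "I n = d * (\<Sum>j<K. G ((real j + 1) * d)) + J" by simp
      have J_le: "norm (indicator {real K * d..s} r * G (next_grid_point d r)) \<le> indicator {real K * d..s} r * C" for r
        using G_le[of "next_grid_point d r"] less_imp_le[OF G_pos] by (auto split: split_indicator)
      have "integrable lborel (\<lambda>r. indicator {real K * d..s} r * G (next_grid_point d r))"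
        by (rule Bochner_Integration.integrable_bound[OF intC[of "real K * d" s]])
          (use J_le in \<open>auto intro!: AE_I2 intro: order_trans[OF _ abs_ge_self]\<close>)
      then have "norm J \<le> (\<integral>r. indicator {real K * d..s} r * C \<partial>lborel)" unfolding J_def
        by (rule Bochner_Integration.integral_norm_bound_integral[OF _ intC J_le])
      also have "\<dots> = C * (s - real K * d)" using K by (simp add: measure_def)
      also have "\<dots> \<le> C * d" using K C0 by (intro mult_left_mono) auto
      finally have J: "\<bar>J\<bar> \<le> C * d" by simp
      have "(\<Sum>j<K. G ((real j + 1) * d)) - (\<Sum>j<K. G (real j * d)) = G (real K * d) - G 0"
        by (induction K) (auto simp: algebra_simps)
      then have "d * (\<Sum>j<K. G ((real j + 1) * d)) = riemann_clock G d K + d * (G (real K * d) - G 0)"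
        by (simp only: riemann_clock_def flip: distrib_left) simp
      moreover have "\<bar>d * (G (real K * d) - G 0)\<bar> \<le> d * C"
        unfolding abs_mult using d G_pos[of 0] G_pos[of "real K * d"] G_le[of 0] G_le[of "real K * d"]
        by (auto intro!: mult_left_mono simp: abs_le_iff)
      ultimately have "\<bar>riemann_clock G d K - I n\<bar> \<le> d * C + C * d" using I J unfolding abs_le_iff mult.commute[of d C] by (intro conjI) linarith+
      also have "\<dots> \<le> 3 * C * d" using d C0 by (simp add: algebra_simps)
      finally show "norm (riemann_clock G (\<Delta> n) (k n) - I n) \<le> 3 * C * \<Delta> n" by (simp add: d_def K_def)
    qed
    show "(\<lambda>n. 3 * C * \<Delta> n) \<longlonglongrightarrow> 0" using tendsto_mult[OF tendsto_const \<Delta>lim, of "3 * C"] by simp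
  qed
  ultimately have "(\<lambda>n. I n + (riemann_clock G (\<Delta> n) (k n) - I n)) \<longlonglongrightarrow> clock s + 0" by (rule tendsto_add)
  then show ?thesis by (simp add: \<Delta>_def k_def)
qed

end

section \<open>Grid approximations of a path and of its time change\<close>

section \<open>The time change along a path\<close>

lemma eventually_at_right_interval:
  fixes s :: real
  assumes "\<forall>\<^sub>F r in at_right s. P r" "P s"
  obtains e where "e > 0" "\<And>r. s \<le> r \<Longrightarrow> r < s + e \<Longrightarrow> P r"
proof -
  from assms(1) obtain b where b: "b > s" "\<And>r. s < r \<Longrightarrow> r < b \<Longrightarrow> P r"
    unfolding eventually_at_right_field by auto
  show ?thesis
  proof (rule that[of "b - s"])
    fix r assume "s \<le> r" "r < s + (b - s)"
    then show "P r" using b(2)[of r] assms(2) by (cases "r = s") auto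
  qed (use b in simp)
qed

lemma grid_index_bounds:
  assumes s: "0 \<le> s" and k: "k = nat \<lfloor>s * real (Suc n)\<rfloor>"
  shows "real k * (1 / real (Suc n)) \<le> s" "s < real k * (1 / real (Suc n)) + 1 / real (Suc n)"
    "s \<le> real (Suc n) \<Longrightarrow> k \<le> (Suc n)\<^sup>2"
    "\<And>j. real j * (1 / real (Suc n)) \<le> s \<Longrightarrow> j \<le> k"
proof -
  define m where "m = real (Suc n)"
  have m: "m > 0" by (simp add: m_def)
  have "0 \<le> s * m" using s m by simp
  then have rk: "real k = of_int \<lfloor>s * m\<rfloor>" by (simp add: k m_def)
  then have fl: "real k \<le> s * m" "s * m < real k + 1" by linarith+
  then have "real k / m \<le> s" "s < (real k + 1) / m" using m by (simp_all add: divide_le_eq less_divide_eq)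
  then show "real k * (1 / real (Suc n)) \<le> s" "s < real k * (1 / real (Suc n)) + 1 / real (Suc n)"
    unfolding m_def[symmetric] by (simp_all add: add_divide_distrib)
  show "k \<le> (Suc n)\<^sup>2" if "s \<le> real (Suc n)"
  proof -
    have "s * m \<le> m * m" using that m by (intro mult_right_mono) (auto simp: m_def)
    then have "real k \<le> m * m" using fl by linarith
    then have "real k \<le> real ((Suc n)\<^sup>2)" unfolding m_def power2_eq_square of_nat_mult .
    then show ?thesis by (simp only: of_nat_le_iff)
  qed
  show "j \<le> k" if "real j * (1 / real (Suc n)) \<le> s" for j
  proof -
    have "real j \<le> s * m" using that m unfolding m_def[symmetric] by (simp add: divide_le_eq)
    then have "int j \<le> \<lfloor>s * m\<rfloor>" by (simp add: le_floor_iff)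
    then show ?thesis using k by (simp add: m_def nat_le_iff le_nat_iff)
  qed
qed

text \<open>\<open>(Suc n)\<^sup>2\<close> steps of length \<open>1 / Suc n\<close> reach time
  \<open>Suc n\<close>: the mesh shrinks and the horizon grows with the same index.\<close>

definition grid_chain :: "(real \<Rightarrow> real) \<Rightarrow> (real \<Rightarrow> real) \<Rightarrow> real \<Rightarrow> real \<Rightarrow> nat \<Rightarrow> real \<times> real" where
  "grid_chain z g a T n = chain g a T (1 / real (Suc n))
     (\<lambda>i. z (real (Suc i) * (1 / real (Suc n))) - z (real i * (1 / real (Suc n)))) (z 0) ((Suc n)\<^sup>2)"

text \<open>No clock condition is attached to a low position, since a chain that drops below its
  stopping level may freeze before its clock reaches \<open>T\<close>. A high position is bad only
  once the clock has passed \<open>T\<close>; before that the chain is still on its way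
  down.\<close>

definition bad_state :: "real \<Rightarrow> real \<Rightarrow> real \<Rightarrow> (real \<times> real) set" where
  "bad_state c1 c2 T = {s. fst s < c2 \<or> c1 < fst s \<and> T < snd s}"

context
  fixes z :: "real \<Rightarrow> real" and g :: "real \<Rightarrow> real" and a C t c1 c2 :: real
  assumes z_cont: "\<And>s. 0 \<le> s \<Longrightarrow> continuous (at_right s) z"
    and g_cont: "\<And>y. isCont g y" and g_pos: "\<And>y. 0 < g y" and g_le: "\<And>y. g y \<le> C"
    and t: "0 \<le> t" and levels: "0 < a" "a \<le> c2" "c2 \<le> c1"
begin

lemma g_path_right_cont: "0 \<le> s \<Longrightarrow> continuous (at_right s) (\<lambda>r. g (z r))"
  using continuous_within_compose3[OF g_cont z_cont] by simp

abbreviation "path_clock \<equiv> clock (\<lambda>r. g (z r))"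

lemmas path_clock_facts = g_path_right_cont g_pos g_le

lemma eventually_small_grid: "e > 0 \<Longrightarrow> \<forall>\<^sub>F n in sequentially. 1 / real (Suc n) < e"
  using order_tendstoD(2)[OF LIMSEQ_inverse_real_of_nat, of e] by (simp add: inverse_eq_divide)

lemma eventually_large_grid: "\<forall>\<^sub>F n in sequentially. s \<le> real (Suc n)"
  using eventually_ge_at_top[of "nat \<lceil>s\<rceil>"] by eventually_elim linarith

text \<open>Right-continuity keeps the path below \<open>a\<close> for a short while after
  \<open>s0\<close>, short enough for the clock to stay below \<open>T\<close>. A fine grid has a
  point in that stretch, so the chain stops with its clock below \<open>T\<close>, hence because of
  its position, which is below \<open>a \<le> c2\<close>.\<close>

lemma grid_chain_early_crossing:
  assumes s0: "0 \<le> s0" "z s0 < a" "path_clock s0 \<le> t" and T: "t < T"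
  shows "\<forall>\<^sub>F n in sequentially. grid_chain z g a T n \<in> bad_state c1 c2 T"
proof -
  have C: "C > 0" using g_pos[of 0] g_le[of 0] by linarith
  have "(z \<longlongrightarrow> z s0) (at_right s0)" using z_cont[OF s0(1)] by (simp add: continuous_within)
  then have "\<forall>\<^sub>F r in at_right s0. z r < a" using s0 by (intro order_tendstoD) auto
  then obtain e where e: "e > 0" "\<And>r. s0 \<le> r \<Longrightarrow> r < s0 + e \<Longrightarrow> z r < a"
    using eventually_at_right_interval[where s = s0 and P = "\<lambda>r. z r < a"] s0 by auto
  \<comment> \<open>The first bound keeps \<open>s1\<close> where the path is below
    \<open>a\<close>, the second limits the growth of the clock to half of
    \<open>T - t\<close>.\<close>
  define d where "d = min (e / 2) ((T - t) / (2 * C))"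
  have "d \<le> e / 2" by (simp add: d_def)
  then have d: "d > 0" "d < e" using e(1) T C by (simp_all add: d_def)
  define s1 where "s1 = s0 + d"
  have "path_clock s1 - path_clock s0 \<le> C * d"
    using clock_lipschitz[OF path_clock_facts, of s0 s1] s0 d by (simp add: s1_def)
  also have "C * d \<le> C * ((T - t) / (2 * C))" using C by (intro mult_left_mono) (auto simp: d_def)
  also have "\<dots> < T - t" using C T by simp
  finally have clk: "path_clock s1 < T" using s0 by simp
  have s1: "0 \<le> s1" using s0 d by (simp add: s1_def)
  have "\<forall>\<^sub>F n in sequentially. riemann_clock (\<lambda>r. g (z r)) (1 / real (Suc n)) (nat \<lfloor>s1 * real (Suc n)\<rfloor>) < T"
    using order_tendstoD(2)[OF riemann_clock_tendsto[OF path_clock_facts s1] clk] .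
  with eventually_small_grid[OF d(1)] eventually_large_grid[of s1] show ?thesis
  proof eventually_elim
    case (elim n)
    define k where "k = nat \<lfloor>s1 * real (Suc n)\<rfloor>"
    note kb = grid_index_bounds[OF s1 k_def]
    have zk: "z (real k * (1 / real (Suc n))) < a"
      using kb(1,2) elim d by (intro e) (auto simp: s1_def)
    obtain k0 where k0: "k0 \<le> k" "z (real k0 * (1 / real (Suc n))) < a \<or> T < riemann_clock (\<lambda>r. g (z r)) (1 / real (Suc n)) k0"
      "grid_chain z g a T n = (z (real k0 * (1 / real (Suc n))), riemann_clock (\<lambda>r. g (z r)) (1 / real (Suc n)) k0)"
      unfolding grid_chain_def
      by (rule chain_stopped[OF refl, of z k "1 / real (Suc n)" a T g "(Suc n)\<^sup>2", OF disjI1[OF zk] kb(3)[OF elim(2)]])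
    have "riemann_clock (\<lambda>r. g (z r)) (1 / real (Suc n)) k0 \<le> riemann_clock (\<lambda>r. g (z r)) (1 / real (Suc n)) k"
      by (rule riemann_clock_mono) (use g_pos k0 in \<open>auto intro: less_imp_le\<close>)
    also have "\<dots> < T" using elim by (simp add: k_def)
    finally show ?case using k0 levels by (auto simp: bad_state_def)
  qed
qed

text \<open>Up to \<open>u\<close> the path is above \<open>a\<close> and the Riemann sums are below
  \<open>T\<close>, so the chain does not stop there. The sums pass \<open>T\<close> by time
  \<open>s1\<close>, and between \<open>u\<close> and \<open>s1\<close> the path is still out by
  right-continuity, so the chain stops while it is out. The bound \<open>T0\<close> is the clock at
  \<open>s1\<close>.\<close>

lemma grid_chain_exit:
  assumes u: "0 \<le> u" "path_clock u = t" and above: "\<And>r. 0 \<le> r \<Longrightarrow> r \<le> u \<Longrightarrow> a \<le> z r"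
    and out: "z u < c2 \<or> c1 < z u"
  shows "\<exists>T0>t. \<forall>T. t < T \<and> T < T0 \<longrightarrow> (\<forall>\<^sub>F n in sequentially. grid_chain z g a T n \<in> bad_state c1 c2 T)"
proof -
  have lim: "(z \<longlongrightarrow> z u) (at_right u)" using z_cont[OF u(1)] by (simp add: continuous_within)
  have "\<forall>\<^sub>F r in at_right u. z r < c2 \<or> c1 < z r"
    using out order_tendstoD(1)[OF lim, of c1] order_tendstoD(2)[OF lim, of c2] by (auto elim: eventually_mono)
  then obtain e where e: "e > 0" "\<And>r. u \<le> r \<Longrightarrow> r < u + e \<Longrightarrow> z r < c2 \<or> c1 < z r"
    using eventually_at_right_interval[where s = u and P = "\<lambda>r. z r < c2 \<or> c1 < z r"] out by auto
  define s1 where "s1 = u + e / 2"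
  have s1: "0 \<le> s1" "u < s1" "s1 < u + e" using e u by (auto simp: s1_def)
  have "t < path_clock s1" using clock_strict_mono[OF path_clock_facts u(1) s1(2)] u by simp
  moreover have "\<forall>\<^sub>F n in sequentially. grid_chain z g a T n \<in> bad_state c1 c2 T" if T: "t < T" "T < path_clock s1" for T
  proof -
    have "\<forall>\<^sub>F n in sequentially. T < riemann_clock (\<lambda>r. g (z r)) (1 / real (Suc n)) (nat \<lfloor>s1 * real (Suc n)\<rfloor>)"
      using order_tendstoD(1)[OF riemann_clock_tendsto[OF path_clock_facts s1(1)] T(2)] .
    moreover have "\<forall>\<^sub>F n in sequentially. riemann_clock (\<lambda>r. g (z r)) (1 / real (Suc n)) (nat \<lfloor>u * real (Suc n)\<rfloor>) < T"
      using order_tendstoD(2)[OF riemann_clock_tendsto[OF path_clock_facts u(1)]] T u by simp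
    ultimately show ?thesis using eventually_large_grid[of s1]
    proof eventually_elim
      case (elim n)
      define \<Delta> where "\<Delta> = 1 / real (Suc n)"
      define ck where "ck = riemann_clock (\<lambda>r. g (z r)) \<Delta>"
      define k where "k = nat \<lfloor>s1 * real (Suc n)\<rfloor>"
      define l where "l = nat \<lfloor>u * real (Suc n)\<rfloor>"
      note kb = grid_index_bounds[OF s1(1) k_def, folded \<Delta>_def]
      note lb = grid_index_bounds[OF u(1) l_def, folded \<Delta>_def]
      have clk: "T < ck k" "ck l < T" using elim by (simp_all add: ck_def \<Delta>_def k_def l_def)
      have mono: "ck i \<le> ck j" if "i \<le> j" for i j
        unfolding ck_def by (rule riemann_clock_mono) (use g_pos that in \<open>auto intro: less_imp_le simp: \<Delta>_def\<close>)
      obtain k0 where k0: "k0 \<le> k" "z (real k0 * \<Delta>) < a \<or> T < ck k0" "grid_chain z g a T n = (z (real k0 * \<Delta>), ck k0)"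
        unfolding grid_chain_def \<Delta>_def[symmetric] ck_def
        by (rule chain_stopped[OF refl, of z k \<Delta> a T g "(Suc n)\<^sup>2", OF disjI2[OF clk(1)[unfolded ck_def]] kb(3)[OF elim(3)]])
      have "u < real k0 * \<Delta>"
      proof (rule ccontr)
        assume "\<not> u < real k0 * \<Delta>"
        then have "real k0 * \<Delta> \<le> u" by simp
        then have "a \<le> z (real k0 * \<Delta>)" "k0 \<le> l" using lb(4) by (auto intro!: above simp: \<Delta>_def)
        then show False using k0(2) mono[of k0 l] clk(2) by linarith
      qed
      moreover have "real k0 * \<Delta> \<le> s1"
      proof -
        have "real k0 * \<Delta> \<le> real k * \<Delta>" using k0(1) by (intro mult_right_mono) (auto simp: \<Delta>_def)
        then show ?thesis using kb(1) by linarith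
      qed
      ultimately have "z (real k0 * \<Delta>) < c2 \<or> c1 < z (real k0 * \<Delta>)" using s1 by (intro e) auto
      \<comment> \<open>A stop above \<open>c1\<close> must be due to the clock, as
        \<open>c1 \<ge> a\<close>.\<close>
      then show ?case using k0 levels by (auto simp: bad_state_def)
    qed
  qed
  ultimately show ?thesis by (intro exI[of _ "path_clock s1"]) auto
qed

text \<open>The level \<open>a\<close> is crossed at some time, when the clock already exceeds
  \<open>t\<close>; this gives the intermediate value theorem its upper end.\<close>

lemma exists_clock_time:
  assumes hit: "0 \<le> s" "z s < a" and no_early: "\<And>s. 0 \<le> s \<Longrightarrow> z s < a \<Longrightarrow> t < path_clock s"
  obtains u where "0 \<le> u" "path_clock u = t" "\<And>r. 0 \<le> r \<Longrightarrow> r \<le> u \<Longrightarrow> a \<le> z r"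
proof -
  have "path_clock 0 \<le> t" using clock_0[OF path_clock_facts] t by simp
  moreover have "t \<le> path_clock s" using no_early[OF hit] by simp
  moreover have "continuous_on {0..s} path_clock"
    using clock_continuous[OF path_clock_facts] by (rule continuous_on_subset) auto
  ultimately obtain u where u: "0 \<le> u" "u \<le> s" "path_clock u = t"
    using IVT'[of path_clock 0 t s] hit by auto
  have "a \<le> z r" if r: "0 \<le> r" "r \<le> u" for r
  proof (rule ccontr)
    assume "\<not> a \<le> z r"
    then have "t < path_clock r" using no_early[of r] r by simp
    moreover have "path_clock r \<le> path_clock u"
      using clock_strict_mono[OF path_clock_facts, of r u] r by (cases "r = u") auto
    ultimately show False using u by simp
  qed
  then show ?thesis using that u by blast
qed

end

text \<open>Up to \<open>u\<close> the path stays above \<open>a\<close>, so \<open>eta\<close>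
  agrees with the truncated clock. Just after \<open>u\<close> right-continuity keeps the path
  positive, so \<open>tau0\<close> lies beyond \<open>u\<close> and \<open>eta\<close> grows
  strictly past \<open>t\<close>. Both facts are needed to identify \<open>u\<close> as the infimum
  in \<open>eta_inv\<close>, which asks for strict excess.\<close>

lemma Xproc_eq_at_clock_time:
  fixes L :: "real \<Rightarrow> 'a \<Rightarrow> real" and x :: real and \<omega> :: 'a
  defines "z \<equiv> \<lambda>s. x + L s \<omega>"
  assumes z_cont: "\<And>s. 0 \<le> s \<Longrightarrow> continuous (at_right s) z"
    and R_cont: "continuous_on {0..} R" and R_pos: "\<And>y. 0 < y \<Longrightarrow> 0 < R y"
    and a: "0 < a" and bound: "\<And>y. 1 / R (max y a) \<le> C"
    and u: "0 \<le> u" "clock (\<lambda>r. 1 / R (max (z r) a)) u = t" and above: "\<And>r. 0 \<le> r \<Longrightarrow> r \<le> u \<Longrightarrow> a \<le> z r"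
  shows "Xproc R L x t \<omega> = ereal (z u)"
proof -
  define G where "G = (\<lambda>r. 1 / R (max (z r) a))"
  have R_isCont: "isCont R y" if "0 < y" for y
  proof -
    have "continuous_on {0<..} R" by (rule continuous_on_subset[OF R_cont]) auto
    then show ?thesis using that by (simp add: continuous_on_eq_continuous_at)
  qed
  have Rmax: "0 < R (max y a)" for y using a by (intro R_pos) simp
  have gc: "isCont (\<lambda>y. 1 / R (max y a)) y" for y
  proof -
    have "isCont (\<lambda>y. max y a) y" by (intro continuous_intros)
    moreover have "isCont R (max y a)" using a by (intro R_isCont) simp
    ultimately have "isCont (\<lambda>y. R (max y a)) y" by (rule isCont_o2)
    moreover have "R (max y a) \<noteq> 0" using Rmax[of y] by simp
    ultimately show ?thesis by (intro isCont_divide continuous_const)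
  qed
  have Gc: "continuous (at_right s) G" if "0 \<le> s" for s
    unfolding G_def using continuous_within_compose3[OF gc z_cont[OF that]] by simp
  have Gp: "0 < G s" for s unfolding G_def using Rmax by simp
  have Gl: "G s \<le> C" for s unfolding G_def by (rule bound)
  note Gf = Gc Gp Gl
  have lim: "(z \<longlongrightarrow> z u) (at_right u)" using z_cont[OF u(1)] by (simp add: continuous_within)
  have zu: "a \<le> z u" using above u by simp
  \<comment> \<open>Half of the rate at \<open>u\<close>: a positive lower bound for the rate just
    after \<open>u\<close>, which pushes \<open>eta\<close> past \<open>t\<close>.\<close>
  define m where "m = 1 / (2 * R (z u))"
  have m: "m > 0" using R_pos[of "z u"] zu a by (simp add: m_def)
  have "((\<lambda>r. 1 / R (z r)) \<longlongrightarrow> 1 / R (z u)) (at_right u)"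
    using R_pos[of "z u"] zu a by (intro tendsto_intros isCont_tendsto_compose[OF R_isCont lim]) auto
  then have "\<forall>\<^sub>F r in at_right u. m < 1 / R (z r)" using R_pos[of "z u"] zu a
    by (intro order_tendstoD) (auto simp: m_def field_simps)
  moreover have "\<forall>\<^sub>F r in at_right u. 0 < z r" using zu a by (intro order_tendstoD(1)[OF lim]) simp
  ultimately have "\<forall>\<^sub>F r in at_right u. m < 1 / R (z r) \<and> 0 < z r" by (rule eventually_conj)
  moreover have "m < 1 / R (z u) \<and> 0 < z u" using R_pos[of "z u"] zu a by (simp add: m_def field_simps)
  ultimately obtain e where e: "e > 0" "\<And>r. u \<le> r \<Longrightarrow> r < u + e \<Longrightarrow> m < 1 / R (z r) \<and> 0 < z r"
    using eventually_at_right_interval[where s = u and P = "\<lambda>r. m < 1 / R (z r) \<and> 0 < z r"] by blast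
  have pos: "0 < z r" if "0 \<le> r" "r < u + e" for r
    using above[of r] e(2)[of r] that a by (cases "r \<le> u") auto
  have tau: "ereal (u + e) \<le> tau0 L x \<omega>" unfolding tau0_def
  proof (rule Inf_greatest)
    fix v assume "v \<in> ereal ` {s. 0 \<le> s \<and> x + L s \<omega> < 0}"
    then obtain s where s: "v = ereal s" "0 \<le> s" "z s < 0" by (auto simp: z_def)
    then show "ereal (u + e) \<le> v" using pos[of s] by (cases "s < u + e") auto
  qed
  have eta_le: "eta R L x \<omega> s \<le> ennreal t" if "s \<le> u" for s
  proof -
    have "eta R L x \<omega> s \<le> (\<integral>\<^sup>+r. ennreal (indicator {0..u} r * G r) \<partial>lborel)"
      unfolding eta_def
    proof (rule nn_integral_mono)
      fix r
      show "indicator {r. 0 \<le> r \<and> r \<le> s \<and> ereal r \<le> tau0 L x \<omega>} r * inverse (ennreal (R (x + L r \<omega>)))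
          \<le> ennreal (indicator {0..u} r * G r)"
      proof (cases "0 \<le> r \<and> r \<le> s")
        case True
        then have "a \<le> z r" using above that by simp
        then have "inverse (ennreal (R (x + L r \<omega>))) = ennreal (G r)"
          using R_pos[of "z r"] a by (simp add: G_def z_def inverse_ennreal max_def inverse_eq_divide)
        then show ?thesis using True that by (auto split: split_indicator)
      qed auto
    qed
    also have "\<dots> = ennreal t" using nn_integral_clock[OF Gf] u by (simp add: G_def)
    finally show ?thesis .
  qed
  have eta_gt: "ennreal t < eta R L x \<omega> s" if s: "u < s" "s < u + e" for s
  proof -
    have t0: "0 \<le> t" using clock_nonneg[OF Gf, of u] u by (simp add: G_def)
    have "ennreal t < ennreal t + ennreal (m * (s - u))" using m s t0
      by (simp add: ennreal_plus[symmetric] ennreal_less_iff del: ennreal_plus)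
    also have "ennreal t + ennreal (m * (s - u)) =
        (\<integral>\<^sup>+r. ennreal (indicator {0..u} r * G r) \<partial>lborel) + (\<integral>\<^sup>+r. ennreal m * indicator {u<..s} r \<partial>lborel)"
    proof (rule arg_cong2[where f = "(+)"])
      show "ennreal t = (\<integral>\<^sup>+r. ennreal (indicator {0..u} r * G r) \<partial>lborel)"
        using nn_integral_clock[OF Gf] u by (simp add: G_def)
      show "ennreal (m * (s - u)) = (\<integral>\<^sup>+r. ennreal m * indicator {u<..s} r \<partial>lborel)"
        using s m by (simp add: nn_integral_cmult_indicator emeasure_lborel_Ioc ennreal_mult)
    qed
    also have "\<dots>
        = (\<integral>\<^sup>+r. ennreal (indicator {0..u} r * G r) + ennreal m * indicator {u<..s} r \<partial>lborel)"
      using right_continuous_measurable[OF Gf, of u] by (intro nn_integral_add[symmetric]) auto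
    also have "\<dots> \<le> eta R L x \<omega> s" unfolding eta_def
    proof (rule nn_integral_mono)
      fix r :: real
      show "ennreal (indicator {0..u} r * G r) + ennreal m * indicator {u<..s} r \<le>
        indicator {r. 0 \<le> r \<and> r \<le> s \<and> ereal r \<le> tau0 L x \<omega>} r * inverse (ennreal (R (x + L r \<omega>)))"
      proof (cases "0 \<le> r \<and> r \<le> s")
        case True
        have "ereal r \<le> tau0 L x \<omega>" using True s by (intro order_trans[OF _ tau]) auto
        moreover have "inverse (ennreal (R (x + L r \<omega>))) = ennreal (1 / R (z r))"
          using R_pos pos[of r] True s by (simp add: z_def inverse_ennreal inverse_eq_divide)
        moreover have "G r = 1 / R (z r)" if "r \<le> u" using above[of r] that True by (simp add: G_def max_def)
        moreover have "m \<le> 1 / R (z r)" if "u < r" using e(2)[of r] that True s by auto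
        ultimately show ?thesis using True s(1) by (cases "r \<le> u") (auto simp: ennreal_leI)
      qed (use s u in \<open>auto split: split_indicator\<close>)
    qed
    finally show ?thesis .
  qed
  have inv: "eta_inv R L x \<omega> t = ereal u"
  proof (rule antisym)
    show "ereal u \<le> eta_inv R L x \<omega> t" unfolding eta_inv_def
    proof (rule Inf_greatest)
      fix v assume "v \<in> ereal ` {s. 0 \<le> s \<and> ennreal t < eta R L x \<omega> s}"
      then obtain s where s: "v = ereal s" "ennreal t < eta R L x \<omega> s" by auto
      then have "\<not> s \<le> u" using eta_le[of s] by (auto simp: not_less[symmetric])
      then show "ereal u \<le> v" using s by simp
    qed
    have inv_le: "eta_inv R L x \<omega> t \<le> ereal s" if "u < s" "s < u + e" for s
      unfolding eta_inv_def using eta_gt[OF that] that u by (intro Inf_lower) auto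
    show "eta_inv R L x \<omega> t \<le> ereal u"
    proof (rule ereal_le_epsilon2)
      fix d :: real assume d: "0 < d"
      have "eta_inv R L x \<omega> t \<le> ereal (u + min d (e / 2))" using d e by (intro inv_le) auto
      also have "\<dots> \<le> ereal u + ereal d" by simp
      finally show "eta_inv R L x \<omega> t \<le> ereal u + ereal d" .
    qed
  qed
  have "ereal u \<le> ereal (u + e)" using e by simp
  then have "ereal u \<le> tau0 L x \<omega>" using tau by (rule order_trans)
  then show ?thesis unfolding Xproc_def Let_def inv by (simp add: min_absorb1 z_def)
qed

section \<open>A scale-invariant smoothing of the tail integral\<close>

section \<open>Smoothing the tail integral\<close>

text \<open>\<open>f\<close> is comparable to \<open>\<phi>\<close> and smooth on the scale of its argument; all bounds are invariant under scaling.\<close>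
definition test_function :: "(real \<Rightarrow> real) \<Rightarrow> (real \<Rightarrow> real) \<Rightarrow> (real \<Rightarrow> real) \<Rightarrow> (real \<Rightarrow> real) \<Rightarrow> real \<Rightarrow> real \<Rightarrow> bool" where
  "test_function \<phi> f G G' C y0 \<longleftrightarrow> 0 < C \<and> 0 < y0 \<and> (\<forall>y\<ge>y0.
     (f has_real_derivative - G y) (at y) \<and> (G has_real_derivative G' y) (at y) \<and>
     0 < G y \<and> \<bar>G' y\<bar> \<le> C * G y / y \<and> 0 \<le> f y \<and> f y \<le> C * \<phi> y \<and>
     y * G y \<le> C * \<phi> y \<and> \<phi> y \<le> C * (y * G y))"

locale regular_tail =
  fixes \<phi> g :: "real \<Rightarrow> real" and \<gamma> :: real
  assumes \<gamma>_pos: "\<gamma> > 0" and g_pos: "\<And>y. 0 < y \<Longrightarrow> 0 < g y"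
    and g_cont: "continuous_on {0<..} g"
    and \<phi>_deriv: "\<And>y. 0 < y \<Longrightarrow> (\<phi> has_real_derivative - g y / \<gamma>) (at y)"
    and \<phi>_pos: "\<And>y. 0 < y \<Longrightarrow> 0 < \<phi> y" and \<phi>_lim: "(\<phi> \<longlongrightarrow> 0) at_top"
    and doubling: "\<And>r. 1 < r \<Longrightarrow> \<exists>C. \<forall>\<^sub>F y in at_top. \<phi> y \<le> C * \<phi> (r * y)"
    and decay: "\<And>r. 1 < r \<Longrightarrow> \<exists>c>0. \<forall>\<^sub>F y in at_top. (1 + c) * \<phi> (r * y) \<le> \<phi> y"
    \<comment> \<open>H3 says nothing about steps shorter than \<open>\<rho> z\<close>, hence the lower cutoff \<open>d\<close>.\<close>
    and almost_decreasing: "\<And>\<epsilon>. 0 < \<epsilon> \<Longrightarrow>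
      \<exists>\<rho>>0. \<exists>d>0. \<forall>x u. d \<le> u \<longrightarrow> u \<le> \<rho> * x \<longrightarrow> g (x + u) \<le> (1 + \<epsilon>) * g x"
begin

lemma \<phi>_strict_decreasing:
  assumes "0 < x" "x < y" shows "\<phi> y < \<phi> x"
proof (rule DERIV_neg_imp_decreasing[OF assms(2)])
  fix u assume "x \<le> u"
  with assms(1) show "\<exists>d. (\<phi> has_real_derivative d) (at u) \<and> d < 0"
    using \<phi>_deriv[of u] g_pos[of u] \<gamma>_pos by (intro exI[of _ "- g u / \<gamma>"]) (auto simp: divide_neg_pos)
qed

lemma \<phi>_decreasing: "0 < x \<Longrightarrow> x \<le> y \<Longrightarrow> \<phi> y \<le> \<phi> x"
  using \<phi>_strict_decreasing[of x y] by (cases "x = y") auto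

lemma \<phi>_mvt:
  assumes "0 < x" "x < y"
  obtains \<xi> where "x < \<xi>" "\<xi> < y" "\<phi> x - \<phi> y = (y - x) * g \<xi> / \<gamma>"
proof -
  obtain \<xi> where "x < \<xi>" "\<xi> < y" "\<phi> y - \<phi> x = (y - x) * (- g \<xi> / \<gamma>)"
    using MVT2[OF assms(2), of \<phi> "\<lambda>y. - g y / \<gamma>"] \<phi>_deriv assms(1) by auto
  then show ?thesis using that[of \<xi>] by (simp add: algebra_simps)
qed

lemma doubling_pos:
  assumes "1 < r" obtains C where "C > 0" "\<forall>\<^sub>F y in at_top. \<phi> y \<le> C * \<phi> (r * y)"
proof -
  obtain C where C: "\<forall>\<^sub>F y in at_top. \<phi> y \<le> C * \<phi> (r * y)" using doubling[OF assms] by blast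
  have "\<forall>\<^sub>F y in at_top. \<phi> y \<le> max C 1 * \<phi> (r * y)" using C eventually_gt_at_top[of 0]
  proof eventually_elim
    case (elim y)
    have "C * \<phi> (r * y) \<le> max C 1 * \<phi> (r * y)" using \<phi>_pos[of "r * y"] elim assms by (intro mult_right_mono) auto
    then show ?case using elim by simp
  qed
  then show ?thesis by (intro that[of "max C 1"]) auto
qed

lemma eventually_scale:
  assumes "s > 0" "eventually P at_top" shows "\<forall>\<^sub>F y in at_top. P (s * y :: real)"
  using filterlim_tendsto_pos_mult_at_top[OF tendsto_const assms(1) filterlim_ident] assms(2)
  by (simp add: filterlim_iff)

definition "avg r y = (\<phi> y - \<phi> (r * y)) / ((r - 1) * y)"
definition "avg' r y = (r * g (r * y) - g y) / (\<gamma> * ((r - 1) * y)) - avg r y / y"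
text \<open>\<open>smooth r y\<close> is \<open>1 / (r - 1)\<close> times the integral of \<open>\<phi> u / u\<close> over \<open>[y, r y]\<close>, and \<open>\<gamma> avg r y\<close> is the average of \<open>g\<close> there.\<close>
definition "log_antideriv y = integral {1..y} (\<lambda>u. \<phi> u / u)"
definition "smooth r y = (log_antideriv (r * y) - log_antideriv y) / (r - 1)"

lemma avg_pos: "1 < r \<Longrightarrow> 0 < y \<Longrightarrow> 0 < avg r y"
  using \<phi>_strict_decreasing[of y "r * y"] by (simp add: avg_def)

lemma avg_eq_g:
  assumes "1 < r" "0 < y" obtains \<xi> where "y < \<xi>" "\<xi> < r * y" "\<gamma> * avg r y = g \<xi>"
proof -
  obtain \<xi> where \<xi>: "y < \<xi>" "\<xi> < r * y" "\<phi> y - \<phi> (r * y) = (r * y - y) * g \<xi> / \<gamma>"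
    using \<phi>_mvt[of y "r * y"] assms by auto
  have eq: "r * y - y = (r - 1) * y" by (simp add: algebra_simps)
  have "(r - 1) * y \<noteq> 0" using assms by simp
  then have "\<gamma> * avg r y = g \<xi>" using \<xi>(3) \<gamma>_pos unfolding avg_def eq by simp
  then show ?thesis using that \<xi> by blast
qed

lemma avg_deriv:
  assumes "1 < r" "0 < y" shows "(avg r has_real_derivative avg' r y) (at y)"
proof -
  have d: "((\<lambda>y. \<phi> (r * y)) has_real_derivative (- g (r * y) / \<gamma>) * r) (at y)"
    using assms by (intro DERIV_chain2[OF \<phi>_deriv]) (auto intro!: derivative_eq_intros)
  have nz: "(r - 1) * y \<noteq> 0" using assms by simp
  have "((\<lambda>y. (\<phi> y - \<phi> (r * y)) / ((r - 1) * y)) has_real_derivative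
      ((- g y / \<gamma> - (- g (r * y) / \<gamma>) * r) * ((r - 1) * y) - (\<phi> y - \<phi> (r * y)) * (r - 1)) / (((r - 1) * y) * ((r - 1) * y))) (at y)"
    by (intro DERIV_divide DERIV_diff \<phi>_deriv d) (use assms nz in \<open>auto intro!: derivative_eq_intros\<close>)
  also have "((- g y / \<gamma> - (- g (r * y) / \<gamma>) * r) * ((r - 1) * y) - (\<phi> y - \<phi> (r * y)) * (r - 1)) / (((r - 1) * y) * ((r - 1) * y)) = avg' r y"
  proof -
    define A where "A = - g y / \<gamma> - (- g (r * y) / \<gamma>) * r"
    define D where "D = \<phi> y - \<phi> (r * y)"
    define w where "w = r - 1"
    have w: "w \<noteq> 0" "y \<noteq> 0" using assms by (auto simp: w_def)
    have "(A * (w * y) - D * w) / ((w * y) * (w * y)) = A / (w * y) - D / (w * y) / y"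
      using w by (simp add: field_simps)
    moreover have "A / (w * y) = (r * g (r * y) - g y) / (\<gamma> * (w * y))"
      using w \<gamma>_pos by (simp add: A_def field_simps)
    ultimately show ?thesis by (simp add: avg'_def avg_def A_def D_def w_def)
  qed
  finally show ?thesis unfolding avg_def .
qed

lemma log_antideriv_deriv:
  assumes "1 < y" shows "(log_antideriv has_real_derivative \<phi> y / y) (at y)"
proof -
  have "isCont (\<lambda>u. \<phi> u / u) u" if "1 \<le> u" for u
    using that DERIV_isCont[OF \<phi>_deriv[of u]] by (intro isCont_divide) auto
  then have "continuous_on {1..y + 1} (\<lambda>u. \<phi> u / u)" by (intro continuous_at_imp_continuous_on) auto
  then have "((\<lambda>y. integral {1..y} (\<lambda>u. \<phi> u / u)) has_real_derivative \<phi> y / y) (at y within {1..y + 1})"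
    using assms by (intro integral_has_real_derivative) auto
  moreover have "at y within {1..y + 1} = at y" using assms by (intro at_within_interior) auto
  ultimately show ?thesis unfolding log_antideriv_def by simp
qed

text \<open>The measure \<open>du / u\<close> is invariant under scaling, so differentiating the
  integral of \<open>\<phi> u / u\<close> over \<open>[y, r * y]\<close> leaves
  \<open>(\<phi> (r * y) - \<phi> y) / y\<close>: a difference of \<open>\<phi>\<close>, hence an
  average of \<open>g\<close>.\<close>

lemma smooth_deriv:
  assumes "1 < r" "1 < y" shows "(smooth r has_real_derivative - avg r y) (at y)"
proof -
  have ry: "1 < r * y" using assms by (metis less_1_mult)
  have "((\<lambda>y. log_antideriv (r * y)) has_real_derivative \<phi> (r * y) / (r * y) * r) (at y)"
    by (rule DERIV_chain2[where f = log_antideriv and g = "\<lambda>y. r * y" and x = y, OF log_antideriv_deriv[OF ry]]) (auto intro!: derivative_eq_intros)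
  then have "((\<lambda>y. (log_antideriv (r * y) - log_antideriv y) / (r - 1)) has_real_derivative
      (\<phi> (r * y) / (r * y) * r - \<phi> y / y) / (r - 1)) (at y)"
    by (intro DERIV_cdivide DERIV_diff log_antideriv_deriv assms)
  moreover have "(\<phi> (r * y) / (r * y) * r - \<phi> y / y) / (r - 1) = - avg r y"
  proof -
    have "\<phi> (r * y) / (r * y) * r = \<phi> (r * y) / y" using assms by simp
    then have "(\<phi> (r * y) / (r * y) * r - \<phi> y / y) / (r - 1) = ((\<phi> (r * y) - \<phi> y) / y) / (r - 1)"
      by (simp only: diff_divide_distrib)
    also have "\<dots> = - ((\<phi> y - \<phi> (r * y)) / y / (r - 1))"
      by (simp add: diff_divide_distrib)
    also have "\<dots> = - avg r y" by (simp add: avg_def mult.commute)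
    finally show ?thesis .
  qed
  ultimately show ?thesis unfolding smooth_def by simp
qed

lemma smooth_bounds:
  assumes "1 < r" "1 < y" shows "\<phi> (r * y) / r \<le> smooth r y" "smooth r y \<le> \<phi> y"
proof -
  have lt: "y < r * y" using assms by simp
  obtain \<xi> where \<xi>: "y < \<xi>" "\<xi> < r * y" "log_antideriv (r * y) - log_antideriv y = (r * y - y) * (\<phi> \<xi> / \<xi>)"
    using MVT2[OF lt, of log_antideriv "\<lambda>y. \<phi> y / y"] log_antideriv_deriv assms by auto
  have "r * y - y = (r - 1) * y" by (simp add: algebra_simps)
  then have eq: "smooth r y = y / \<xi> * \<phi> \<xi>" using \<xi>(3) assms by (simp add: smooth_def)
  have pos: "0 < \<xi>" "0 < \<phi> \<xi>" using \<xi> assms \<phi>_pos by auto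
  have "1 / r \<le> y / \<xi>" "y / \<xi> \<le> 1" using \<xi> pos assms by (simp_all add: divide_le_eq le_divide_eq mult.commute)
  moreover have "\<phi> (r * y) \<le> \<phi> \<xi>" "\<phi> \<xi> \<le> \<phi> y" using \<xi> pos assms by (auto intro!: \<phi>_decreasing)
  moreover have "0 < \<phi> (r * y)" "0 < y / \<xi>" using assms pos by (auto intro!: \<phi>_pos)
  ultimately show "\<phi> (r * y) / r \<le> smooth r y" "smooth r y \<le> \<phi> y"
    using mult_mono[of "1 / r" "y / \<xi>" "\<phi> (r * y)" "\<phi> \<xi>"] mult_mono[of "y / \<xi>" 1 "\<phi> \<xi>" "\<phi> y"] pos
    unfolding eq by auto
qed

text \<open>Such a \<open>w\<close> is at least \<open>(r - 1) * x\<close> away from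
  \<open>x\<close>, beyond the cutoff \<open>d\<close> once \<open>y\<close> is large, and at most
  \<open>(r\<^sup>2 - 1) * x\<close>, which \<open>r0 = sqrt (1 + \<rho>)\<close> keeps below
  \<open>\<rho> * x\<close>.\<close>

lemma almost_decreasing_window:
  assumes "0 < \<delta>"
  obtains r0 where "r0 > 1" "\<And>r. 1 < r \<Longrightarrow> r \<le> r0 \<Longrightarrow>
    \<forall>\<^sub>F y in at_top. \<forall>x w. y \<le> x \<longrightarrow> r * x \<le> w \<longrightarrow> w \<le> r\<^sup>2 * x \<longrightarrow> g w \<le> (1 + \<delta>) * g x"
proof -
  obtain \<rho> d where \<rho>: "\<rho> > 0" "d > 0"
    and ad: "\<And>x u. d \<le> u \<Longrightarrow> u \<le> \<rho> * x \<Longrightarrow> g (x + u) \<le> (1 + \<delta>) * g x"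
    using almost_decreasing[OF assms] by blast
  define r0 where "r0 = sqrt (1 + \<rho>)"
  show ?thesis
  proof (rule that[of r0])
    show "r0 > 1" using \<rho> by (simp add: r0_def)
    fix r assume r: "1 < r" "r \<le> r0"
    have "r\<^sup>2 \<le> r0\<^sup>2" using r by (intro power_mono) auto
    then have r2: "r\<^sup>2 \<le> 1 + \<rho>" using \<rho> by (simp add: r0_def)
    show "\<forall>\<^sub>F y in at_top. \<forall>x w. y \<le> x \<longrightarrow> r * x \<le> w \<longrightarrow> w \<le> r\<^sup>2 * x \<longrightarrow> g w \<le> (1 + \<delta>) * g x"
      using eventually_ge_at_top[of "d / (r - 1)"] eventually_gt_at_top[of 0]
    proof eventually_elim
      case (elim y)
      show ?case
      proof (intro allI impI)
        fix x w assume H: "y \<le> x" "r * x \<le> w" "w \<le> r\<^sup>2 * x"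
        have "d \<le> y * (r - 1)" using elim r by (simp add: divide_le_eq)
        also have "\<dots> \<le> x * (r - 1)" using H r by (intro mult_right_mono) auto
        finally have "d \<le> w - x" using H by (simp add: algebra_simps)
        moreover have "r\<^sup>2 * x \<le> (1 + \<rho>) * x" using r2 H elim by (intro mult_right_mono) auto
        then have "w - x \<le> \<rho> * x" using H by (simp add: algebra_simps)
        ultimately show "g w \<le> (1 + \<delta>) * g x" using ad[of "w - x" x] by simp
      qed
    qed
  qed
qed

text \<open>Every point of \<open>[y, r * y]\<close> precedes \<open>r\<^sup>2 * y\<close> by a
  factor between \<open>r\<close> and \<open>r\<^sup>2\<close>, so each value of \<open>g\<close> in
  the average dominates the one at \<open>r\<^sup>2 * y\<close> up to
  \<open>1 + \<delta>\<close>.\<close>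

lemma g_le_avg:
  assumes r: "1 < r" and win: "\<And>x w. y \<le> x \<Longrightarrow> r * x \<le> w \<Longrightarrow> w \<le> r\<^sup>2 * x \<Longrightarrow> g w \<le> (1 + \<delta>) * g x" and y: "0 < y"
  shows "g (r\<^sup>2 * y) \<le> (1 + \<delta>) * (\<gamma> * avg r y)"
proof -
  obtain \<xi> where \<xi>: "y < \<xi>" "\<xi> < r * y" "\<gamma> * avg r y = g \<xi>" using avg_eq_g[OF r y] .
  have "r * \<xi> \<le> r * (r * y)" using \<xi> r by (intro mult_left_mono) auto
  moreover have "r\<^sup>2 * y \<le> r\<^sup>2 * \<xi>" using \<xi> by (intro mult_left_mono) auto
  ultimately show ?thesis using win[of \<xi> "r\<^sup>2 * y"] \<xi> by (simp add: power2_eq_square mult.assoc)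
qed

text \<open>The mirror case: every point of \<open>[r * y, r\<^sup>2 * y]\<close> follows
  \<open>y\<close> by such a factor.\<close>

lemma avg_le_g:
  assumes r: "1 < r" and win: "\<And>x w. y \<le> x \<Longrightarrow> r * x \<le> w \<Longrightarrow> w \<le> r\<^sup>2 * x \<Longrightarrow> g w \<le> (1 + \<delta>) * g x" and y: "0 < y"
  shows "\<gamma> * avg r (r * y) \<le> (1 + \<delta>) * g y"
proof -
  obtain \<xi> where \<xi>: "r * y < \<xi>" "\<xi> < r * (r * y)" "\<gamma> * avg r (r * y) = g \<xi>" using avg_eq_g[OF r, of "r * y"] y r by auto
  then show ?thesis using win[of y \<xi>] by (simp add: power2_eq_square mult.assoc)
qed

text \<open>The comparison of \<open>y * avg r y\<close> with \<open>\<phi> y\<close> rests on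
  \<open>decay\<close>, which makes \<open>\<phi> y - \<phi> (r * y)\<close> a fixed fraction of
  \<open>\<phi> y\<close>. The derivative \<open>avg'\<close> involves \<open>g\<close> at the two
  endpoints; there \<open>y * g y \<le> B * \<phi> y\<close> follows from \<open>g_le_avg\<close>
  and \<open>doubling\<close>.\<close>

lemma avg_bounds:
  assumes r: "1 < r"
    and window: "\<forall>\<^sub>F y in at_top. \<forall>x w. y \<le> x \<longrightarrow> r * x \<le> w \<longrightarrow> w \<le> r\<^sup>2 * x \<longrightarrow> g w \<le> (1 + \<delta>) * g x"
    and \<delta>: "\<delta> > 0"
  obtains C where "C > 0" "\<forall>\<^sub>F y in at_top. \<bar>avg' r y\<bar> \<le> C * avg r y / y \<and>
    y * avg r y \<le> C * \<phi> y \<and> \<phi> y \<le> C * (y * avg r y)"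
proof -
  have r2: "1 < r\<^sup>2" using r by (simp add: one_less_power)
  obtain c where c: "c > 0" "\<forall>\<^sub>F y in at_top. (1 + c) * \<phi> (r * y) \<le> \<phi> y" using decay[OF r] by blast
  obtain D where D: "D > 0" "\<forall>\<^sub>F y in at_top. \<phi> y \<le> D * \<phi> (r\<^sup>2 * y)" using doubling_pos[OF r2] .
  \<comment> \<open>By \<open>decay\<close>, \<open>\<phi> y - \<phi> (r * y)\<close> is at least
    \<open>c / (1 + c) * \<phi> y\<close>; the factor \<open>r - 1\<close> is the one in
    \<open>avg\<close>.\<close>
  define K where "K = (r - 1) * (1 + c) / c"
  define B where "B = (1 + \<delta>) * \<gamma> * r\<^sup>2 / (r - 1) * D"
  define C where "C = max (max K (1 / (r - 1))) (((r + 1) * B * K) / (\<gamma> * (r - 1)) + 1)"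
  have K: "K > 0" using r c by (simp add: K_def)
  have B: "B > 0" using r D \<delta> \<gamma>_pos by (simp add: B_def)
  have up: "y * avg r y \<le> 1 / (r - 1) * \<phi> y" if "y > 0" for y
  proof -
    have "y * avg r y = 1 / (r - 1) * (\<phi> y - \<phi> (r * y))" using that by (simp add: avg_def)
    also have "\<dots> \<le> 1 / (r - 1) * \<phi> y" using \<phi>_pos[of "r * y"] that r by (intro mult_left_mono) auto
    finally show ?thesis .
  qed
  have gB: "\<forall>\<^sub>F y in at_top. y * g y \<le> B * \<phi> y"
  proof -
    have "\<forall>\<^sub>F y in at_top. (r\<^sup>2 * y) * g (r\<^sup>2 * y) \<le> B * \<phi> (r\<^sup>2 * y)"
      using window D(2) eventually_gt_at_top[of 0]
    proof eventually_elim
      case (elim y)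
      have "g (r\<^sup>2 * y) \<le> (1 + \<delta>) * (\<gamma> * avg r y)" using elim r by (intro g_le_avg) auto
      then have "(r\<^sup>2 * y) * g (r\<^sup>2 * y) \<le> (r\<^sup>2 * y) * ((1 + \<delta>) * (\<gamma> * avg r y))"
        using elim by (intro mult_left_mono) auto
      also have "\<dots> = (1 + \<delta>) * \<gamma> * r\<^sup>2 * (y * avg r y)" by simp
      also have "\<dots> \<le> (1 + \<delta>) * \<gamma> * r\<^sup>2 * (1 / (r - 1) * \<phi> y)" using up[of y] elim \<gamma>_pos \<delta> by (intro mult_left_mono) auto
      also have "\<dots> \<le> (1 + \<delta>) * \<gamma> * r\<^sup>2 * (1 / (r - 1) * (D * \<phi> (r\<^sup>2 * y)))"
        using elim \<gamma>_pos \<delta> r by (intro mult_left_mono) auto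
      also have "\<dots> = B * \<phi> (r\<^sup>2 * y)" by (simp add: B_def)
      finally show ?case .
    qed
    from eventually_scale[of "1 / r\<^sup>2", OF _ this] show ?thesis using r by simp
  qed
  have gBr: "\<forall>\<^sub>F y in at_top. (r * y) * g (r * y) \<le> B * \<phi> (r * y)" using eventually_scale[OF _ gB, of r] r by simp
  have "\<forall>\<^sub>F y in at_top. \<bar>avg' r y\<bar> \<le> C * avg r y / y \<and> y * avg r y \<le> C * \<phi> y \<and> \<phi> y \<le> C * (y * avg r y)"
    using gB gBr c(2) eventually_gt_at_top[of 0]
  proof eventually_elim
    case (elim y)
    have pos: "0 < \<phi> y" "0 < \<phi> (r * y)" "0 < g y" "0 < g (r * y)" "0 < avg r y"
      using elim r by (auto intro!: \<phi>_pos g_pos avg_pos)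
    have lowK: "\<phi> y \<le> K * (y * avg r y)"
    proof -
      have "K * (y * avg r y) = (1 + c) / c * (\<phi> y - \<phi> (r * y))" using elim r by (simp add: K_def avg_def)
      moreover have "c * \<phi> y \<le> (1 + c) * (\<phi> y - \<phi> (r * y))" using elim by (simp add: algebra_simps)
      then have "\<phi> y \<le> (1 + c) / c * (\<phi> y - \<phi> (r * y))" using c by (simp add: field_simps)
      ultimately show ?thesis by simp
    qed
    have C1: "K \<le> C" "1 / (r - 1) \<le> C" "((r + 1) * B * K) / (\<gamma> * (r - 1)) + 1 \<le> C" by (auto simp: C_def)
    have "0 \<le> y * avg r y" using pos elim by simp
    then have "\<phi> y \<le> C * (y * avg r y)" by (rule order_trans[OF lowK mult_right_mono[OF C1(1)]])
    moreover have "y * avg r y \<le> C * \<phi> y" using mult_right_mono[OF C1(2), of "\<phi> y"] up[of y] pos elim by linarith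
    moreover have "\<bar>avg' r y\<bar> \<le> C * avg r y / y"
    proof -
      have gy: "g y \<le> B * \<phi> y / y" using elim by (simp add: le_divide_eq mult.commute)
      have "r * g (r * y) \<le> B * \<phi> (r * y) / y" using elim by (simp add: le_divide_eq mult_ac)
      also have "\<dots> \<le> B * \<phi> y / y" using elim B r \<phi>_decreasing[of y "r * y"] by (intro divide_right_mono mult_left_mono) auto
      finally have gry: "r * g (r * y) \<le> B * \<phi> y / y" .
      have X: "\<bar>r * g (r * y) - g y\<bar> \<le> B * \<phi> y / y"
        using gy gry pos r by (auto simp: abs_le_iff intro: order_trans[rotated] less_imp_le mult_pos_pos)
      also have "\<dots> \<le> B * (K * (y * avg r y)) / y" using lowK B elim by (intro divide_right_mono mult_left_mono) auto
      also have "\<dots> = B * K * avg r y" using elim by simp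
      also have "\<dots> \<le> (r + 1) * B * K * avg r y" using r B K pos by (simp add: algebra_simps)
      finally have X: "\<bar>r * g (r * y) - g y\<bar> \<le> (r + 1) * B * K * avg r y" .
      have den: "0 < \<gamma> * ((r - 1) * y)" using \<gamma>_pos r elim by simp
      have "\<bar>avg' r y\<bar> \<le> \<bar>r * g (r * y) - g y\<bar> / (\<gamma> * ((r - 1) * y)) + avg r y / y"
      proof -
        have "\<bar>(r * g (r * y) - g y) / (\<gamma> * ((r - 1) * y))\<bar> = \<bar>r * g (r * y) - g y\<bar> / (\<gamma> * ((r - 1) * y))"
          by (simp only: abs_divide abs_of_pos[OF den])
        moreover have "\<bar>avg r y / y\<bar> = avg r y / y" using pos elim by simp
        ultimately show ?thesis unfolding avg'_def
          using abs_triangle_ineq4[of "(r * g (r * y) - g y) / (\<gamma> * ((r - 1) * y))" "avg r y / y"] by (simp only:)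
      qed
      also have "\<dots> \<le> (r + 1) * B * K * avg r y / (\<gamma> * ((r - 1) * y)) + avg r y / y"
        using X den by (intro add_right_mono divide_right_mono) auto
      also have "\<dots> = (((r + 1) * B * K) / (\<gamma> * (r - 1)) + 1) * (avg r y / y)"
        using \<gamma>_pos r elim by (simp add: field_simps)
      also have "\<dots> \<le> C * (avg r y / y)" using C1(3) pos elim by (intro mult_right_mono) auto
      finally show ?thesis by simp
    qed
    ultimately show ?case by blast
  qed
  moreover have "C > 0" using K by (simp add: C_def)
  ultimately show ?thesis using that by blast
qed

text \<open>Rescaling the argument by \<open>s\<close> moves the averaging interval to
  \<open>[s * y, r * s * y]\<close>; division by \<open>s\<close> keeps the derivative free of an
  extra factor. The predicate \<open>P\<close> puts further eventual properties under the same
  \<open>y0\<close>.\<close>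

lemma scaled_test_function:
  assumes r: "1 < r" and s: "0 < s" and \<delta>: "\<delta> > 0"
    and window: "\<forall>\<^sub>F y in at_top. \<forall>x w. y \<le> x \<longrightarrow> r * x \<le> w \<longrightarrow> w \<le> r\<^sup>2 * x \<longrightarrow> g w \<le> (1 + \<delta>) * g x"
    and S: "S > 0" "\<forall>\<^sub>F y in at_top. \<phi> (s * y) \<le> S * \<phi> y" "\<forall>\<^sub>F y in at_top. \<phi> y \<le> S * \<phi> (s * y)"
    and P: "\<forall>\<^sub>F y in at_top. P y"
  shows "\<exists>C y0. test_function \<phi> (\<lambda>y. smooth r (s * y) / s) (\<lambda>y. avg r (s * y)) (\<lambda>y. avg' r (s * y) * s) C y0 \<and> (\<forall>y\<ge>y0. P y)"
proof -
  obtain C where C: "C > 0" "\<forall>\<^sub>F y in at_top. \<bar>avg' r y\<bar> \<le> C * avg r y / y \<and> y * avg r y \<le> C * \<phi> y \<and> \<phi> y \<le> C * (y * avg r y)"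
    using avg_bounds[OF r window \<delta>] .
  define C' where "C' = max C (max (S / s) (max (C * S / s) (S * C * s)))"
  have "\<forall>\<^sub>F y in at_top. 0 < y \<and> P y \<and> ((\<lambda>y. smooth r (s * y) / s) has_real_derivative - avg r (s * y)) (at y) \<and>
     ((\<lambda>y. avg r (s * y)) has_real_derivative avg' r (s * y) * s) (at y) \<and>
     0 < avg r (s * y) \<and> \<bar>avg' r (s * y) * s\<bar> \<le> C' * avg r (s * y) / y \<and> 0 \<le> smooth r (s * y) / s \<and> smooth r (s * y) / s \<le> C' * \<phi> y \<and>
     y * avg r (s * y) \<le> C' * \<phi> y \<and> \<phi> y \<le> C' * (y * avg r (s * y))"
    using eventually_scale[OF s C(2)] S(2,3) eventually_gt_at_top[of 0] eventually_gt_at_top[of "1 / s"] P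
  proof eventually_elim
    case (elim y)
    have sy: "1 < s * y" using elim s by (simp add: divide_less_eq mult.commute)
    have pos: "0 < avg r (s * y)" "0 < \<phi> y" "0 < \<phi> (s * y)" "0 < \<phi> (r * (s * y))" using r sy elim by (auto intro!: avg_pos \<phi>_pos)
    have C': "C \<le> C'" "S / s \<le> C'" "C * S / s \<le> C'" "S * C * s \<le> C'" by (auto simp: C'_def)
    have d1: "((\<lambda>y. smooth r (s * y) / s) has_real_derivative (- avg r (s * y) * s) / s) (at y)"
      by (intro DERIV_cdivide DERIV_chain2[where f = "smooth r" and g = "\<lambda>y. s * y" and x = y, OF smooth_deriv[OF r sy]]) (auto intro!: derivative_eq_intros)
    have d2: "((\<lambda>y. avg r (s * y)) has_real_derivative avg' r (s * y) * s) (at y)"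
      using sy by (intro DERIV_chain2[where f = "avg r" and g = "\<lambda>y. s * y" and x = y, OF avg_deriv[OF r]]) (auto intro!: derivative_eq_intros)
    have "\<bar>avg' r (s * y) * s\<bar> = \<bar>avg' r (s * y)\<bar> * s" using s by (simp add: abs_mult)
    also have "\<dots> \<le> (C * avg r (s * y) / (s * y)) * s" using elim s by (intro mult_right_mono) auto
    also have "\<dots> = C * (avg r (s * y) / y)" using s by simp
    also have "\<dots> \<le> C' * (avg r (s * y) / y)" using C'(1) pos elim by (intro mult_right_mono) auto
    finally have e1: "\<bar>avg' r (s * y) * s\<bar> \<le> C' * avg r (s * y) / y" by simp
    have e2: "0 \<le> smooth r (s * y) / s"
    proof -
      have "0 \<le> \<phi> (r * (s * y)) / r" using pos r by simp
      then show ?thesis using smooth_bounds(1)[OF r sy] s by simp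
    qed
    have "smooth r (s * y) / s \<le> \<phi> (s * y) / s" using smooth_bounds(2)[OF r sy] s by (intro divide_right_mono) auto
    also have "\<dots> \<le> S * \<phi> y / s" using elim s by (intro divide_right_mono) auto
    also have "\<dots> \<le> C' * \<phi> y" using mult_right_mono[OF C'(2), of "\<phi> y"] pos by simp
    finally have e3: "smooth r (s * y) / s \<le> C' * \<phi> y" .
    have "s * (y * avg r (s * y)) \<le> C * \<phi> (s * y)" using elim by (simp add: mult.assoc)
    also have "\<dots> \<le> C * (S * \<phi> y)" using elim C by (intro mult_left_mono) auto
    finally have "y * avg r (s * y) \<le> C * S / s * \<phi> y" using s by (simp add: field_simps)
    also have "\<dots> \<le> C' * \<phi> y" using C'(3) pos by (intro mult_right_mono) auto
    finally have e4: "y * avg r (s * y) \<le> C' * \<phi> y" .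
    have "\<phi> y \<le> S * \<phi> (s * y)" using elim by simp
    also have "\<dots> \<le> S * (C * ((s * y) * avg r (s * y)))" using elim S by (intro mult_left_mono) auto
    also have "\<dots> = S * C * s * (y * avg r (s * y))" by simp
    also have "\<dots> \<le> C' * (y * avg r (s * y))" using C'(4) pos elim by (intro mult_right_mono) auto
    finally have e5: "\<phi> y \<le> C' * (y * avg r (s * y))" .
    show ?case using d1 d2 e1 e2 e3 e4 e5 pos elim s by simp
  qed
  then obtain N where N: "\<And>y. y \<ge> N \<Longrightarrow> 0 < y \<and> P y \<and> ((\<lambda>y. smooth r (s * y) / s) has_real_derivative - avg r (s * y)) (at y) \<and>
     ((\<lambda>y. avg r (s * y)) has_real_derivative avg' r (s * y) * s) (at y) \<and>
     0 < avg r (s * y) \<and> \<bar>avg' r (s * y) * s\<bar> \<le> C' * avg r (s * y) / y \<and> 0 \<le> smooth r (s * y) / s \<and> smooth r (s * y) / s \<le> C' * \<phi> y \<and>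
     y * avg r (s * y) \<le> C' * \<phi> y \<and> \<phi> y \<le> C' * (y * avg r (s * y))"
    unfolding eventually_at_top_linorder by blast
  have C'N: "C' > 0" "N > 0" using C N[of N] by (auto simp: C'_def less_max_iff_disj)
  have "test_function \<phi> (\<lambda>y. smooth r (s * y) / s) (\<lambda>y. avg r (s * y)) (\<lambda>y. avg' r (s * y) * s) C' N"
    unfolding test_function_def
  proof (rule conjI[OF C'N(1) conjI[OF C'N(2)]], intro allI impI, goal_cases)
    case (1 y)
    from N[OF this] show ?case by (elim conjE) (intro conjI; assumption)
  qed
  moreover have "\<forall>y\<ge>N. P y"
  proof (intro allI impI)
    fix y assume "N \<le> y"
    from N[OF this] show "P y" by (elim conjE)
  qed
  ultimately show ?thesis by blast
qed

text \<open>With \<open>s = 1 / r\<^sup>2\<close> the average is over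
  \<open>[y / r\<^sup>2, y / r]\<close>, to the left of \<open>y\<close> by at least the factor
  \<open>r\<close>. All \<open>r\<close> up to \<open>r0\<close> are offered, because a deviation
  bound for small \<open>\<epsilon>\<close> needs \<open>r\<close> close to 1.\<close>

lemma upper_test_function:
  assumes \<delta>: "\<delta> > 0"
  shows "\<exists>r0>1. \<forall>r. 1 < r \<and> r \<le> r0 \<longrightarrow> (\<exists>f G G' C y0. test_function \<phi> f G G' C y0 \<and>
    (\<forall>y\<ge>y0. g y \<le> (1 + \<delta>) * (\<gamma> * G y) \<and> f y \<le> r\<^sup>2 * \<phi> (y / r\<^sup>2)))"
proof -
  obtain r0 where r0: "r0 > 1" "\<And>r. 1 < r \<Longrightarrow> r \<le> r0 \<Longrightarrow>
    \<forall>\<^sub>F y in at_top. \<forall>x w. y \<le> x \<longrightarrow> r * x \<le> w \<longrightarrow> w \<le> r\<^sup>2 * x \<longrightarrow> g w \<le> (1 + \<delta>) * g x"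
    using almost_decreasing_window[OF \<delta>] by blast
  show ?thesis
  proof (intro exI[of _ r0] conjI allI impI r0(1))
    fix r assume "1 < r \<and> r \<le> r0"
    then have r: "1 < r" and win: "\<forall>\<^sub>F y in at_top. \<forall>x w. y \<le> x \<longrightarrow> r * x \<le> w \<longrightarrow> w \<le> r\<^sup>2 * x \<longrightarrow> g w \<le> (1 + \<delta>) * g x"
      using r0(2) by auto
    have r2: "1 < r\<^sup>2" using r by (simp add: one_less_power)
    define s where "s = 1 / r\<^sup>2"
    have s: "0 < s" "s \<le> 1" "r\<^sup>2 * s = 1" using r r2 by (auto simp: s_def)
    obtain D where D: "D > 0" "\<forall>\<^sub>F y in at_top. \<phi> y \<le> D * \<phi> (r\<^sup>2 * y)" using doubling_pos[OF r2] .
    have ev: "\<forall>\<^sub>F y in at_top. \<phi> (s * y) \<le> D * \<phi> y" using eventually_scale[OF s(1) D(2)] s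
      by (simp add: mult.assoc[symmetric])
    have S1: "\<forall>\<^sub>F y in at_top. \<phi> (s * y) \<le> max D 1 * \<phi> y" using ev eventually_gt_at_top[of 0]
    proof eventually_elim
      case (elim y)
      have "D * \<phi> y \<le> max D 1 * \<phi> y" using \<phi>_pos[of y] elim by (intro mult_right_mono) auto
      then show ?case using elim by simp
    qed
    have S2: "\<forall>\<^sub>F y in at_top. \<phi> y \<le> max D 1 * \<phi> (s * y)" using eventually_gt_at_top[of 0]
    proof eventually_elim
      case (elim y)
      have "s * y \<le> 1 * y" using s elim by (intro mult_right_mono) auto
      then have "\<phi> y \<le> \<phi> (s * y)" using s elim by (intro \<phi>_decreasing) auto
      also have "1 * \<phi> (s * y) \<le> max D 1 * \<phi> (s * y)" using \<phi>_pos[of "s * y"] elim s by (intro mult_right_mono) auto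
      finally show ?case by simp
    qed
    have P: "\<forall>\<^sub>F y in at_top. g y \<le> (1 + \<delta>) * (\<gamma> * avg r (s * y)) \<and> smooth r (s * y) / s \<le> r\<^sup>2 * \<phi> (y / r\<^sup>2)"
      using eventually_scale[OF s(1) win] eventually_gt_at_top[of "1 / s"]
    proof eventually_elim
      case (elim y)
      have sy: "1 < s * y" using elim s by (simp add: divide_less_eq mult.commute)
      have "g (r\<^sup>2 * (s * y)) \<le> (1 + \<delta>) * (\<gamma> * avg r (s * y))" using elim sy r by (intro g_le_avg) auto
      moreover have "r\<^sup>2 * (s * y) = y" using s(3) by (simp add: mult.assoc[symmetric])
      moreover have "smooth r (s * y) / s \<le> \<phi> (s * y) / s" using smooth_bounds(2)[OF r sy] s by (intro divide_right_mono) auto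
      moreover have "\<phi> (s * y) / s = r\<^sup>2 * \<phi> (y / r\<^sup>2)" using r by (simp add: s_def)
      ultimately show ?case by simp
    qed
    show "\<exists>f G G' C y0. test_function \<phi> f G G' C y0 \<and> (\<forall>y\<ge>y0. g y \<le> (1 + \<delta>) * (\<gamma> * G y) \<and> f y \<le> r\<^sup>2 * \<phi> (y / r\<^sup>2))"
      by (rule exI[of _ "\<lambda>y. smooth r (s * y) / s"], rule exI[of _ "\<lambda>y. avg r (s * y)"],
          rule exI[of _ "\<lambda>y. avg' r (s * y) * s"])
        (rule scaled_test_function[OF r s(1) \<delta> win _ S1 S2 P], simp)
  qed
qed

text \<open>With \<open>s = r\<close> the average is over \<open>[r * y, r\<^sup>2 * y]\<close>, to
  the right of \<open>y\<close>, which reverses the comparison with \<open>g y\<close>.\<close>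

lemma lower_test_function:
  assumes \<delta>: "\<delta> > 0"
  shows "\<exists>r0>1. \<forall>r. 1 < r \<and> r \<le> r0 \<longrightarrow> (\<exists>f G G' C y0. test_function \<phi> f G G' C y0 \<and>
    (\<forall>y\<ge>y0. \<gamma> * G y \<le> (1 + \<delta>) * g y \<and> \<phi> (r\<^sup>2 * y) / r\<^sup>2 \<le> f y))"
proof -
  obtain r0 where r0: "r0 > 1" "\<And>r. 1 < r \<Longrightarrow> r \<le> r0 \<Longrightarrow>
    \<forall>\<^sub>F y in at_top. \<forall>x w. y \<le> x \<longrightarrow> r * x \<le> w \<longrightarrow> w \<le> r\<^sup>2 * x \<longrightarrow> g w \<le> (1 + \<delta>) * g x"
    using almost_decreasing_window[OF \<delta>] by blast
  show ?thesis
  proof (intro exI[of _ r0] conjI allI impI r0(1))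
    fix r assume "1 < r \<and> r \<le> r0"
    then have r: "1 < r" and win: "\<forall>\<^sub>F y in at_top. \<forall>x w. y \<le> x \<longrightarrow> r * x \<le> w \<longrightarrow> w \<le> r\<^sup>2 * x \<longrightarrow> g w \<le> (1 + \<delta>) * g x"
      using r0(2) by auto
    obtain D where D: "D > 0" "\<forall>\<^sub>F y in at_top. \<phi> y \<le> D * \<phi> (r * y)" using doubling_pos[OF r] .
    have S2: "\<forall>\<^sub>F y in at_top. \<phi> y \<le> max D 1 * \<phi> (r * y)" using D(2) eventually_gt_at_top[of 0]
    proof eventually_elim
      case (elim y)
      have "D * \<phi> (r * y) \<le> max D 1 * \<phi> (r * y)" using \<phi>_pos[of "r * y"] r elim by (intro mult_right_mono) auto
      then show ?case using elim by simp
    qed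
    have S1: "\<forall>\<^sub>F y in at_top. \<phi> (r * y) \<le> max D 1 * \<phi> y" using eventually_gt_at_top[of 0]
    proof eventually_elim
      case (elim y)
      have "\<phi> (r * y) \<le> \<phi> y" using r elim by (intro \<phi>_decreasing) auto
      also have "1 * \<phi> y \<le> max D 1 * \<phi> y" using \<phi>_pos[of y] elim by (intro mult_right_mono) auto
      finally show ?case by simp
    qed
    have P: "\<forall>\<^sub>F y in at_top. \<gamma> * avg r (r * y) \<le> (1 + \<delta>) * g y \<and> \<phi> (r\<^sup>2 * y) / r\<^sup>2 \<le> smooth r (r * y) / r"
      using win eventually_gt_at_top[of 1]
    proof eventually_elim
      case (elim y)
      have ry: "1 < r * y" using elim r by (metis less_1_mult)
      have "\<gamma> * avg r (r * y) \<le> (1 + \<delta>) * g y" using elim r by (intro avg_le_g) auto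
      moreover have "\<phi> (r * (r * y)) / r / r \<le> smooth r (r * y) / r"
        using smooth_bounds(1)[OF r ry] r by (intro divide_right_mono) auto
      ultimately show ?case by (simp add: power2_eq_square mult.assoc)
    qed
    show "\<exists>f G G' C y0. test_function \<phi> f G G' C y0 \<and> (\<forall>y\<ge>y0. \<gamma> * G y \<le> (1 + \<delta>) * g y \<and> \<phi> (r\<^sup>2 * y) / r\<^sup>2 \<le> f y)"
      by (rule exI[of _ "\<lambda>y. smooth r (r * y) / r"], rule exI[of _ "\<lambda>y. avg r (r * y)"],
          rule exI[of _ "\<lambda>y. avg' r (r * y) * r"])
        (rule scaled_test_function[OF r _ \<delta> win _ S1 S2 P], use r in simp_all)
  qed
qed

end

section \<open>Pointwise bounds for the exponentials of f after a move\<close>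

section \<open>One-step estimates\<close>

text \<open>The quantity \<open>1 - exp (- w)\<close> stands in for the relative move
  \<open>w\<close>: accurately for moderate \<open>w\<close>, and with modulus at least
  \<open>1/2\<close> for large moves either way, so that a linear term there can be charged to the
  square.\<close>

lemma one_minus_exp_bounds:
  fixes w :: real
  shows "1 - exp (- w) \<le> w"
    and "- (1/2) \<le> w \<Longrightarrow> w \<le> 1 \<Longrightarrow> w \<le> (1 - exp (- w)) + w\<^sup>2"
    and "- (1/2) \<le> w \<Longrightarrow> w \<le> 1 \<Longrightarrow> w\<^sup>2 \<le> 4 * (1 - exp (- w))\<^sup>2"
    and "1 \<le> w \<Longrightarrow> 1/2 \<le> 1 - exp (- w)"
    and "w \<le> - (1/2) \<Longrightarrow> 1/2 \<le> exp (- w) - 1"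
proof -
  show 1: "1 - exp (- w) \<le> w" using exp_ge_add_one_self[of "- w"] by simp
  have half: "w / 2 \<le> 1 - exp (- w)" if "0 \<le> w" "w \<le> 1"
  proof -
    have "exp (- w) \<le> 1 / (1 + w)"
      using exp_ge_add_one_self[of w] that by (simp add: exp_minus inverse_eq_divide frac_le)
    moreover have "1 / (1 + w) \<le> 1 - w / 2"
      using that mult_left_mono[of w 1 w] by (simp add: field_simps)
    ultimately show ?thesis by linarith
  qed
  show "w \<le> (1 - exp (- w)) + w\<^sup>2" if "- (1/2) \<le> w" "w \<le> 1"
  proof (cases "0 \<le> w")
    case True
    then show ?thesis using exp_minus_quadratic_bound(3)[of w] by simp
  next
    case False
    then show ?thesis using exp_le_quadratic[of "- w"] that by simp
  qed
  show "w\<^sup>2 \<le> 4 * (1 - exp (- w))\<^sup>2" if "- (1/2) \<le> w" "w \<le> 1"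
  proof -
    have "\<bar>w\<bar> \<le> \<bar>2 * (1 - exp (- w))\<bar>"
    proof (cases "0 \<le> w")
      case True
      then show ?thesis using half that by simp
    next
      case False
      then show ?thesis using 1 by (simp add: abs_if)
    qed
    then have "w\<^sup>2 \<le> (2 * (1 - exp (- w)))\<^sup>2" by (simp only: abs_le_square_iff)
    then show ?thesis by (simp only: power_mult_distrib) simp
  qed
  show "1/2 \<le> 1 - exp (- w)" if "1 \<le> w"
  proof -
    have "exp (- w) \<le> exp (- 1)" using that by simp
    also have "exp (- 1 :: real) \<le> 1 / 2" using exp_ge_add_one_self[of "1::real"] by (simp add: exp_minus inverse_eq_divide)
    finally show ?thesis by simp
  qed
  show "1/2 \<le> exp (- w) - 1" if "w \<le> - (1/2)"
    using exp_ge_add_one_self[of "- w"] that by simp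
qed

lemma second_order_bound:
  fixes h h1 h2 :: "real \<Rightarrow> real"
  assumes d1: "\<And>z. l \<le> z \<Longrightarrow> z \<le> u \<Longrightarrow> (h has_real_derivative h1 z) (at z)"
    and d2: "\<And>z. l \<le> z \<Longrightarrow> z \<le> u \<Longrightarrow> (h1 has_real_derivative h2 z) (at z)"
    and B: "\<And>z. l \<le> z \<Longrightarrow> z \<le> u \<Longrightarrow> \<bar>h2 z\<bar> \<le> B"
    and y: "l \<le> y" "y \<le> u" and v: "l \<le> y + v" "y + v \<le> u"
  shows "h (y + v) \<le> h y + v * h1 y + B * v\<^sup>2"
proof -
  have conv: "convex {l..u}" by simp
  have mvt: "\<exists>\<xi>. l \<le> \<xi> \<and> \<xi> \<le> u \<and> \<bar>\<xi> - y\<bar> \<le> \<bar>v\<bar> \<and> h (y + v) - h y = v * h1 \<xi>"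
  proof (cases v "0 :: real" rule: linorder_cases)
    case less
    then obtain \<xi> where "y + v < \<xi>" "\<xi> < y" "h y - h (y + v) = (y - (y + v)) * h1 \<xi>"
      using MVT2[of "y + v" y h h1] d1 y v by auto
    then show ?thesis using y v less by (intro exI[of _ \<xi>]) auto
  next
    case equal
    then show ?thesis using y by (intro exI[of _ y]) auto
  next
    case greater
    then obtain \<xi> where "y < \<xi>" "\<xi> < y + v" "h (y + v) - h y = ((y + v) - y) * h1 \<xi>"
      using MVT2[of y "y + v" h h1] d1 y v by auto
    then show ?thesis using y v greater by (intro exI[of _ \<xi>]) auto
  qed
  then obtain \<xi> where \<xi>: "l \<le> \<xi>" "\<xi> \<le> u" "\<bar>\<xi> - y\<bar> \<le> \<bar>v\<bar>" "h (y + v) - h y = v * h1 \<xi>" by blast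
  have B0: "0 \<le> B" using B[OF y] by linarith
  have "norm (h1 \<xi> - h1 y) \<le> B * norm (\<xi> - y)"
    using y \<xi> d2 B by (intro field_differentiable_bound[OF conv, of h1 h2 B]) (auto intro: has_field_derivative_at_within)
  also have "\<dots> \<le> B * \<bar>v\<bar>" using \<xi>(3) B0 by (simp add: mult_left_mono)
  finally have "\<bar>v * (h1 \<xi> - h1 y)\<bar> \<le> B * \<bar>v\<bar> * \<bar>v\<bar>"
    by (subst abs_mult, subst mult.commute) (simp add: mult_right_mono)
  then have "v * (h1 \<xi> - h1 y) \<le> B * v\<^sup>2" by (simp add: power2_eq_square mult.assoc)
  then show ?thesis using \<xi>(4) by (simp add: algebra_simps)
qed

text \<open>The middle summand is the second-order coefficient of \<open>exp_second_order\<close>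
  times 4, from replacing \<open>w\<^sup>2\<close> by \<open>4 * (1 - exp (- w))\<^sup>2\<close>.
  The summand 4 pays for linear terms, the last one for large upward moves.\<close>

definition taylor_const :: "real \<Rightarrow> real \<Rightarrow> real" where
  "taylor_const C \<Lambda> = 4 + 8 * exp (2 * C + \<Lambda>) * (C + \<Lambda>) + 4 * C\<^sup>2 * exp \<Lambda>"

context regular_tail
begin

context
  fixes f G G' :: "real \<Rightarrow> real" and C y0 b lam \<Lambda> :: real
  assumes tf: "test_function \<phi> f G G' C y0" and b: "y0 \<le> b" and lam: "0 < lam" and \<Lambda>: "lam * (C * \<phi> b) \<le> \<Lambda>"
begin

lemma tf_facts:
  assumes "b \<le> z"
  shows "(f has_real_derivative - G z) (at z)" "(G has_real_derivative G' z) (at z)" "0 < G z" "\<bar>G' z\<bar> \<le> C * G z / z"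
    "0 \<le> f z" "f z \<le> C * \<phi> z" "z * G z \<le> C * \<phi> z" "\<phi> z \<le> C * (z * G z)" "0 < z" "0 < C"
  using tf assms b unfolding test_function_def by auto

lemma tf_decreasing:
  assumes "b \<le> z" "z \<le> z'" shows "f z' \<le> f z"
proof (rule DERIV_nonpos_imp_nonincreasing[OF assms(2)])
  fix u assume "z \<le> u"
  with assms(1) have "b \<le> u" by simp
  from tf_facts(1,3)[OF this] show "\<exists>d. (f has_real_derivative d) (at u) \<and> d \<le> 0"
    by (intro exI[of _ "- G u"]) simp
qed

text \<open>Monotonicity of \<open>\<phi>\<close> carries the bound from \<open>b\<close> to all
  \<open>z \<ge> b\<close>. From here on constants depend on \<open>C\<close> and
  \<open>\<Lambda>\<close> only, not on \<open>lam\<close> or \<open>b\<close>.\<close>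

lemma tf_small:
  assumes "b \<le> z" shows "lam * f z \<le> \<Lambda>" "lam * (z * G z) \<le> \<Lambda>"
proof -
  have "\<phi> z \<le> \<phi> b" using assms tf_facts(9)[of b] by (intro \<phi>_decreasing) auto
  then have "lam * (C * \<phi> z) \<le> lam * (C * \<phi> b)" using lam tf_facts(10)[of b] by (intro mult_left_mono) auto
  then have *: "lam * (C * \<phi> z) \<le> \<Lambda>" using \<Lambda> by linarith
  have "lam * f z \<le> lam * (C * \<phi> z)" "lam * (z * G z) \<le> lam * (C * \<phi> z)"
    using tf_facts[OF assms] lam by (simp_all add: mult_left_mono)
  with * show "lam * f z \<le> \<Lambda>" "lam * (z * G z) \<le> \<Lambda>" by linarith+
qed

lemma \<Lambda>_nonneg: "0 \<le> \<Lambda>"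
  using tf_small(1)[of b] tf_facts(5)[of b] lam by (auto intro: order_trans[rotated])

text \<open>The logarithmic derivative of \<open>G\<close> is at most \<open>2 * C / y\<close>
  there, over a distance of at most \<open>y\<close>.\<close>

lemma G_comparable:
  assumes y: "2 * b \<le> y" and z: "y / 2 \<le> z" "z \<le> 2 * y"
  shows "G z \<le> exp (2 * C) * G y"
proof -
  have b0: "0 < b" using tf_facts(9)[of b] by simp
  have conv: "convex {y / 2..2 * y}" by simp
  have C: "0 < C" by (rule tf_facts(10)[OF order_refl])
  have "norm (ln (G z) - ln (G y)) \<le> (2 * C / y) * norm (z - y)"
  proof (rule field_differentiable_bound[OF conv, of "\<lambda>z. ln (G z)" "\<lambda>z. G' z / G z"])
    fix u assume "u \<in> {y / 2..2 * y}"
    then have u: "y / 2 \<le> u" "b \<le> u" using y by auto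
    note F = tf_facts[OF u(2)]
    show "((\<lambda>z. ln (G z)) has_real_derivative G' u / G u) (at u within {y / 2..2 * y})"
      by (rule has_field_derivative_at_within) (use F in \<open>auto intro!: derivative_eq_intros simp: field_simps\<close>)
    have "\<bar>G' u\<bar> / G u \<le> (C * G u / u) / G u" using F by (intro divide_right_mono) auto
    also have "\<dots> = C / u" using F by simp
    also have "\<dots> \<le> C / (y / 2)" using u y b0 C by (intro divide_left_mono) auto
    finally show "norm (G' u / G u) \<le> 2 * C / y" using F by (simp add: mult.commute)
  qed (use z y b0 in auto)
  also have "\<dots> \<le> (2 * C / y) * y" using z y b0 C by (intro mult_left_mono) auto
  also have "\<dots> = 2 * C" using y b0 by simp
  finally have "ln (G z) \<le> 2 * C + ln (G y)" by simp
  then have "exp (ln (G z)) \<le> exp (2 * C + ln (G y))" by simp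
  then show ?thesis using tf_facts(3)[of z] tf_facts(3)[of y] y z b0 by (simp add: exp_add)
qed

lemma taylor_const_ge: "4 \<le> taylor_const C \<Lambda>" "8 * exp (2 * C + \<Lambda>) * (C + \<Lambda>) + 4 \<le> taylor_const C \<Lambda>" "4 * C\<^sup>2 * exp \<Lambda> \<le> taylor_const C \<Lambda>"
  using tf_facts(10)[of b] \<Lambda>_nonneg by (auto simp: taylor_const_def)

text \<open>In the second derivative, \<open>lam * G'\<close> and \<open>(lam * G)\<^sup>2\<close>
  are both at most a constant times \<open>lam * G y / y\<close>, the latter because
  \<open>lam * (z * G z) \<le> \<Lambda>\<close>. So in terms of \<open>v / y\<close> the quadratic
  term carries the same weight as the linear one. Comparability of \<open>G\<close> and of the
  exponential over \<open>[y / 2, 2 * y]\<close> moves all values to the base point.\<close>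

lemma exp_second_order:
  assumes \<tau>: "\<tau> = 1 \<or> \<tau> = -1" and y: "2 * b \<le> y" and v: "- (y / 2) \<le> v" "v \<le> y"
  shows "exp (\<tau> * (lam * f (y + v))) \<le> exp (\<tau> * (lam * f y)) - v * (\<tau> * (lam * G y)) * exp (\<tau> * (lam * f y))
    + 2 * exp (2 * C + \<Lambda>) * (C + \<Lambda>) * (y * (lam * G y * exp (\<tau> * (lam * f y)))) * (v / y)\<^sup>2"
proof -
  have b0: "0 < b" using tf_facts(9)[of b] by simp
  have y0: "0 < y" using y b0 by simp
  have C: "0 < C" by (rule tf_facts(10)[OF order_refl])
  define h where "h = (\<lambda>z. exp (\<tau> * (lam * f z)))"
  define h1 where "h1 = (\<lambda>z. - (\<tau> * (lam * G z)) * h z)"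
  define h2 where "h2 = (\<lambda>z. (- (\<tau> * (lam * G' z)) + (\<tau> * (lam * G z))\<^sup>2) * h z)"
  have hb: "exp (- \<Lambda>) \<le> h z" "h z \<le> exp \<Lambda>" if "b \<le> z" for z
  proof -
    have "0 \<le> lam * f z" using tf_facts(5)[OF that] lam by simp
    then have "- \<Lambda> \<le> \<tau> * (lam * f z)" "\<tau> * (lam * f z) \<le> \<Lambda>"
      using tf_small(1)[OF that] \<Lambda>_nonneg \<tau> by auto
    then show "exp (- \<Lambda>) \<le> h z" "h z \<le> exp \<Lambda>" by (simp_all add: h_def)
  qed
  define K where "K = lam * (exp (2 * C) * G y) * (C + \<Lambda>) * (2 / y)"
  have hratio: "h z \<le> exp \<Lambda> * h y" if "b \<le> z" for z
  proof (cases "\<tau> = 1")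
    case True
    then have "1 \<le> h y" using tf_facts(5)[of y] y b0 lam by (simp add: h_def)
    then have "exp \<Lambda> * 1 \<le> exp \<Lambda> * h y" by (intro mult_left_mono) auto
    then show ?thesis using hb(2)[OF that] by linarith
  next
    case False
    then have "h z \<le> 1" using \<tau> tf_facts(5)[OF that] lam by (simp add: h_def)
    moreover have "exp \<Lambda> * exp (- \<Lambda>) \<le> exp \<Lambda> * h y" using hb(1)[of y] y b0 by (intro mult_left_mono) auto
    ultimately show ?thesis by (simp flip: exp_add)
  qed
  have "h (y + v) \<le> h y + v * h1 y + (K * (exp \<Lambda> * h y)) * v\<^sup>2"
  proof (rule second_order_bound[of "y / 2" "2 * y" h h1 h2])
    fix z assume z: "y / 2 \<le> z" "z \<le> 2 * y"
    then have bz: "b \<le> z" using y by simp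
    note F = tf_facts[OF bz]
    show "(h has_real_derivative h1 z) (at z)" unfolding h_def h1_def
      by (auto intro!: derivative_eq_intros F(1))
    then show "(h1 has_real_derivative h2 z) (at z)" unfolding h1_def h2_def
      by (auto intro!: derivative_eq_intros F(2) simp: h1_def algebra_simps power2_eq_square)
    have "\<bar>- (\<tau> * (lam * G' z)) + (\<tau> * (lam * G z))\<^sup>2\<bar> \<le> lam * \<bar>G' z\<bar> + (lam * G z) * (lam * G z)"
      using \<tau> lam F(3) by (intro order_trans[OF abs_triangle_ineq]) (auto simp: abs_mult power2_eq_square)
    also have "\<dots> \<le> lam * (C * G z / z) + (lam * G z) * (\<Lambda> / z)"
      using lam F tf_small(2)[OF bz] by (intro add_mono mult_left_mono) (auto simp: le_divide_eq mult_ac)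
    also have "\<dots> = lam * G z * (C + \<Lambda>) * (1 / z)" using F by (simp add: field_simps)
    also have "\<dots> \<le> lam * (exp (2 * C) * G y) * (C + \<Lambda>) * (2 / y)"
    proof (intro mult_mono)
      show "1 / z \<le> 2 / y" using z y0 F by (simp add: field_simps)
    qed (use lam G_comparable[OF y z] F C \<Lambda>_nonneg y0 tf_facts(3)[of y] y b0 in auto)
    finally have "\<bar>- (\<tau> * (lam * G' z)) + (\<tau> * (lam * G z))\<^sup>2\<bar> \<le> K" by (simp add: K_def)
    then have "\<bar>- (\<tau> * (lam * G' z)) + (\<tau> * (lam * G z))\<^sup>2\<bar> * h z \<le> K * (exp \<Lambda> * h y)"
      using hratio[OF bz] by (intro mult_mono) (auto simp: h_def)
    then show "\<bar>h2 z\<bar> \<le> K * (exp \<Lambda> * h y)" by (simp add: h2_def abs_mult h_def)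
  qed (use v y0 in auto)
  moreover have "(K * (exp \<Lambda> * h y)) * v\<^sup>2 = 2 * exp (2 * C + \<Lambda>) * (C + \<Lambda>) * (y * (lam * G y * h y)) * (v / y)\<^sup>2"
    using y0 by (simp add: K_def exp_add field_simps power2_eq_square)
  ultimately show ?thesis by (simp add: h_def h1_def algebra_simps)
qed

text \<open>Three regimes of \<open>v / y\<close>. A moderate move uses the Taylor bound. A large
  fall only lowers \<open>h\<close>, and the quadratic term outweighs the negative linear one. After
  a large rise \<open>h\<close> is at most 1, and \<open>1 - h y \<le> lam * f y\<close> is of the
  order of the weight \<open>y * (lam * G y * h y)\<close>, because
  \<open>f y \<le> C * \<phi> y\<close> and \<open>\<phi> y \<le> C * (y * G y)\<close>.\<close>

lemma up_bound:
  defines "h \<equiv> \<lambda>y. exp (- (lam * f (max y b)))"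
  assumes y: "2 * b \<le> y"
  shows "h (y + v) \<le> h y + (y * (lam * G y * h y)) * (1 - exp (- v / y))
    + (taylor_const C \<Lambda> * (y * (lam * G y * h y))) * (1 - exp (- v / y))\<^sup>2"
proof -
  have b0: "0 < b" using tf_facts(9)[of b] by simp
  have y0: "0 < y" "b \<le> y" using y b0 by auto
  note F = tf_facts[OF y0(2)]
  define w where "w = v / y"
  define q where "q = 1 - exp (- w)"
  define D where "D = y * (lam * G y * h y)"
  have D: "0 < D" using y0 lam F by (simp add: D_def h_def)
  have vw: "v = y * w" using y0 by (simp add: w_def)
  have hy: "h y = exp (- (lam * f y))" using y0 by (simp add: h_def max_def)
  have "h (y + v) \<le> h y + D * q + taylor_const C \<Lambda> * D * q\<^sup>2"
  proof -
    consider "w \<le> - (1/2)" | "- (1/2) \<le> w" "w \<le> 1" | "1 \<le> w" by linarith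
    then show ?thesis
    proof cases
      case 1
      have "v \<le> 0" using 1 y0 by (simp add: vw mult_nonneg_nonpos)
      then have "h (y + v) \<le> h y" unfolding h_def using tf_decreasing[of "max (y + v) b" y] y0 lam
        by (auto simp: max_def)
      moreover have "0 \<le> D * (q + taylor_const C \<Lambda> * q\<^sup>2)"
      proof -
        have m: "1/2 \<le> - q" using one_minus_exp_bounds(5)[OF 1] by (simp add: q_def)
        have "2 * (- q) \<le> taylor_const C \<Lambda> * (- q)" using taylor_const_ge(1) m by (intro mult_right_mono) auto
        then have "1 \<le> taylor_const C \<Lambda> * (- q)" using m by linarith
        then have "(- q) * 1 \<le> (- q) * (taylor_const C \<Lambda> * (- q))" using m by (intro mult_left_mono) auto
        then have "0 \<le> q + taylor_const C \<Lambda> * q\<^sup>2" by (simp add: power2_eq_square algebra_simps)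
        then show ?thesis using D by simp
      qed
      ultimately show ?thesis by (simp add: algebra_simps)
    next
      case 2
      have v: "- (y / 2) \<le> v" "v \<le> y" using 2 y0 mult_left_mono[of "- (1/2)" w y] mult_left_mono[of w 1 y] by (simp_all add: vw)
      have "b \<le> y + v" using v y by linarith
      then have yv: "h (y + v) = exp (- (lam * f (y + v)))" by (simp add: h_def max_absorb1)
      define E where "E = 2 * exp (2 * C + \<Lambda>) * (C + \<Lambda>)"
      have E: "0 \<le> E" using F(10) \<Lambda>_nonneg by (simp add: E_def)
      have "h (y + v) \<le> h y + w * D + E * D * w\<^sup>2"
        using exp_second_order[of "-1" y v, OF _ y v] y0 unfolding yv
        by (simp add: hy[symmetric] E_def D_def w_def mult_ac)
      also have "\<dots> \<le> h y + (q + w\<^sup>2) * D + E * D * w\<^sup>2"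
        using one_minus_exp_bounds(2)[OF 2] D by (intro add_mono mult_right_mono) (auto simp: q_def)
      also have "\<dots> = h y + q * D + (E + 1) * D * w\<^sup>2" by (simp add: algebra_simps)
      also have "\<dots> \<le> h y + q * D + (E + 1) * D * (4 * q\<^sup>2)"
        using one_minus_exp_bounds(3)[OF 2] D E by (intro add_left_mono mult_left_mono) (auto simp: q_def)
      also have "\<dots> = h y + q * D + (4 * E + 4) * (D * q\<^sup>2)" by (simp add: algebra_simps)
      also have "\<dots> \<le> h y + q * D + taylor_const C \<Lambda> * (D * q\<^sup>2)"
        using taylor_const_ge(2) D by (intro add_left_mono mult_right_mono) (auto simp: E_def)
      finally show ?thesis by (simp add: algebra_simps)
    next
      case 3
      have q: "1/2 \<le> q" using one_minus_exp_bounds(4)[OF 3] by (simp add: q_def)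
      have "h (y + v) \<le> 1" using tf_facts(5)[of "max (y + v) b"] lam by (simp add: h_def)
      moreover have "1 - lam * f y \<le> h y" using exp_ge_add_one_self[of "- (lam * f y)"] by (simp add: hy)
      moreover have "lam * f y \<le> taylor_const C \<Lambda> * D * q\<^sup>2"
      proof -
        have "f y \<le> C * (C * (y * G y))" using F(6,8,10) by (intro order_trans[OF F(6)] mult_left_mono) auto
        then have "lam * f y \<le> lam * (C\<^sup>2 * (y * G y))" using lam by (intro mult_left_mono) (auto simp: power2_eq_square mult.assoc)
        also have "\<dots> = C\<^sup>2 * exp \<Lambda> * (y * (lam * G y * exp (- \<Lambda>)))" by (simp add: exp_minus field_simps)
        also have "\<dots> \<le> C\<^sup>2 * exp \<Lambda> * D" unfolding D_def hy using lam F(3) y0 tf_small(1)[OF y0(2)]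
          by (intro mult_left_mono) auto
        finally have *: "lam * f y \<le> C\<^sup>2 * exp \<Lambda> * D" .
        have "(1/2)\<^sup>2 \<le> q\<^sup>2" using q by (intro power_mono) auto
        then have q4: "1 \<le> 4 * q\<^sup>2" by (simp add: power2_eq_square)
        have "C\<^sup>2 * exp \<Lambda> * D * 1 \<le> C\<^sup>2 * exp \<Lambda> * D * (4 * q\<^sup>2)" using q4 D by (intro mult_left_mono) auto
        also have "\<dots> = (4 * C\<^sup>2 * exp \<Lambda>) * (D * q\<^sup>2)" by simp
        also have "\<dots> \<le> taylor_const C \<Lambda> * (D * q\<^sup>2)" using taylor_const_ge(3) D by (intro mult_right_mono) auto
        finally show ?thesis using * by (simp add: mult.assoc)
      qed
      moreover have "0 \<le> D * q" using D q by simp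
      ultimately show ?thesis by linarith
    qed
  qed
  then show ?thesis by (simp add: D_def q_def w_def mult.assoc)
qed

text \<open>The last term pays for a fall from \<open>y\<close> to below \<open>b\<close> in one step; its factor decays exponentially in \<open>y / b\<close>, whereas
  \<open>\<phi>\<close> decays like a power, so it is negligible even for \<open>y\<close> much larger than \<open>b\<close>.\<close>
lemma down_bound:
  defines "h \<equiv> \<lambda>y. exp (lam * f (max y b))"
  assumes y: "2 * b \<le> y"
  shows "h (y + v) \<le> h y + (- (y * (lam * G y * h y))) * (1 - exp (- v / y))
    + (taylor_const C \<Lambda> * (y * (lam * G y * h y))) * (1 - exp (- v / y))\<^sup>2
    + (exp \<Lambda> / (exp (y / (2 * (2 * b))) - 1)\<^sup>2) * (1 - exp (- v / (2 * b)))\<^sup>2"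
proof -
  have b0: "0 < b" using tf_facts(9)[of b] by simp
  have y0: "0 < y" "b \<le> y" using y b0 by auto
  note F = tf_facts[OF y0(2)]
  define w where "w = v / y"
  define q where "q = 1 - exp (- w)"
  define D where "D = y * (lam * G y * h y)"
  define \<kappa> where "\<kappa> = exp \<Lambda> / (exp (y / (2 * (2 * b))) - 1)\<^sup>2"
  define q2 where "q2 = 1 - exp (- v / (2 * b))"
  have D: "0 < D" using y0 lam F by (simp add: D_def h_def)
  have vw: "v = y * w" using y0 by (simp add: w_def)
  have hy: "h y = exp (lam * f y)" using y0 by (simp add: h_def max_def)
  have \<kappa>: "0 \<le> \<kappa> * q2\<^sup>2" by (simp add: \<kappa>_def)
  have "h (y + v) \<le> h y + (- D) * q + taylor_const C \<Lambda> * D * q\<^sup>2 + \<kappa> * q2\<^sup>2"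
  proof -
    consider "w \<le> - (1/2)" | "- (1/2) \<le> w" "w \<le> 1" | "1 \<le> w" by linarith
    then show ?thesis
    proof cases
      case 1
      have "h (y + v) \<le> exp \<Lambda>" unfolding h_def using tf_small(1)[of "max (y + v) b"] by simp
      \<comment> \<open>At \<open>v = - (y / 2)\<close> the factor
        \<open>exp (- v / (2 * b))\<close> equals \<open>exp (y / (2 * (2 * b)))\<close>, and deeper
        falls only increase it; \<open>\<kappa>\<close> is normalised to reach
        \<open>exp \<Lambda>\<close> at this point.\<close>
      also have "exp \<Lambda> \<le> \<kappa> * q2\<^sup>2"
      proof -
        have e1: "1 < exp (y / (2 * (2 * b)))" using y0 b0 by simp
        have "v \<le> - (y / 2)" using mult_left_mono[OF 1, of y] y0 by (simp add: vw)
        then have "y / (2 * (2 * b)) \<le> - v / (2 * b)" using b0 by (simp add: field_simps)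
        then have "exp (y / (2 * (2 * b))) - 1 \<le> - q2" by (simp add: q2_def)
        then have "(exp (y / (2 * (2 * b))) - 1)\<^sup>2 \<le> (- q2)\<^sup>2" using e1 by (intro power_mono) auto
        then have le: "(exp (y / (2 * (2 * b))) - 1)\<^sup>2 \<le> q2\<^sup>2" by simp
        have pos: "0 < (exp (y / (2 * (2 * b))) - 1)\<^sup>2" using e1 by (intro zero_less_power) simp
        have "exp \<Lambda> = \<kappa> * (exp (y / (2 * (2 * b))) - 1)\<^sup>2" using pos by (simp add: \<kappa>_def)
        also have "\<dots> \<le> \<kappa> * q2\<^sup>2" using le by (intro mult_left_mono) (auto simp: \<kappa>_def)
        finally show ?thesis .
      qed
      moreover have "0 \<le> (- D) * q"
      proof -
        have "q \<le> 0" using one_minus_exp_bounds(5)[OF 1] unfolding q_def by linarith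
        then show ?thesis using D by (intro mult_nonpos_nonpos) auto
      qed
      moreover have "0 \<le> taylor_const C \<Lambda> * D * q\<^sup>2" using taylor_const_ge(1) D by simp
      moreover have "0 \<le> h y" by (simp add: h_def)
      ultimately show ?thesis by linarith
    next
      case 2
      have v: "- (y / 2) \<le> v" "v \<le> y" using 2 y0 mult_left_mono[of "- (1/2)" w y] mult_left_mono[of w 1 y] by (simp_all add: vw)
      have "b \<le> y + v" using v y by linarith
      then have yv: "h (y + v) = exp (lam * f (y + v))" by (simp add: h_def max_absorb1)
      define E where "E = 2 * exp (2 * C + \<Lambda>) * (C + \<Lambda>)"
      have E: "0 \<le> E" using F(10) \<Lambda>_nonneg by (simp add: E_def)
      have "h (y + v) \<le> h y - w * D + E * D * w\<^sup>2"
        using exp_second_order[of 1 y v, OF _ y v] y0 unfolding yv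
        by (simp add: hy[symmetric] E_def D_def w_def mult_ac)
      also have "\<dots> \<le> h y - q * D + E * D * w\<^sup>2"
        using one_minus_exp_bounds(1)[of w] D mult_right_mono[of q w D] by (simp add: q_def)
      also have "\<dots> \<le> h y - q * D + E * D * (4 * q\<^sup>2)"
        using one_minus_exp_bounds(3)[OF 2] D E by (intro add_left_mono mult_left_mono) (auto simp: q_def)
      also have "\<dots> = h y - q * D + (4 * E) * (D * q\<^sup>2)" by (simp add: algebra_simps)
      also have "\<dots> \<le> h y - q * D + taylor_const C \<Lambda> * (D * q\<^sup>2)"
        using taylor_const_ge(2) D by (intro add_left_mono mult_right_mono) (auto simp: E_def)
      finally show ?thesis using \<kappa> by (simp add: algebra_simps)
    next
      case 3
      have q: "1/2 \<le> q" using one_minus_exp_bounds(4)[OF 3] by (simp add: q_def)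
      have "0 \<le> v" using 3 y0 by (simp add: vw)
      then have "h (y + v) \<le> h y" unfolding h_def using tf_decreasing[of y "y + v"] y0 lam by (simp add: max_absorb1)
      moreover have "D * q \<le> taylor_const C \<Lambda> * D * q\<^sup>2"
      proof -
        have "2 * q \<le> taylor_const C \<Lambda> * q" using taylor_const_ge(1) q by (intro mult_right_mono) auto
        then have "1 \<le> taylor_const C \<Lambda> * q" using q by linarith
        then have "(D * q) * 1 \<le> (D * q) * (taylor_const C \<Lambda> * q)" using q D by (intro mult_left_mono) auto
        then show ?thesis by (simp add: power2_eq_square mult_ac)
      qed
      ultimately show ?thesis using \<kappa> by simp
    qed
  qed
  then show ?thesis by (simp add: D_def q_def w_def \<kappa>_def q2_def mult.assoc)
qed

end

end

locale levy_tail = regular_tail +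
  fixes \<Psi> :: "real \<Rightarrow> real"
  assumes \<Psi>_lim: "((\<lambda>lam. \<Psi> lam / lam) \<longlongrightarrow> \<gamma>) (at_right 0)"
    and \<Psi>_ge: "\<And>lam. 0 \<le> lam \<Longrightarrow> \<gamma> * lam \<le> \<Psi> lam"

definition levy_increments :: "'a measure \<Rightarrow> (real \<Rightarrow> real) \<Rightarrow> real \<Rightarrow> (nat \<Rightarrow> 'a \<Rightarrow> real) \<Rightarrow> nat \<Rightarrow> bool" where
  "levy_increments M \<Psi> \<Delta> \<xi> n \<longleftrightarrow> prob_space M \<and> prob_space.indep_vars M (\<lambda>_. borel) \<xi> {..<n} \<and>
    (\<forall>i<n. \<forall>lam\<ge>0. (\<integral>\<^sup>+\<omega>. ennreal (exp (- lam * \<xi> i \<omega>)) \<partial>M) = ennreal (exp (\<Delta> * \<Psi> lam)))"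

text \<open>Each doubling of the argument costs a factor \<open>D\<close>; with
  \<open>D < 2 ^ n\<close> the growth of \<open>(y / x) ^ n\<close> absorbs it, and one
  \<open>D\<close> remains for the last incomplete doubling.\<close>

lemma (in regular_tail) power_lower_bound:
  obtains n :: nat and D y1 where "D \<ge> 1" "y1 > 0"
    "\<And>x y. y1 \<le> x \<Longrightarrow> x \<le> y \<Longrightarrow> \<phi> x \<le> D * (y / x) ^ n * \<phi> y"
proof -
  obtain D0 where D0: "D0 > 0" "\<forall>\<^sub>F y in at_top. \<phi> y \<le> D0 * \<phi> (2 * y)" using doubling_pos[of 2] by auto
  then obtain N where N: "\<And>y. y \<ge> N \<Longrightarrow> \<phi> y \<le> D0 * \<phi> (2 * y)" unfolding eventually_at_top_linorder by blast
  define D where "D = max D0 1"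
  define y1 where "y1 = max N 1"
  have D: "\<phi> y \<le> D * \<phi> (2 * y)" if "y1 \<le> y" for y
  proof -
    have "D0 * \<phi> (2 * y) \<le> D * \<phi> (2 * y)" using \<phi>_pos[of "2 * y"] that by (intro mult_right_mono) (auto simp: D_def y1_def)
    then show ?thesis using N[of y] that by (simp add: y1_def)
  qed
  obtain n where n: "D < 2 ^ n" using real_arch_pow[of 2 D] by auto
  have "\<phi> x \<le> D * (y / x) ^ n * \<phi> y" if "y1 \<le> x" "x \<le> y" "y \<le> 2 ^ m * x" for x y m
    using that
  proof (induction m arbitrary: x)
    case 0
    then have "y = x" by simp
    moreover have "1 * \<phi> x \<le> D * \<phi> x" using \<phi>_pos[of x] 0 by (intro mult_right_mono) (auto simp: D_def y1_def)
    ultimately show ?case using 0 by (simp add: y1_def)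
  next
    case (Suc m)
    have x: "0 < x" "0 < y" using Suc.prems by (auto simp: y1_def)
    have D1: "1 \<le> D" by (simp add: D_def)
    show ?case
    proof (cases "y \<le> 2 * x")
      case True
      have "\<phi> x \<le> D * \<phi> (2 * x)" using D Suc.prems by simp
      also have "\<dots> \<le> D * \<phi> y" using True x D1 by (intro mult_left_mono \<phi>_decreasing) auto
      also have "\<dots> = D * 1 * \<phi> y" by simp
      also have "\<dots> \<le> D * (y / x) ^ n * \<phi> y"
        using Suc.prems x D1 \<phi>_pos[of y] by (intro mult_right_mono mult_left_mono one_le_power) auto
      finally show ?thesis .
    next
      case False
      have IH: "\<phi> (2 * x) \<le> D * (y / (2 * x)) ^ n * \<phi> y" using Suc.prems False x by (intro Suc.IH) auto
      have "\<phi> x \<le> D * \<phi> (2 * x)" using D Suc.prems by simp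
      also have "\<dots> \<le> 2 ^ n * \<phi> (2 * x)" using n \<phi>_pos[of "2 * x"] x by (intro mult_right_mono) auto
      also have "\<dots> \<le> 2 ^ n * (D * (y / (2 * x)) ^ n * \<phi> y)" using IH by (intro mult_left_mono) auto
      also have "\<dots> = D * (y / x) ^ n * \<phi> y" by (simp add: power_divide power_mult_distrib)
      finally show ?thesis .
    qed
  qed
  moreover have "\<exists>m. y \<le> 2 ^ m * x" if "0 < x" for x y :: real
  proof -
    obtain m where "y / x < 2 ^ m" using real_arch_pow[of 2 "y / x"] by auto
    then show ?thesis using that by (intro exI[of _ m]) (simp add: divide_less_eq)
  qed
  ultimately show ?thesis by (intro that[of D y1 n]) (force simp: D_def y1_def)+
qed

text \<open>Raising \<open>s / n \<le> exp (s / n)\<close> to the power \<open>n\<close> compares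
  \<open>s ^ n\<close> with \<open>exp s\<close>; and \<open>exp (s / 2) \<ge> 3 / 2\<close> for
  \<open>s \<ge> 1\<close> gives \<open>exp (s / 2) \<le> 3 * (exp (s / 2) - 1)\<close>.\<close>

lemma power_le_exp_square:
  assumes s: "1 \<le> s" and n: "0 < n"
  shows "s ^ n \<le> 9 * real n ^ n * (exp (s / 2) - 1)\<^sup>2"
proof -
  have "3 / 2 \<le> exp (s / 2)" using exp_ge_add_one_self[of "s / 2"] s by linarith
  then have "exp (s / 2) \<le> 3 * (exp (s / 2) - 1)" by simp
  then have "(exp (s / 2))\<^sup>2 \<le> (3 * (exp (s / 2) - 1))\<^sup>2" by (intro power_mono) auto
  then have e: "exp s \<le> 9 * (exp (s / 2) - 1)\<^sup>2" 
    by (simp only: power_mult_distrib) (simp flip: exp_double)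
  have "(s / real n) ^ n \<le> exp (s / real n) ^ n" 
  proof (rule power_mono)
    show "s / real n \<le> exp (s / real n)" using exp_ge_add_one_self[of "s / real n"] by linarith
  qed (use s in simp)
  also have "\<dots> = exp s" using n by (simp flip: exp_of_nat_mult)
  finally have "s ^ n \<le> real n ^ n * exp s" using n by (simp add: power_divide divide_le_eq mult.commute)
  also have "\<dots> \<le> real n ^ n * (9 * (exp (s / 2) - 1)\<^sup>2)" using e by (intro mult_left_mono) auto
  finally show ?thesis by simp
qed

section \<open>Expected change of the exponentials in one time step\<close>

context levy_tail
begin

text \<open>The linear term contributes at most \<open>- \<Delta> * \<gamma> / y\<close> times the
  weight \<open>D\<close>, the quadratic one a small multiple of that, and
  \<open>1 - x \<le> exp (- x)\<close> gives the exponential form. In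
  \<open>(1 - \<delta>) / (1 + \<delta>)\<close> the numerator pays for the quadratic term, the
  denominator for replacing \<open>\<gamma> * G\<close> by \<open>g\<close>. With
  \<open>b \<ge> 1 / l0\<close> the Laplace argument \<open>1 / y\<close> is in the range of
  \<open>laplace_step_bounds\<close>.\<close>

lemma up_step:
  assumes tf: "test_function \<phi> f G G' C y0" and gG: "\<And>y. y0 \<le> y \<Longrightarrow> g y \<le> (1 + \<delta>) * (\<gamma> * G y)"
    and \<delta>: "0 < \<delta>" "\<delta> < 1" and \<Lambda>: "0 \<le> \<Lambda>"
  obtains b0 where "y0 \<le> b0" "\<And>b lam y \<Delta> (\<xi> :: 'a \<Rightarrow> real) M.
    b0 \<le> b \<Longrightarrow> 0 < lam \<Longrightarrow> lam * (C * \<phi> b) \<le> \<Lambda> \<Longrightarrow> 2 * b \<le> y \<Longrightarrow> 0 < \<Delta> \<Longrightarrow> \<Delta> \<le> 1 \<Longrightarrow> prob_space M \<Longrightarrow>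
    \<xi> \<in> borel_measurable M \<Longrightarrow> (\<And>l. 0 \<le> l \<Longrightarrow> (\<integral>\<^sup>+\<omega>. ennreal (exp (- l * \<xi> \<omega>)) \<partial>M) = ennreal (exp (\<Delta> * \<Psi> l))) \<Longrightarrow>
    (\<integral>\<^sup>+\<omega>. ennreal (exp (- (lam * f (max (y + \<xi> \<omega>) b)))) \<partial>M)
      \<le> ennreal (exp (- (lam * f (max y b))) * exp (- (lam * ((1 - \<delta>) / (1 + \<delta>)) * \<Delta> * g y)))"
proof -
  have "0 < C" using tf by (simp add: test_function_def)
  then have C3: "4 \<le> taylor_const C \<Lambda>" using \<Lambda> by (simp add: taylor_const_def)
  \<comment> \<open>After multiplication by \<open>taylor_const C \<Lambda>\<close> the quadratic
    term is the fraction \<open>\<delta>\<close> of the drift.\<close>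
  define \<epsilon> where "\<epsilon> = \<delta> * \<gamma> / taylor_const C \<Lambda>"
  have \<epsilon>: "0 < \<epsilon>" using \<delta> \<gamma>_pos C3 by (simp add: \<epsilon>_def)
  obtain l0 where l0: "l0 > 0" "\<And>lam \<Delta>. 0 < lam \<Longrightarrow> lam \<le> l0 \<Longrightarrow> 0 < \<Delta> \<Longrightarrow> \<Delta> \<le> 1 \<Longrightarrow>
      1 - 2 * exp (\<Delta> * \<Psi> lam) + exp (\<Delta> * \<Psi> (2 * lam)) \<le> \<epsilon> * \<Delta> * lam \<and>
      exp (\<Delta> * \<Psi> lam) - 1 \<le> \<Delta> * lam * (\<gamma> + \<epsilon>)"
    using laplace_step_bounds[OF \<gamma>_pos \<Psi>_lim \<Psi>_ge \<epsilon>] by blast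
  show ?thesis
  proof (rule that[of "max y0 (1 / l0)"])
    fix b lam y \<Delta> :: real and \<xi> :: "'a \<Rightarrow> real" and M
    assume b: "max y0 (1 / l0) \<le> b" and lam: "0 < lam" "lam * (C * \<phi> b) \<le> \<Lambda>" and y: "2 * b \<le> y"
      and \<Delta>: "0 < \<Delta>" "\<Delta> \<le> 1" and M: "prob_space M" and \<xi>: "\<xi> \<in> borel_measurable M"
      and lap: "\<And>l. 0 \<le> l \<Longrightarrow> (\<integral>\<^sup>+\<omega>. ennreal (exp (- l * \<xi> \<omega>)) \<partial>M) = ennreal (exp (\<Delta> * \<Psi> l))"
    have yb: "y0 \<le> b" using b by simp
    note tff = tf_facts[OF tf yb lam]
    have b0: "0 < b" using yb tf by (simp add: test_function_def)
    have y0: "0 < y" "b \<le> y" using y b0 by auto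
    have "1 / l0 \<le> y" using b y b0 by simp
    then have ly: "1 / y \<le> l0" using l0(1) y0 by (simp add: divide_le_eq mult.commute)
    define h where "h = (\<lambda>z. exp (- (lam * f (max z b))))"
    define D where "D = y * (lam * G y * h y)"
    have D: "0 < D" using y0 lam tff(3)[OF y0(2)] by (simp add: D_def h_def)
    interpret prob_space M by (rule M)
    \<comment> \<open>\<open>up_bound\<close> has no term at a second scale; it is filled in with
      coefficient 0 at scale 1 to match \<open>exponential_moment_bound\<close>.\<close>
    have bd: "h (y + v) \<le> h y + D * (1 - exp (- v / y)) + (taylor_const C \<Lambda> * D) * (1 - exp (- v / y))\<^sup>2 + 0 * (1 - exp (- v / 1))\<^sup>2" for v
      using up_bound[OF tf yb lam y, of v] by (simp add: h_def D_def)
    have "(\<integral>\<^sup>+\<omega>. ennreal (h (y + \<xi> \<omega>)) \<partial>M) \<le> ennreal (h y + D * (1 - exp (\<Delta> * \<Psi> (1 / y)))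
        + (taylor_const C \<Lambda> * D) * (1 - 2 * exp (\<Delta> * \<Psi> (1 / y)) + exp (\<Delta> * \<Psi> (2 / y)))
        + 0 * (1 - 2 * exp (\<Delta> * \<Psi> (1 / 1)) + exp (\<Delta> * \<Psi> (2 / 1))))"
      by (rule exponential_moment_bound[where E = "\<lambda>l. exp (\<Delta> * \<Psi> l)", OF \<xi> lap _ y0(1) _ _ bd]) (auto simp: h_def)
    also have "\<dots> \<le> ennreal (h y * exp (- (lam * ((1 - \<delta>) / (1 + \<delta>)) * \<Delta> * g y)))"
    proof (rule ennreal_leI)
      have s: "1 - 2 * exp (\<Delta> * \<Psi> (1 / y)) + exp (\<Delta> * \<Psi> (2 / y)) \<le> \<epsilon> * \<Delta> * (1 / y)"
        using l0(2)[of "1 / y" \<Delta>] ly y0 \<Delta> by simp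
      have "\<Delta> * (\<gamma> * (1 / y)) \<le> \<Delta> * \<Psi> (1 / y)" using \<Psi>_ge[of "1 / y"] y0 \<Delta> by (intro mult_left_mono) auto
      then have e: "1 - exp (\<Delta> * \<Psi> (1 / y)) \<le> - (\<Delta> * (\<gamma> * (1 / y)))"
        using exp_ge_add_one_self[of "\<Delta> * \<Psi> (1 / y)"] by linarith
      define x where "x = lam * (1 - \<delta>) * \<Delta> * (\<gamma> * G y)"
      have "h y + D * (1 - exp (\<Delta> * \<Psi> (1 / y))) + (taylor_const C \<Lambda> * D) * (1 - 2 * exp (\<Delta> * \<Psi> (1 / y)) + exp (\<Delta> * \<Psi> (2 / y)))
          \<le> h y + D * (- (\<Delta> * (\<gamma> * (1 / y)))) + (taylor_const C \<Lambda> * D) * (\<epsilon> * \<Delta> * (1 / y))"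
        using s e D C3 by (intro add_mono mult_left_mono) auto
      also have "\<dots> = h y * (1 - x)" using y0 C3 by (simp add: D_def x_def \<epsilon>_def field_simps)
      also have "\<dots> \<le> h y * exp (- x)" using exp_ge_add_one_self[of "- x"] by (intro mult_left_mono) (auto simp: h_def)
      also have "\<dots> \<le> h y * exp (- (lam * ((1 - \<delta>) / (1 + \<delta>)) * \<Delta> * g y))"
      proof -
        have "lam * ((1 - \<delta>) / (1 + \<delta>)) * \<Delta> * g y \<le> lam * ((1 - \<delta>) / (1 + \<delta>)) * \<Delta> * ((1 + \<delta>) * (\<gamma> * G y))"
          using gG[of y] y0 yb lam \<delta> \<Delta> by (intro mult_left_mono) auto
        also have "\<dots> = x" using \<delta> by (simp add: x_def)
        finally show ?thesis by (intro mult_left_mono) (auto simp: h_def)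
      qed
      finally show "h y + D * (1 - exp (\<Delta> * \<Psi> (1 / y)))
        + (taylor_const C \<Lambda> * D) * (1 - 2 * exp (\<Delta> * \<Psi> (1 / y)) + exp (\<Delta> * \<Psi> (2 / y)))
        + 0 * (1 - 2 * exp (\<Delta> * \<Psi> (1 / 1)) + exp (\<Delta> * \<Psi> (2 / 1)))
        \<le> h y * exp (- (lam * ((1 - \<delta>) / (1 + \<delta>)) * \<Delta> * g y))" by simp
    qed
    finally show "(\<integral>\<^sup>+\<omega>. ennreal (exp (- (lam * f (max (y + \<xi> \<omega>) b)))) \<partial>M)
      \<le> ennreal (exp (- (lam * f (max y b))) * exp (- (lam * ((1 - \<delta>) / (1 + \<delta>)) * \<Delta> * g y)))"
      by (simp add: h_def)
  qed simp
qed

text \<open>Here the expectation may grow, so the upper estimate for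
  \<open>exp (\<Delta> * \<Psi> (1 / y)) - 1\<close> is used, and falls below \<open>b\<close> have
  to be paid for. The hypothesis with \<open>C4\<close> makes their price at most of the order of
  \<open>lam * G y\<close>, like the drift. One factor \<open>1 + \<delta>\<close> covers the
  errors, the other the replacement of \<open>\<gamma> * G\<close> by \<open>g\<close>.\<close>

lemma down_step:
  assumes tf: "test_function \<phi> f G G' C y0" and gG: "\<And>y. y0 \<le> y \<Longrightarrow> \<gamma> * G y \<le> (1 + \<delta>) * g y"
    and \<delta>: "0 < \<delta>" and \<Lambda>: "0 \<le> \<Lambda>" and C4: "0 < C4"
  obtains b0 where "y0 \<le> b0" "\<And>b lam y \<Delta> (\<xi> :: 'a \<Rightarrow> real) M.
    b0 \<le> b \<Longrightarrow> 0 < lam \<Longrightarrow> lam * (C * \<phi> b) \<le> \<Lambda> \<Longrightarrow> 2 * b \<le> y \<Longrightarrow>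
    exp \<Lambda> / (exp (y / (2 * (2 * b))) - 1)\<^sup>2 \<le> C4 * (lam * G y) * (2 * b) \<Longrightarrow>
    0 < \<Delta> \<Longrightarrow> \<Delta> \<le> 1 \<Longrightarrow> prob_space M \<Longrightarrow>
    \<xi> \<in> borel_measurable M \<Longrightarrow> (\<And>l. 0 \<le> l \<Longrightarrow> (\<integral>\<^sup>+\<omega>. ennreal (exp (- l * \<xi> \<omega>)) \<partial>M) = ennreal (exp (\<Delta> * \<Psi> l))) \<Longrightarrow>
    (\<integral>\<^sup>+\<omega>. ennreal (exp (lam * f (max (y + \<xi> \<omega>) b))) \<partial>M)
      \<le> ennreal (exp (lam * f (max y b)) * exp (lam * (1 + \<delta>)\<^sup>2 * \<Delta> * g y))"
proof -
  have "0 < C" using tf by (simp add: test_function_def)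
  then have C3: "4 \<le> taylor_const C \<Lambda>" using \<Lambda> by (simp add: taylor_const_def)
  \<comment> \<open>Three errors share the budget \<open>\<delta> * \<gamma>\<close>: that of the
    linear term, that of the quadratic term, and the falls below \<open>b\<close>.\<close>
  define \<epsilon> where "\<epsilon> = \<delta> * \<gamma> / (1 + taylor_const C \<Lambda> + C4)"
  have \<epsilon>: "0 < \<epsilon>" using \<delta> \<gamma>_pos C3 C4 by (simp add: \<epsilon>_def)
  have \<epsilon>eq: "(1 + taylor_const C \<Lambda> + C4) * \<epsilon> = \<delta> * \<gamma>" using C3 C4 by (simp add: \<epsilon>_def)
  obtain l0 where l0: "l0 > 0" "\<And>lam \<Delta>. 0 < lam \<Longrightarrow> lam \<le> l0 \<Longrightarrow> 0 < \<Delta> \<Longrightarrow> \<Delta> \<le> 1 \<Longrightarrow>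
      1 - 2 * exp (\<Delta> * \<Psi> lam) + exp (\<Delta> * \<Psi> (2 * lam)) \<le> \<epsilon> * \<Delta> * lam \<and>
      exp (\<Delta> * \<Psi> lam) - 1 \<le> \<Delta> * lam * (\<gamma> + \<epsilon>)"
    using laplace_step_bounds[OF \<gamma>_pos \<Psi>_lim \<Psi>_ge \<epsilon>] by blast
  show ?thesis
  proof (rule that[of "max y0 (1 / l0)"])
    fix b lam y \<Delta> :: real and \<xi> :: "'a \<Rightarrow> real" and M
    assume b: "max y0 (1 / l0) \<le> b" and lam: "0 < lam" "lam * (C * \<phi> b) \<le> \<Lambda>" and y: "2 * b \<le> y"
      and cap: "exp \<Lambda> / (exp (y / (2 * (2 * b))) - 1)\<^sup>2 \<le> C4 * (lam * G y) * (2 * b)"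
      and \<Delta>: "0 < \<Delta>" "\<Delta> \<le> 1" and M: "prob_space M" and \<xi>: "\<xi> \<in> borel_measurable M"
      and lap: "\<And>l. 0 \<le> l \<Longrightarrow> (\<integral>\<^sup>+\<omega>. ennreal (exp (- l * \<xi> \<omega>)) \<partial>M) = ennreal (exp (\<Delta> * \<Psi> l))"
    have yb: "y0 \<le> b" using b by simp
    note tff = tf_facts[OF tf yb lam]
    have b0: "0 < b" using yb tf by (simp add: test_function_def)
    have y0: "0 < y" "b \<le> y" using y b0 by auto
    have "1 / l0 \<le> y" using b y b0 by simp
    then have ly: "1 / y \<le> l0" using l0(1) y0 by (simp add: divide_le_eq mult.commute)
    have "1 / l0 \<le> 2 * b" using b b0 by simp
    then have la: "1 / (2 * b) \<le> l0" using l0(1) b0 by (simp add: divide_le_eq mult.commute)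
    define a where "a = 2 * b"
    have a: "0 < a" using b0 by (simp add: a_def)
    define h where "h = (\<lambda>z. exp (lam * f (max z b)))"
    define D where "D = y * (lam * G y * h y)"
    define \<kappa> where "\<kappa> = exp \<Lambda> / (exp (y / (2 * (2 * b))) - 1)\<^sup>2"
    have h1: "1 \<le> h y" using tff(5)[of "max y b"] lam by (simp add: h_def)
    have lG: "0 < lam * G y" using lam tff(3)[OF y0(2)] by simp
    have D: "0 < D" using y0 lG h1 by (simp add: D_def)
    interpret prob_space M by (rule M)
    have bd: "h (y + v) \<le> h y + (- D) * (1 - exp (- v / y)) + (taylor_const C \<Lambda> * D) * (1 - exp (- v / y))\<^sup>2 + \<kappa> * (1 - exp (- v / a))\<^sup>2" for v
      using down_bound[OF tf yb lam y, of v] by (simp add: h_def D_def \<kappa>_def a_def)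
    have "(\<integral>\<^sup>+\<omega>. ennreal (h (y + \<xi> \<omega>)) \<partial>M) \<le> ennreal (h y + (- D) * (1 - exp (\<Delta> * \<Psi> (1 / y)))
        + (taylor_const C \<Lambda> * D) * (1 - 2 * exp (\<Delta> * \<Psi> (1 / y)) + exp (\<Delta> * \<Psi> (2 / y)))
        + \<kappa> * (1 - 2 * exp (\<Delta> * \<Psi> (1 / a)) + exp (\<Delta> * \<Psi> (2 / a))))"
      by (rule exponential_moment_bound[where E = "\<lambda>l. exp (\<Delta> * \<Psi> l)", OF \<xi> lap _ y0(1) a _ bd]) (auto simp: h_def)
    also have "\<dots> \<le> ennreal (h y * exp (lam * (1 + \<delta>)\<^sup>2 * \<Delta> * g y))"
    proof (rule ennreal_leI)
      have s: "1 - 2 * exp (\<Delta> * \<Psi> (1 / y)) + exp (\<Delta> * \<Psi> (2 / y)) \<le> \<epsilon> * \<Delta> * (1 / y)"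
        and e: "exp (\<Delta> * \<Psi> (1 / y)) - 1 \<le> \<Delta> * (1 / y) * (\<gamma> + \<epsilon>)"
        using l0(2)[of "1 / y" \<Delta>] ly y0 \<Delta> by simp_all
      have s2: "1 - 2 * exp (\<Delta> * \<Psi> (1 / a)) + exp (\<Delta> * \<Psi> (2 / a)) \<le> \<epsilon> * \<Delta> * (1 / a)"
        using l0(2)[of "1 / a" \<Delta>] la a \<Delta> by (simp add: a_def)
      define x where "x = lam * (1 + \<delta>) * \<Delta> * (\<gamma> * G y)"
      have "\<kappa> * (\<epsilon> * \<Delta> * (1 / a)) \<le> (C4 * (lam * G y) * a) * (\<epsilon> * \<Delta> * (1 / a))"
        using cap \<epsilon> \<Delta> a by (intro mult_right_mono) (auto simp: \<kappa>_def a_def)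
      also have "\<dots> = C4 * (lam * G y) * (\<epsilon> * \<Delta>) * 1" using a by simp
      also have "\<dots> \<le> C4 * (lam * G y) * (\<epsilon> * \<Delta>) * h y" using h1 C4 lG \<epsilon> \<Delta> by (intro mult_left_mono) auto
      finally have k: "\<kappa> * (\<epsilon> * \<Delta> * (1 / a)) \<le> C4 * (lam * G y) * (\<epsilon> * \<Delta>) * h y" .
      have "(- D) * (1 - exp (\<Delta> * \<Psi> (1 / y))) = D * (exp (\<Delta> * \<Psi> (1 / y)) - 1)" by (simp add: algebra_simps)
      also have "\<dots> \<le> D * (\<Delta> * (1 / y) * (\<gamma> + \<epsilon>))" using e D by (intro mult_left_mono) auto
      also have "\<dots> = (lam * G y) * \<Delta> * (\<gamma> + \<epsilon>) * h y" using y0 by (simp add: D_def)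
      finally have t1: "(- D) * (1 - exp (\<Delta> * \<Psi> (1 / y))) \<le> (lam * G y) * \<Delta> * (\<gamma> + \<epsilon>) * h y" .
      have "(taylor_const C \<Lambda> * D) * (1 - 2 * exp (\<Delta> * \<Psi> (1 / y)) + exp (\<Delta> * \<Psi> (2 / y))) \<le> (taylor_const C \<Lambda> * D) * (\<epsilon> * \<Delta> * (1 / y))"
        using s D C3 by (intro mult_left_mono) auto
      also have "\<dots> = taylor_const C \<Lambda> * (lam * G y) * (\<epsilon> * \<Delta>) * h y" using y0 by (simp add: D_def)
      finally have t2: "(taylor_const C \<Lambda> * D) * (1 - 2 * exp (\<Delta> * \<Psi> (1 / y)) + exp (\<Delta> * \<Psi> (2 / y))) \<le> taylor_const C \<Lambda> * (lam * G y) * (\<epsilon> * \<Delta>) * h y" .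
      have "\<kappa> * (1 - 2 * exp (\<Delta> * \<Psi> (1 / a)) + exp (\<Delta> * \<Psi> (2 / a))) \<le> \<kappa> * (\<epsilon> * \<Delta> * (1 / a))"
        using s2 by (intro mult_left_mono) (auto simp: \<kappa>_def)
      then have t3: "\<kappa> * (1 - 2 * exp (\<Delta> * \<Psi> (1 / a)) + exp (\<Delta> * \<Psi> (2 / a))) \<le> C4 * (lam * G y) * (\<epsilon> * \<Delta>) * h y"
        using k by linarith
      have "h y + (- D) * (1 - exp (\<Delta> * \<Psi> (1 / y))) + (taylor_const C \<Lambda> * D) * (1 - 2 * exp (\<Delta> * \<Psi> (1 / y)) + exp (\<Delta> * \<Psi> (2 / y)))
          + \<kappa> * (1 - 2 * exp (\<Delta> * \<Psi> (1 / a)) + exp (\<Delta> * \<Psi> (2 / a)))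
          \<le> h y + (lam * G y) * \<Delta> * (\<gamma> + \<epsilon>) * h y + taylor_const C \<Lambda> * (lam * G y) * (\<epsilon> * \<Delta>) * h y + C4 * (lam * G y) * (\<epsilon> * \<Delta>) * h y"
        using t1 t2 t3 by (intro add_mono) auto
      also have "\<dots> = h y * (1 + lam * G y * \<Delta> * (\<gamma> + (1 + taylor_const C \<Lambda> + C4) * \<epsilon>))" by (simp add: algebra_simps)
      also have "\<dots> = h y * (1 + x)" unfolding \<epsilon>eq by (simp add: x_def algebra_simps)
      also have "\<dots> \<le> h y * exp x" using exp_ge_add_one_self[of x] by (intro mult_left_mono) (auto simp: h_def)
      also have "\<dots> \<le> h y * exp (lam * (1 + \<delta>)\<^sup>2 * \<Delta> * g y)"
      proof -
        have "x \<le> lam * (1 + \<delta>) * \<Delta> * ((1 + \<delta>) * g y)" unfolding x_def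
          using gG[of y] y0 yb lam \<delta> \<Delta> by (intro mult_left_mono) auto
        also have "\<dots> = lam * (1 + \<delta>)\<^sup>2 * \<Delta> * g y" by (simp add: power2_eq_square mult_ac)
        finally show ?thesis by (intro mult_left_mono) (auto simp: h_def)
      qed
      finally show "h y + (- D) * (1 - exp (\<Delta> * \<Psi> (1 / y)))
        + (taylor_const C \<Lambda> * D) * (1 - 2 * exp (\<Delta> * \<Psi> (1 / y)) + exp (\<Delta> * \<Psi> (2 / y)))
        + \<kappa> * (1 - 2 * exp (\<Delta> * \<Psi> (1 / a)) + exp (\<Delta> * \<Psi> (2 / a)))
        \<le> h y * exp (lam * (1 + \<delta>)\<^sup>2 * \<Delta> * g y)" .
    qed
    finally show "(\<integral>\<^sup>+\<omega>. ennreal (exp (lam * f (max (y + \<xi> \<omega>) b))) \<partial>M)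
      \<le> ennreal (exp (lam * f (max y b)) * exp (lam * (1 + \<delta>)\<^sup>2 * \<Delta> * g y))"
      by (simp add: h_def)
  qed simp
qed

end

section \<open>Exponential deviation bounds, uniform in the mesh\<close>

section \<open>Deviation bounds for the sampled process\<close>

text \<open>The clock advances only while it is at most \<open>T\<close>, so it overshoots by a
  single step at most.\<close>

lemma chain_snd_le:
  assumes "0 \<le> T" "0 \<le> \<Delta>" "\<And>y. g y \<le> c" "0 \<le> c"
  shows "snd (chain g a T \<Delta> \<xi> x k) \<le> T + \<Delta> * c"
proof (induction k)
  case (Suc k)
  have "\<Delta> * g (fst (chain g a T \<Delta> \<xi> x k)) \<le> \<Delta> * c" using assms by (intro mult_left_mono) auto
  then show ?case using Suc by (auto simp: chain_step_def)
qed (use assms in simp)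

lemma sets_states:
  fixes u v :: real
  shows "{s. u < fst s \<and> v < snd s} \<in> sets (borel \<Otimes>\<^sub>M borel :: (real \<times> real) measure)"
    and "{s. fst s < u} \<in> sets (borel \<Otimes>\<^sub>M borel :: (real \<times> real) measure)"
proof -
  have "{s \<in> space (borel \<Otimes>\<^sub>M borel :: (real \<times> real) measure). u < fst s \<and> v < snd s} \<in> sets (borel \<Otimes>\<^sub>M borel)"
    by measurable
  then show "{s. u < fst s \<and> v < snd s} \<in> sets (borel \<Otimes>\<^sub>M borel :: (real \<times> real) measure)"
    by (simp add: space_pair_measure)
  have "{s \<in> space (borel \<Otimes>\<^sub>M borel :: (real \<times> real) measure). fst s < u} \<in> sets (borel \<Otimes>\<^sub>M borel)"
    by measurable
  then show "{s. fst s < u} \<in> sets (borel \<Otimes>\<^sub>M borel :: (real \<times> real) measure)"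
    by (simp add: space_pair_measure)
qed

lemma exp_minus_inverse_le: "0 < \<eta> \<Longrightarrow> exp (- (1 / \<eta>)) \<le> (\<eta> :: real)"
proof -
  assume \<eta>: "0 < \<eta>"
  have "1 / \<eta> \<le> exp (1 / \<eta>)" using exp_ge_add_one_self[of "1 / \<eta>"] by linarith
  then have "inverse (exp (1 / \<eta>)) \<le> inverse (1 / \<eta>)" using \<eta> by (intro le_imp_inverse_le) auto
  then show ?thesis by (simp add: exp_minus)
qed

context levy_tail
begin

lemma measurable_truncated_g:
  assumes "0 < a" shows "(\<lambda>y. g (max y a)) \<in> borel_measurable borel"
proof -
  have "continuous_on UNIV (\<lambda>y. g (max y a))"
    by (rule continuous_on_compose2[OF g_cont]) (use assms in \<open>auto intro!: continuous_intros\<close>)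
  then show ?thesis by (rule borel_measurable_continuous_onI)
qed

lemma measurable_truncated_test_function:
  assumes "test_function \<phi> f G G' C y0" "y0 \<le> b" shows "(\<lambda>z. f (max z b)) \<in> borel_measurable borel"
proof -
  have "continuous_on {b..} f"
  proof (intro continuous_at_imp_continuous_on ballI)
    fix x assume "x \<in> {b..}"
    then have "(f has_real_derivative - G x) (at x)" using assms by (simp add: test_function_def)
    then show "isCont f x" by (rule DERIV_isCont)
  qed
  then have "continuous_on UNIV (\<lambda>z. f (max z b))"
    by (rule continuous_on_compose2) (auto intro!: continuous_intros)
  then show ?thesis by (rule borel_measurable_continuous_onI)
qed

lemma eventually_quarter:
  assumes "\<forall>\<^sub>F y in at_top. P y" shows "\<forall>\<^sub>F \<beta> in at_top. P (\<beta> / 4 :: real)"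
  using eventually_scale[of "1/4", OF _ assms] by simp

text \<open>On the bad event the clock has passed \<open>T \<ge> \<phi> \<beta>\<close> while the
  position is so high that \<open>f\<close> is at most \<open>\<theta> * \<phi> \<beta>\<close> with
  \<open>\<theta> < 1\<close>. There the supermartingale is at least
  \<open>exp (1 / \<eta>)\<close>, whereas it starts from at most 1 for every \<open>x\<close>. The
  choice \<open>b = \<beta> / 4\<close> makes \<open>2 * b\<close> the stopping level.\<close>

lemma upper_deviation:
  assumes \<epsilon>: "0 < \<epsilon>" and \<eta>: "0 < \<eta>"
  obtains \<beta>0 where "\<And>\<beta> T \<Delta> \<xi> n x (M :: 'a measure). \<beta>0 \<le> \<beta> \<Longrightarrow> \<phi> \<beta> \<le> T \<Longrightarrow> 0 < \<Delta> \<Longrightarrow> \<Delta> \<le> 1 \<Longrightarrow>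
    levy_increments M \<Psi> \<Delta> \<xi> n \<Longrightarrow>
    measure M {\<omega> \<in> space M. chain (\<lambda>y. g (max y (\<beta> / 2))) (\<beta> / 2) T \<Delta> (\<lambda>i. \<xi> i \<omega>) x n
      \<in> {s. (1 + \<epsilon>) * \<beta> < fst s \<and> T < snd s}} \<le> \<eta>"
proof -
  obtain c where c: "c > 0" "\<forall>\<^sub>F \<beta> in at_top. (1 + c) * \<phi> ((1 + \<epsilon> / 2) * \<beta>) \<le> \<phi> \<beta>" using decay[of "1 + \<epsilon> / 2"] \<epsilon> by auto
  define \<theta> where "\<theta> = 1 / (1 + c / 2)"
  have \<theta>: "0 < \<theta>" "\<theta> < 1" using c by (auto simp: \<theta>_def)
  \<comment> \<open>Chosen so that \<open>1 - 2 * \<delta> - \<theta> = (1 - \<theta>) / 2\<close>,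
    where \<open>1 - 2 * \<delta>\<close> bounds \<open>(1 - \<delta>) / (1 + \<delta>)\<close> from
    below.\<close>
  define \<delta> where "\<delta> = (1 - \<theta>) / 4"
  have \<delta>: "0 < \<delta>" "\<delta> < 1" using \<theta> by (auto simp: \<delta>_def)
  obtain r0 where r0: "r0 > 1" "\<And>r. 1 < r \<and> r \<le> r0 \<Longrightarrow> (\<exists>f G G' C y0. test_function \<phi> f G G' C y0 \<and>
    (\<forall>y\<ge>y0. g y \<le> (1 + \<delta>) * (\<gamma> * G y) \<and> f y \<le> r\<^sup>2 * \<phi> (y / r\<^sup>2)))" using upper_test_function[OF \<delta>(1)] by blast
  \<comment> \<open>\<open>m\<close> is the value of \<open>r\<^sup>2\<close>. The caps keep
    \<open>r\<close> below \<open>r0\<close>, keep the shifted argument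
    \<open>(1 + \<epsilon>) * \<beta> / m\<close> above
    \<open>(1 + \<epsilon> / 2) * \<beta>\<close>, and let the prefactor \<open>m\<close> use up
    only part of the gain \<open>1 + c\<close>.\<close>
  define m where "m = min (r0\<^sup>2) (min ((1 + \<epsilon>) / (1 + \<epsilon> / 2)) ((1 + c) / (1 + c / 2)))"
  define r where "r = sqrt m"
  have m: "1 < m" using r0 \<epsilon> c by (simp add: m_def one_less_power)
  have r: "1 < r" "r\<^sup>2 = m" using m by (auto simp: r_def)
  have "m \<le> r0\<^sup>2" by (simp add: m_def)
  then have "r \<le> r0" using r0 unfolding r_def by (intro real_le_lsqrt) auto
  then obtain f G G' C y0 where tf: "test_function \<phi> f G G' C y0"
    and fG: "\<And>y. y0 \<le> y \<Longrightarrow> g y \<le> (1 + \<delta>) * (\<gamma> * G y)" "\<And>y. y0 \<le> y \<Longrightarrow> f y \<le> r\<^sup>2 * \<phi> (y / r\<^sup>2)"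
    using r0(2)[of r] r(1) by blast
  have C: "0 < C" "0 < y0" using tf by (auto simp: test_function_def)
  \<comment> \<open>Makes the exponent \<open>K * ((1 - \<theta>) / 2)\<close> equal to
    \<open>1 / \<eta>\<close>.\<close>
  define K where "K = 2 / (\<eta> * (1 - \<theta>))"
  have K: "0 < K" using \<eta> \<theta> by (simp add: K_def)
  obtain D where D: "D > 0" "\<forall>\<^sub>F y in at_top. \<phi> y \<le> D * \<phi> (4 * y)" using doubling_pos[of 4] by auto
  \<comment> \<open>As \<open>\<phi> (\<beta> / 4) \<le> D * \<phi> \<beta>\<close>, this bounds
    \<open>lam * (C * \<phi> (\<beta> / 4))\<close> for \<open>lam = K / \<phi> \<beta>\<close>,
    independently of \<open>\<beta>\<close>.\<close>
  define \<Lambda> where "\<Lambda> = K * C * D"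
  have \<Lambda>: "0 \<le> \<Lambda>" using K C D by (simp add: \<Lambda>_def)
  obtain b0 where b0: "y0 \<le> b0" and step: "\<And>b lam y \<Delta> (\<xi> :: 'a \<Rightarrow> real) M.
    b0 \<le> b \<Longrightarrow> 0 < lam \<Longrightarrow> lam * (C * \<phi> b) \<le> \<Lambda> \<Longrightarrow> 2 * b \<le> y \<Longrightarrow> 0 < \<Delta> \<Longrightarrow> \<Delta> \<le> 1 \<Longrightarrow> prob_space M \<Longrightarrow>
    \<xi> \<in> borel_measurable M \<Longrightarrow> (\<And>l. 0 \<le> l \<Longrightarrow> (\<integral>\<^sup>+\<omega>. ennreal (exp (- l * \<xi> \<omega>)) \<partial>M) = ennreal (exp (\<Delta> * \<Psi> l))) \<Longrightarrow>
    (\<integral>\<^sup>+\<omega>. ennreal (exp (- (lam * f (max (y + \<xi> \<omega>) b)))) \<partial>M)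
      \<le> ennreal (exp (- (lam * f (max y b))) * exp (- (lam * ((1 - \<delta>) / (1 + \<delta>)) * \<Delta> * g y)))"
    using up_step[OF tf fG(1) \<delta> \<Lambda>] by blast
  have "\<forall>\<^sub>F \<beta> in at_top. b0 \<le> \<beta> / 4 \<and> \<phi> (\<beta> / 4) \<le> D * \<phi> (4 * (\<beta> / 4)) \<and> (1 + c) * \<phi> ((1 + \<epsilon> / 2) * \<beta>) \<le> \<phi> \<beta>"
    using eventually_quarter[OF eventually_ge_at_top[of b0]] eventually_quarter[OF D(2)] c(2) by eventually_elim simp
  then obtain \<beta>0 where \<beta>0: "\<And>\<beta>. \<beta>0 \<le> \<beta> \<Longrightarrow> b0 \<le> \<beta> / 4 \<and> \<phi> (\<beta> / 4) \<le> D * \<phi> (4 * (\<beta> / 4)) \<and> (1 + c) * \<phi> ((1 + \<epsilon> / 2) * \<beta>) \<le> \<phi> \<beta>"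
    unfolding eventually_at_top_linorder by blast
  show ?thesis
  proof (rule that[of \<beta>0])
    fix \<beta> T \<Delta> :: real and \<xi> and n :: nat and x :: real and M :: "'a measure"
    assume \<beta>: "\<beta>0 \<le> \<beta>" and T: "\<phi> \<beta> \<le> T" and \<Delta>: "0 < \<Delta>" "\<Delta> \<le> 1" and inc: "levy_increments M \<Psi> \<Delta> \<xi> n"
    interpret prob_space M using inc by (simp add: levy_increments_def)
    have ind: "indep_vars (\<lambda>_. borel) \<xi> {..<n}" using inc by (simp add: levy_increments_def)
    have lap: "(\<integral>\<^sup>+\<omega>. ennreal (exp (- l * \<xi> i \<omega>)) \<partial>M) = ennreal (exp (\<Delta> * \<Psi> l))" if "i < n" "0 \<le> l" for i l
      using inc that by (simp add: levy_increments_def)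
    have rv: "\<xi> i \<in> borel_measurable M" if "i < n" for i using ind that unfolding indep_vars_def by auto
    define b where "b = \<beta> / 4"
    define a where "a = \<beta> / 2"
    define t where "t = \<phi> \<beta>"
    define lam where "lam = K / t"
    define q where "q = (1 - \<delta>) / (1 + \<delta>)"
    have bb: "b0 \<le> b" "\<phi> b \<le> D * t" "(1 + c) * \<phi> ((1 + \<epsilon> / 2) * \<beta>) \<le> t"
      using \<beta>0[OF \<beta>] by (auto simp: b_def t_def)
    have yb: "y0 \<le> b" using bb b0 by simp
    have \<beta>pos: "0 < \<beta>" using yb C by (simp add: b_def)
    have t: "0 < t" unfolding t_def using \<beta>pos by (rule \<phi>_pos)
    have lam: "0 < lam" using K t by (simp add: lam_def)
    have lamt: "lam * t = K" using t by (simp add: lam_def)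
    have small: "lam * (C * \<phi> b) \<le> \<Lambda>"
    proof -
      have "lam * (C * \<phi> b) \<le> lam * (C * (D * t))" using bb lam C by (intro mult_left_mono) auto
      also have "\<dots> = \<Lambda>" using lamt by (simp add: \<Lambda>_def mult_ac)
      finally show ?thesis .
    qed
    note dec = tf_decreasing[OF tf yb lam small]
    define h where "h = (\<lambda>z. exp (- (lam * f (max z b))))"
    have f1: "f ((1 + \<epsilon>) * \<beta>) \<le> \<theta> * t"
    proof -
      have le\<beta>: "b \<le> (1 + \<epsilon>) * \<beta>" using \<beta>pos \<epsilon> by (simp add: b_def algebra_simps add_increasing2)
      have "m \<le> (1 + \<epsilon>) / (1 + \<epsilon> / 2)" by (simp add: m_def)
      then have "(1 + \<epsilon> / 2) * m \<le> 1 + \<epsilon>" using \<epsilon> by (simp add: field_simps)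
      then have "(1 + \<epsilon> / 2) * m * \<beta> \<le> (1 + \<epsilon>) * \<beta>" using \<beta>pos by (intro mult_right_mono) auto
      then have "(1 + \<epsilon> / 2) * \<beta> \<le> (1 + \<epsilon>) * \<beta> / m" using m by (simp add: le_divide_eq mult_ac)
      then have "\<phi> ((1 + \<epsilon>) * \<beta> / m) \<le> \<phi> ((1 + \<epsilon> / 2) * \<beta>)" using \<beta>pos \<epsilon> by (intro \<phi>_decreasing) auto
      also have "\<dots> \<le> t / (1 + c)" using bb c by (simp add: le_divide_eq mult.commute)
      finally have "m * \<phi> ((1 + \<epsilon>) * \<beta> / m) \<le> m * (t / (1 + c))" using m by (intro mult_left_mono) auto
      then have "f ((1 + \<epsilon>) * \<beta>) \<le> m * (t / (1 + c))"
        using fG(2)[of "(1 + \<epsilon>) * \<beta>"] le\<beta> yb unfolding r(2) by linarith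
      also have "\<dots> \<le> ((1 + c) / (1 + c / 2)) * (t / (1 + c))" using t c by (intro mult_right_mono) (auto simp: m_def)
      also have "\<dots> = \<theta> * t" using c by (simp add: \<theta>_def)
      finally show ?thesis .
    qed
    have "prob {\<omega> \<in> space M. chain (\<lambda>y. g (max y a)) a T \<Delta> (\<lambda>i. \<xi> i \<omega>) x n \<in> {s. (1 + \<epsilon>) * \<beta> < fst s \<and> T < snd s}}
        \<le> h x / exp (1 / \<eta>)"
    proof (rule chain_exp_bound[OF measurable_truncated_g ind, where c = "lam * q"])
      show "0 < a" using \<beta>pos by (simp add: a_def)
      show "h \<in> borel_measurable borel" unfolding h_def
        using measurable_truncated_test_function[OF tf yb] by measurable
      show "0 \<le> h z" for z by (simp add: h_def)
      show "{s. (1 + \<epsilon>) * \<beta> < fst s \<and> T < snd s} \<in> sets (borel \<Otimes>\<^sub>M borel)" by (rule sets_states(1))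
      show "0 < exp (1 / \<eta>)" by simp
      show "(\<integral>\<^sup>+\<omega>. ennreal (h (z + \<xi> i \<omega>)) \<partial>M) \<le> ennreal (h z * exp (- (lam * q * \<Delta> * g (max z a))))"
        if "i < n" "a \<le> z" for i z
        using step[OF bb(1) lam small _ \<Delta> prob_space_axioms rv[OF that(1)] lap[OF that(1)], of z] that(2)
        by (simp add: h_def q_def a_def b_def max_absorb1)
      fix \<omega> assume "chain (\<lambda>y. g (max y a)) a T \<Delta> (\<lambda>i. \<xi> i \<omega>) x n \<in> {s. (1 + \<epsilon>) * \<beta> < fst s \<and> T < snd s}"
      then obtain z A where zA: "chain (\<lambda>y. g (max y a)) a T \<Delta> (\<lambda>i. \<xi> i \<omega>) x n = (z, A)" "(1 + \<epsilon>) * \<beta> < z" "T < A"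
        by (cases "chain (\<lambda>y. g (max y a)) a T \<Delta> (\<lambda>i. \<xi> i \<omega>) x n") auto
      have le\<beta>: "b \<le> (1 + \<epsilon>) * \<beta>" using \<beta>pos \<epsilon> by (simp add: b_def algebra_simps add_increasing2)
      have "f (max z b) \<le> f ((1 + \<epsilon>) * \<beta>)" using zA le\<beta> by (intro dec) auto
      then have "lam * f (max z b) \<le> lam * (\<theta> * t)" using f1 lam by (intro mult_left_mono) auto
      also have "\<dots> = K * \<theta>" using lamt by (simp add: mult_ac)
      finally have 1: "lam * f (max z b) \<le> K * \<theta>" .
      have q: "1 - 2 * \<delta> \<le> q" unfolding q_def using \<delta> by (simp add: le_divide_eq algebra_simps)
      have q0: "0 \<le> q" using \<delta> by (simp add: q_def)
      have "K * (1 - 2 * \<delta>) \<le> K * q" using q K by (intro mult_left_mono) auto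
      also have "\<dots> = lam * q * t" using lamt by (simp add: mult_ac)
      also have "\<dots> \<le> lam * q * A" using T zA lam q0 by (intro mult_left_mono) (auto simp: t_def)
      finally have 2: "K * (1 - 2 * \<delta>) \<le> lam * q * A" .
      have "1 / \<eta> = K * (1 - 2 * \<delta>) - K * \<theta>"
      proof -
        have "K * (1 - 2 * \<delta>) - K * \<theta> = K * (1 - 2 * \<delta> - \<theta>)" by (simp add: right_diff_distrib)
        also have "1 - 2 * \<delta> - \<theta> = (1 - \<theta>) / 2" by (simp add: \<delta>_def field_simps)
        finally have e1: "K * (1 - 2 * \<delta>) - K * \<theta> = K * ((1 - \<theta>) / 2)" .
        have eq: "2 / (\<eta> * w) * (w / 2) = 1 / \<eta>" if "w \<noteq> 0" for w using that \<eta> by simp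
        have "K * ((1 - \<theta>) / 2) = 1 / \<eta>" unfolding K_def by (rule eq) (use \<theta> in simp)
        then show ?thesis using e1 by (simp only:)
      qed
      then have "1 / \<eta> \<le> lam * q * A - lam * f (max z b)" using 1 2 by linarith
      then have "exp (1 / \<eta>) \<le> exp (- (lam * f (max z b)) + lam * q * A)" by simp
      then show "exp (1 / \<eta>) \<le> h (fst (chain (\<lambda>y. g (max y a)) a T \<Delta> (\<lambda>i. \<xi> i \<omega>) x n)) *
          exp (lam * q * snd (chain (\<lambda>y. g (max y a)) a T \<Delta> (\<lambda>i. \<xi> i \<omega>) x n))"
        unfolding zA(1) by (simp add: h_def exp_add[symmetric])
    qed
    also have "\<dots> \<le> 1 / exp (1 / \<eta>)"
    proof -
      have "0 \<le> lam * f (max x b)" using tf_facts(5)[OF tf yb lam small, of "max x b"] lam by simp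
      then show ?thesis by (intro divide_right_mono) (auto simp: h_def)
    qed
    also have "\<dots> = exp (- (1 / \<eta>))" by (simp add: exp_minus inverse_eq_divide)
    also have "\<dots> \<le> \<eta>" by (rule exp_minus_inverse_le[OF \<eta>])
    finally show "prob {\<omega> \<in> space M. chain (\<lambda>y. g (max y (\<beta> / 2))) (\<beta> / 2) T \<Delta> (\<lambda>i. \<xi> i \<omega>) x n
      \<in> {s. (1 + \<epsilon>) * \<beta> < fst s \<and> T < snd s}} \<le> \<eta>" by (simp only: a_def)
  qed
qed

text \<open>Continuity of \<open>R\<close> says nothing at infinity; the bound comes from
  \<open>g \<le> 2 * (\<gamma> * G)\<close> and \<open>y * G y \<le> C * \<phi> y\<close>. It limits
  the overshoot of the clock and supplies the bounded rate for the Riemann sums.\<close>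

lemma g_eventually_bounded:
  obtains c y1 where "0 < c" "\<And>y. y1 \<le> y \<Longrightarrow> g y \<le> c"
proof -
  obtain r0 where r0: "r0 > 1" "\<And>r. 1 < r \<and> r \<le> r0 \<Longrightarrow> (\<exists>f G G' C y0. test_function \<phi> f G G' C y0 \<and>
    (\<forall>y\<ge>y0. g y \<le> (1 + 1) * (\<gamma> * G y) \<and> f y \<le> r\<^sup>2 * \<phi> (y / r\<^sup>2)))" using upper_test_function[of 1] by auto
  then obtain f G G' C y0 where tf: "test_function \<phi> f G G' C y0" and gG: "\<And>y. y0 \<le> y \<Longrightarrow> g y \<le> (1 + 1) * (\<gamma> * G y)"
    using r0(2)[of r0] by blast
  have C: "0 < C" "0 < y0" using tf by (auto simp: test_function_def)
  have "g y \<le> 2 * (\<gamma> * (C * \<phi> y0 / y0))" if y: "y0 \<le> y" for y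
  proof -
    have "y * G y \<le> C * \<phi> y" using tf y by (simp add: test_function_def)
    then have "G y \<le> C * \<phi> y / y" using y C by (simp add: le_divide_eq mult.commute)
    also have "\<dots> \<le> C * \<phi> y0 / y0" using y C \<phi>_pos[of y0] by (intro frac_le mult_left_mono \<phi>_decreasing) auto
    finally have "2 * (\<gamma> * G y) \<le> 2 * (\<gamma> * (C * \<phi> y0 / y0))" using \<gamma>_pos by (intro mult_left_mono) auto
    then show ?thesis using gG[OF y] by simp
  qed
  moreover have "0 < 2 * (\<gamma> * (C * \<phi> y0 / y0))" using \<gamma>_pos C \<phi>_pos[of y0] by simp
  ultimately show ?thesis using that by blast
qed

text \<open>Below \<open>(1 - \<epsilon>) * \<beta>\<close> the function \<open>f\<close> is at
  least \<open>\<theta> * \<phi> \<beta>\<close> with \<open>\<theta> > 1\<close>, while the clock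
  is at most \<open>(1 + 2 * \<delta>) * \<phi> \<beta>\<close>. The overshoot of the clock counts
  against the bound, hence the upper limits on \<open>T\<close> and \<open>\<Delta>\<close>. The
  start is controlled only through the decay of \<open>\<phi>\<close> at infinity, hence
  \<open>x0\<close> depends on \<open>\<beta>\<close>.\<close>

lemma lower_deviation:
  assumes \<epsilon>: "0 < \<epsilon>" "\<epsilon> < 1 / 2" and \<eta>: "0 < \<eta>"
  obtains \<beta>0 \<delta> where "0 < \<delta>" "\<And>\<beta>. \<beta>0 \<le> \<beta> \<Longrightarrow> \<exists>x0. \<exists>\<Delta>0>0. \<forall>T \<Delta> \<xi> n x. \<forall>M :: 'a measure. x0 \<le> x \<longrightarrow>
    \<phi> \<beta> \<le> T \<longrightarrow> T \<le> (1 + \<delta>) * \<phi> \<beta> \<longrightarrow> 0 < \<Delta> \<longrightarrow> \<Delta> \<le> \<Delta>0 \<longrightarrow> levy_increments M \<Psi> \<Delta> \<xi> n \<longrightarrow>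
    measure M {\<omega> \<in> space M. chain (\<lambda>y. g (max y (\<beta> / 2))) (\<beta> / 2) T \<Delta> (\<lambda>i. \<xi> i \<omega>) x n
      \<in> {s. fst s < (1 - \<epsilon>) * \<beta>}} \<le> \<eta>"
proof -
  define k where "k = 1 - \<epsilon> / 2"
  have k: "1 / 2 < k" "k < 1" using \<epsilon> by (auto simp: k_def)
  obtain c where c: "c > 0" "\<forall>\<^sub>F \<beta> in at_top. (1 + c) * \<phi> (1 / k * \<beta>) \<le> \<phi> \<beta>" using decay[of "1 / k"] k by auto
  have c': "\<forall>\<^sub>F \<beta> in at_top. (1 + c) * \<phi> \<beta> \<le> \<phi> (k * \<beta>)" using eventually_scale[OF _ c(2), of k] k by simp
  define \<theta> where "\<theta> = 1 + c / 2"
  have \<theta>: "1 < \<theta>" using c by (simp add: \<theta>_def)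
  \<comment> \<open>Since \<open>(1 + \<delta>)\<^sup>2 * (1 + 2 * \<delta>) \<le> 1 + 10 *
    \<delta>\<close> for \<open>\<delta> \<le> 1 / 2\<close>, the clock uses at most half of the gap
    between 1 and \<open>\<theta>\<close>.\<close>
  define \<delta> where "\<delta> = min (1 / 2) ((\<theta> - 1) / 20)"
  have \<delta>: "0 < \<delta>" "\<delta> \<le> 1 / 2" "\<delta> \<le> (\<theta> - 1) / 20"
    using \<theta> unfolding \<delta>_def by (simp, simp, intro min.cobounded2)
  obtain r0 where r0: "r0 > 1" "\<And>r. 1 < r \<and> r \<le> r0 \<Longrightarrow> (\<exists>f G G' C y0. test_function \<phi> f G G' C y0 \<and>
    (\<forall>y\<ge>y0. \<gamma> * G y \<le> (1 + \<delta>) * g y \<and> \<phi> (r\<^sup>2 * y) / r\<^sup>2 \<le> f y))" using lower_test_function[OF \<delta>(1)] by blast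
  \<comment> \<open>Again the value of \<open>r\<^sup>2\<close>: the caps give
    \<open>r \<le> r0\<close>, keep \<open>m * (1 - \<epsilon>) * \<beta>\<close> below
    \<open>k * \<beta>\<close>, and leave at least \<open>\<theta>\<close> of the factor
    \<open>1 + c\<close> after division by \<open>m\<close>.\<close>
  define m where "m = min (r0\<^sup>2) (min (k / (1 - \<epsilon>)) ((1 + c) / \<theta>))"
  define r where "r = sqrt m"
  have m: "1 < m" using r0 \<epsilon> c by (simp add: m_def one_less_power k_def \<theta>_def)
  have r: "1 < r" "r\<^sup>2 = m" using m by (auto simp: r_def)
  have "m \<le> r0\<^sup>2" by (simp add: m_def)
  then have "r \<le> r0" using r0 unfolding r_def by (intro real_le_lsqrt) auto
  then obtain f G G' C y0 where tf: "test_function \<phi> f G G' C y0"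
    and fG: "\<And>y. y0 \<le> y \<Longrightarrow> \<gamma> * G y \<le> (1 + \<delta>) * g y" "\<And>y. y0 \<le> y \<Longrightarrow> \<phi> (r\<^sup>2 * y) / r\<^sup>2 \<le> f y"
    using r0(2)[of r] r(1) by blast
  have C: "0 < C" "0 < y0" using tf by (auto simp: test_function_def)
  \<comment> \<open>The exponent becomes \<open>1 + 1 / \<eta>\<close>; the summand 1 offsets the
    starting value, which is at most \<open>exp 1\<close>.\<close>
  define K where "K = 2 / (\<theta> - 1) * (1 + 1 / \<eta>)"
  have K: "0 < K" using \<eta> \<theta> by (simp add: K_def add_pos_pos)
  obtain D where D: "D > 0" "\<forall>\<^sub>F y in at_top. \<phi> y \<le> D * \<phi> (4 * y)" using doubling_pos[of 4] by auto
  define \<Lambda> where "\<Lambda> = K * C * D"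
  have \<Lambda>: "0 \<le> \<Lambda>" using K C D by (simp add: \<Lambda>_def)
  obtain N0 :: nat and D' y1 where D': "D' \<ge> 1" "y1 > 0"
    "\<And>x y. y1 \<le> x \<Longrightarrow> x \<le> y \<Longrightarrow> \<phi> x \<le> D' * (y / x) ^ N0 * \<phi> y" by (rule power_lower_bound) (rule that; assumption)
  \<comment> \<open>The extra power comes from \<open>y = s * (2 * b)\<close> when
    \<open>y * G y\<close> is expressed through \<open>2 * b\<close>; it also makes the exponent
    positive, as \<open>power_le_exp_square\<close> requires.\<close>
  define N where "N = Suc N0"
  define C4 where "C4 = exp \<Lambda> * (9 * real N ^ N) * (C * D' / K)"
  have C4: "0 < C4" using C D' K by (simp add: C4_def N_def)
  obtain cg y2 where cg: "0 < cg" "\<And>y. y2 \<le> y \<Longrightarrow> g y \<le> cg" by (rule g_eventually_bounded) (rule that; assumption)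
  obtain b0 where b0: "y0 \<le> b0" and step: "\<And>b lam y \<Delta> (\<xi> :: 'a \<Rightarrow> real) M.
    b0 \<le> b \<Longrightarrow> 0 < lam \<Longrightarrow> lam * (C * \<phi> b) \<le> \<Lambda> \<Longrightarrow> 2 * b \<le> y \<Longrightarrow>
    exp \<Lambda> / (exp (y / (2 * (2 * b))) - 1)\<^sup>2 \<le> C4 * (lam * G y) * (2 * b) \<Longrightarrow> 0 < \<Delta> \<Longrightarrow> \<Delta> \<le> 1 \<Longrightarrow> prob_space M \<Longrightarrow>
    \<xi> \<in> borel_measurable M \<Longrightarrow> (\<And>l. 0 \<le> l \<Longrightarrow> (\<integral>\<^sup>+\<omega>. ennreal (exp (- l * \<xi> \<omega>)) \<partial>M) = ennreal (exp (\<Delta> * \<Psi> l))) \<Longrightarrow>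
    (\<integral>\<^sup>+\<omega>. ennreal (exp (lam * f (max (y + \<xi> \<omega>) b))) \<partial>M)
      \<le> ennreal (exp (lam * f (max y b)) * exp (lam * (1 + \<delta>)\<^sup>2 * \<Delta> * g y))"
    using down_step[OF tf fG(1) \<delta>(1) \<Lambda> C4] by blast
  have "\<forall>\<^sub>F \<beta> in at_top. b0 \<le> \<beta> / 4 \<and> y1 \<le> \<beta> / 4 \<and> y2 \<le> \<beta> / 4 \<and> \<phi> (\<beta> / 4) \<le> D * \<phi> (4 * (\<beta> / 4)) \<and> (1 + c) * \<phi> \<beta> \<le> \<phi> (k * \<beta>)"
    using eventually_quarter[OF eventually_ge_at_top[of b0]] eventually_quarter[OF eventually_ge_at_top[of y1]]
      eventually_quarter[OF eventually_ge_at_top[of y2]] eventually_quarter[OF D(2)] c' by eventually_elim simp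
  then obtain \<beta>0 where \<beta>0: "\<And>\<beta>. \<beta>0 \<le> \<beta> \<Longrightarrow> b0 \<le> \<beta> / 4 \<and> y1 \<le> \<beta> / 4 \<and> y2 \<le> \<beta> / 4 \<and> \<phi> (\<beta> / 4) \<le> D * \<phi> (4 * (\<beta> / 4)) \<and> (1 + c) * \<phi> \<beta> \<le> \<phi> (k * \<beta>)"
    unfolding eventually_at_top_linorder by blast
  show ?thesis
  proof (rule that[OF \<delta>(1), of \<beta>0])
    fix \<beta> assume \<beta>: "\<beta>0 \<le> \<beta>"
    define b where "b = \<beta> / 4"
    define a where "a = \<beta> / 2"
    define t where "t = \<phi> \<beta>"
    define lam where "lam = K / t"
    have bb: "b0 \<le> b" "y1 \<le> b" "y2 \<le> b" "\<phi> b \<le> D * t" "(1 + c) * t \<le> \<phi> (k * \<beta>)"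
      using \<beta>0[OF \<beta>] by (auto simp: b_def t_def)
    have yb: "y0 \<le> b" using bb b0 by simp
    have \<beta>pos: "0 < \<beta>" using yb C by (simp add: b_def)
    have t: "0 < t" unfolding t_def using \<beta>pos by (rule \<phi>_pos)
    have lam: "0 < lam" using K t by (simp add: lam_def)
    have lamt: "lam * t = K" using t by (simp add: lam_def)
    have small: "lam * (C * \<phi> b) \<le> \<Lambda>"
    proof -
      have "lam * (C * \<phi> b) \<le> lam * (C * (D * t))" using bb lam C by (intro mult_left_mono) auto
      also have "\<dots> = \<Lambda>" using lamt by (simp add: \<Lambda>_def mult_ac)
      finally show ?thesis .
    qed
    note dec = tf_decreasing[OF tf yb lam small] and tff = tf_facts[OF tf yb lam small]
    define h where "h = (\<lambda>z. exp (lam * f (max z b)))"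
    have le\<beta>: "b \<le> (1 - \<epsilon>) * \<beta>" using \<beta>pos \<epsilon> by (simp add: b_def)
    have f1: "\<theta> * t \<le> f ((1 - \<epsilon>) * \<beta>)"
    proof -
      have "m \<le> k / (1 - \<epsilon>)" by (simp add: m_def)
      then have "m * (1 - \<epsilon>) \<le> k" using \<epsilon> by (simp add: le_divide_eq)
      then have "m * (1 - \<epsilon>) * \<beta> \<le> k * \<beta>" using \<beta>pos by (intro mult_right_mono) auto
      then have "\<phi> (k * \<beta>) \<le> \<phi> (m * ((1 - \<epsilon>) * \<beta>))" using \<beta>pos \<epsilon> m by (intro \<phi>_decreasing) (auto simp: mult.assoc)
      then have "(1 + c) * t \<le> \<phi> (m * ((1 - \<epsilon>) * \<beta>))" using bb by simp
      then have "(1 + c) * t / m \<le> \<phi> (m * ((1 - \<epsilon>) * \<beta>)) / m" using m by (intro divide_right_mono) auto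
      also have "\<dots> \<le> f ((1 - \<epsilon>) * \<beta>)" using fG(2)[of "(1 - \<epsilon>) * \<beta>"] le\<beta> yb r(2) by simp
      finally have 1: "(1 + c) * t / m \<le> f ((1 - \<epsilon>) * \<beta>)" .
      have "m \<le> (1 + c) / \<theta>" by (simp add: m_def)
      then have "\<theta> * m \<le> 1 + c" using \<theta> by (simp add: le_divide_eq mult.commute)
      then have "\<theta> * m * t \<le> (1 + c) * t" using t by (intro mult_right_mono) auto
      then have "\<theta> * t \<le> (1 + c) * t / m" using m by (simp add: le_divide_eq mult_ac)
      then show ?thesis using 1 by simp
    qed
    \<comment> \<open>In \<open>s = y / (2 * b)\<close> the left side decays exponentially, whereas
      \<open>lam * G y * (2 * b)\<close> is at least \<open>K / (C * D' * s ^ N)\<close> by the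
      power bound on \<open>\<phi>\<close>. \<open>C4\<close> collects the constants of this
      comparison.\<close>
    have cap: "exp \<Lambda> / (exp (y / (2 * (2 * b))) - 1)\<^sup>2 \<le> C4 * (lam * G y) * (2 * b)" if y: "2 * b \<le> y" for y
    proof -
      have bpos: "0 < b" using \<beta>pos by (simp add: b_def)
      define s where "s = y / (2 * b)"
      have s: "1 \<le> s" using y bpos by (simp add: s_def)
      have by': "b \<le> y" "0 < y" using y bpos by auto
      have e: "0 < (exp (s / 2) - 1)\<^sup>2" using s by (intro zero_less_power) simp
      have "t \<le> \<phi> (2 * b)" unfolding t_def using \<beta>pos by (intro \<phi>_decreasing) (auto simp: b_def)
      also have "\<dots> \<le> D' * s ^ N0 * \<phi> y" unfolding s_def using bb y bpos by (intro D'(3)) auto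
      also have "\<dots> \<le> D' * s ^ N0 * (C * (y * G y))" using tff(8)[OF by'(1)] s D' by (intro mult_left_mono) auto
      finally have "t \<le> D' * s ^ N0 * (C * (y * G y))" .
      then have "lam * t \<le> lam * (D' * s ^ N0 * (C * (y * G y)))" using lam by (intro mult_left_mono) auto
      also have "\<dots> = C * D' * s ^ N * ((lam * G y) * (2 * b))" using bpos by (simp add: N_def s_def)
      finally have K1: "K \<le> C * D' * s ^ N * ((lam * G y) * (2 * b))" using lamt by simp
      have "K * s ^ N \<le> K * (9 * real N ^ N * (exp (s / 2) - 1)\<^sup>2)"
        using power_le_exp_square[OF s, of N] K by (intro mult_left_mono) (auto simp: N_def)
      also have "\<dots> \<le> (C * D' * s ^ N * ((lam * G y) * (2 * b))) * (9 * real N ^ N * (exp (s / 2) - 1)\<^sup>2)"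
        using K1 by (intro mult_right_mono) auto
      finally have "s ^ N * K \<le> s ^ N * (C * D' * ((lam * G y) * (2 * b)) * (9 * real N ^ N * (exp (s / 2) - 1)\<^sup>2))"
        by (simp add: mult_ac)
      then have "K \<le> C * D' * ((lam * G y) * (2 * b)) * (9 * real N ^ N * (exp (s / 2) - 1)\<^sup>2)"
        using s by (simp add: mult_le_cancel_left_pos)
      then have "exp \<Lambda> * K \<le> exp \<Lambda> * (C * D' * ((lam * G y) * (2 * b)) * (9 * real N ^ N * (exp (s / 2) - 1)\<^sup>2))"
        by (intro mult_left_mono) auto
      also have "\<dots> = K * (C4 * (lam * G y) * (2 * b) * (exp (s / 2) - 1)\<^sup>2)" using K by (simp add: C4_def)
      finally have "exp \<Lambda> \<le> C4 * (lam * G y) * (2 * b) * (exp (s / 2) - 1)\<^sup>2" using K by (simp add: mult.commute)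
      then have "exp \<Lambda> / (exp (s / 2) - 1)\<^sup>2 \<le> C4 * (lam * G y) * (2 * b)" using e by (simp add: pos_divide_le_eq)
      moreover have "s / 2 = y / (2 * (2 * b))" by (simp add: s_def)
      ultimately show ?thesis by simp
    qed
    have "\<forall>\<^sub>F x in at_top. lam * (C * \<phi> x) < 1"
    proof -
      have "((\<lambda>x. lam * (C * \<phi> x)) \<longlongrightarrow> lam * (C * 0)) at_top" by (intro tendsto_mult tendsto_const \<phi>_lim)
      then show ?thesis by (intro order_tendstoD(2)) auto
    qed
    then obtain x1 where x1: "\<And>x. x1 \<le> x \<Longrightarrow> lam * (C * \<phi> x) < 1" unfolding eventually_at_top_linorder by blast
    \<comment> \<open>The clock overshoots \<open>T\<close> by at most \<open>\<Delta> * cg\<close>,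
      which this keeps below \<open>\<delta> * t\<close>.\<close>
    define \<Delta>0 where "\<Delta>0 = min 1 (\<delta> * t / cg)"
    have \<Delta>0: "0 < \<Delta>0" using \<delta> t cg by (simp add: \<Delta>0_def)
    show "\<exists>x0. \<exists>\<Delta>0>0. \<forall>T \<Delta> \<xi> n x. \<forall>M :: 'a measure. x0 \<le> x \<longrightarrow> \<phi> \<beta> \<le> T \<longrightarrow> T \<le> (1 + \<delta>) * \<phi> \<beta> \<longrightarrow>
        0 < \<Delta> \<longrightarrow> \<Delta> \<le> \<Delta>0 \<longrightarrow> levy_increments M \<Psi> \<Delta> \<xi> n \<longrightarrow>
        measure M {\<omega> \<in> space M. chain (\<lambda>y. g (max y (\<beta> / 2))) (\<beta> / 2) T \<Delta> (\<lambda>i. \<xi> i \<omega>) x n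
        \<in> {s. fst s < (1 - \<epsilon>) * \<beta>}} \<le> \<eta>"
    proof (rule exI[of _ "max x1 b"], rule exI[of _ \<Delta>0], intro conjI \<Delta>0 allI impI)
      fix T \<Delta> :: real and \<xi> and n :: nat and x :: real and M :: "'a measure"
      assume x: "max x1 b \<le> x" and T: "\<phi> \<beta> \<le> T" "T \<le> (1 + \<delta>) * \<phi> \<beta>" and \<Delta>': "0 < \<Delta>" "\<Delta> \<le> \<Delta>0" and inc: "levy_increments M \<Psi> \<Delta> \<xi> n"
      have \<Delta>: "0 < \<Delta>" "\<Delta> \<le> 1" using \<Delta>' by (auto simp: \<Delta>0_def)
      interpret prob_space M using inc by (simp add: levy_increments_def)
      have ind: "indep_vars (\<lambda>_. borel) \<xi> {..<n}" using inc by (simp add: levy_increments_def)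
      have lap: "(\<integral>\<^sup>+\<omega>. ennreal (exp (- l * \<xi> i \<omega>)) \<partial>M) = ennreal (exp (\<Delta> * \<Psi> l))" if "i < n" "0 \<le> l" for i l
        using inc that by (simp add: levy_increments_def)
      have rv: "\<xi> i \<in> borel_measurable M" if "i < n" for i using ind that unfolding indep_vars_def by auto
      have "prob {\<omega> \<in> space M. chain (\<lambda>y. g (max y a)) a T \<Delta> (\<lambda>i. \<xi> i \<omega>) x n \<in> {s. fst s < (1 - \<epsilon>) * \<beta>}}
          \<le> h x / exp (1 + 1 / \<eta>)"
      proof (rule chain_exp_bound[OF measurable_truncated_g ind, where c = "- (lam * (1 + \<delta>)\<^sup>2)"])
        show "0 < a" using \<beta>pos by (simp add: a_def)
        show "h \<in> borel_measurable borel" unfolding h_def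
          using measurable_truncated_test_function[OF tf yb] by measurable
        show "0 \<le> h z" for z by (simp add: h_def)
        show "{s. fst s < (1 - \<epsilon>) * \<beta>} \<in> sets (borel \<Otimes>\<^sub>M borel :: (real \<times> real) measure)" by (rule sets_states(2))
        show "0 < exp (1 + 1 / \<eta>)" by simp
        show "(\<integral>\<^sup>+\<omega>. ennreal (h (z + \<xi> i \<omega>)) \<partial>M) \<le> ennreal (h z * exp (- (- (lam * (1 + \<delta>)\<^sup>2) * \<Delta> * g (max z a))))"
          if "i < n" "a \<le> z" for i z
          using step[OF bb(1) lam small _ cap \<Delta> prob_space_axioms rv[OF that(1)] lap[OF that(1)], of z] that(2)
          by (simp add: h_def a_def b_def max_absorb1)
        fix \<omega> assume "chain (\<lambda>y. g (max y a)) a T \<Delta> (\<lambda>i. \<xi> i \<omega>) x n \<in> {s. fst s < (1 - \<epsilon>) * \<beta>}"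
        then obtain z A where zA: "chain (\<lambda>y. g (max y a)) a T \<Delta> (\<lambda>i. \<xi> i \<omega>) x n = (z, A)" "z < (1 - \<epsilon>) * \<beta>"
          by (cases "chain (\<lambda>y. g (max y a)) a T \<Delta> (\<lambda>i. \<xi> i \<omega>) x n") auto
        have T0: "0 \<le> T" using T t by (simp add: t_def)
        have "g (max y a) \<le> cg" for y using bb \<beta>pos by (intro cg(2)) (auto simp: a_def b_def)
        then have "A \<le> T + \<Delta> * cg" using chain_snd_le[of T \<Delta> "\<lambda>y. g (max y a)" cg a "\<lambda>i. \<xi> i \<omega>" x n] T0 \<Delta> cg zA(1) by simp
        also have "\<Delta> * cg \<le> \<delta> * t" using \<Delta>' cg by (simp add: \<Delta>0_def le_divide_eq)
        finally have A: "A \<le> (1 + 2 * \<delta>) * t" using T by (simp add: t_def algebra_simps)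
        have "f ((1 - \<epsilon>) * \<beta>) \<le> f (max z b)" using zA le\<beta> by (intro dec) auto
        then have "lam * (\<theta> * t) \<le> lam * f (max z b)" using f1 lam by (intro mult_left_mono) auto
        then have 1: "K * \<theta> \<le> lam * f (max z b)" using lamt by (simp add: mult_ac)
        have "lam * (1 + \<delta>)\<^sup>2 * A \<le> lam * (1 + \<delta>)\<^sup>2 * ((1 + 2 * \<delta>) * t)" using A lam by (intro mult_left_mono) auto
        also have "\<dots> = K * ((1 + \<delta>)\<^sup>2 * (1 + 2 * \<delta>))" using lamt by (simp add: mult_ac)
        also have "\<dots> \<le> K * (1 + 10 * \<delta>)"
        proof -
          have "(1 + \<delta>)\<^sup>2 * (1 + 2 * \<delta>) = 1 + 4 * \<delta> + (5 * \<delta>) * \<delta> + 2 * (\<delta> * \<delta>) * \<delta>" by (simp add: power2_eq_square algebra_simps)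
          also have "\<dots> \<le> 1 + 4 * \<delta> + (5 * \<delta>) * 1 + 2 * (1 / 2 * 1) * \<delta>"
            using \<delta> by (intro add_mono mult_mono mult_left_mono) auto
          finally show ?thesis using K by (intro mult_left_mono) auto
        qed
        also have "\<dots> \<le> K * (1 + (\<theta> - 1) / 2)" using \<delta> K by (intro mult_left_mono) auto
        finally have 2: "lam * (1 + \<delta>)\<^sup>2 * A \<le> K * (1 + (\<theta> - 1) / 2)" .
        have "1 + 1 / \<eta> = K * \<theta> - K * (1 + (\<theta> - 1) / 2)"
        proof -
          have "K * \<theta> - K * (1 + (\<theta> - 1) / 2) = K * (\<theta> - (1 + (\<theta> - 1) / 2))" by (simp only: right_diff_distrib)
          also have "\<theta> - (1 + (\<theta> - 1) / 2) = (\<theta> - 1) / 2" by (simp add: field_simps)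
          finally have e1: "K * \<theta> - K * (1 + (\<theta> - 1) / 2) = K * ((\<theta> - 1) / 2)" .
          have eq: "2 / w * u * (w / 2) = u" if "w \<noteq> 0" for w u :: real using that by simp
          have "K * ((\<theta> - 1) / 2) = 1 + 1 / \<eta>" unfolding K_def by (rule eq) (use \<theta> in simp)
          then show ?thesis using e1 by (simp only:)
        qed
        then have "1 + 1 / \<eta> \<le> lam * f (max z b) - lam * (1 + \<delta>)\<^sup>2 * A" using 1 2 by linarith
        then have "exp (1 + 1 / \<eta>) \<le> exp (lam * f (max z b) + - (lam * (1 + \<delta>)\<^sup>2) * A)" by simp
        then show "exp (1 + 1 / \<eta>) \<le> h (fst (chain (\<lambda>y. g (max y a)) a T \<Delta> (\<lambda>i. \<xi> i \<omega>) x n)) *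
            exp (- (lam * (1 + \<delta>)\<^sup>2) * snd (chain (\<lambda>y. g (max y a)) a T \<Delta> (\<lambda>i. \<xi> i \<omega>) x n))"
          unfolding zA(1) by (simp add: h_def exp_add[symmetric])
      qed
      also have "\<dots> \<le> exp 1 / exp (1 + 1 / \<eta>)"
      proof -
        have "lam * f x \<le> lam * (C * \<phi> x)" using tff(6)[of x] x lam by (intro mult_left_mono) auto
        then have "lam * f (max x b) \<le> 1" using x1[of x] x by (simp add: max_absorb1)
        then show ?thesis by (intro divide_right_mono) (auto simp: h_def)
      qed
      also have "\<dots> = exp (- (1 / \<eta>))" by (simp add: exp_add exp_minus field_simps)
      also have "\<dots> \<le> \<eta>" by (rule exp_minus_inverse_le[OF \<eta>])
      finally show "prob {\<omega> \<in> space M. chain (\<lambda>y. g (max y (\<beta> / 2))) (\<beta> / 2) T \<Delta> (\<lambda>i. \<xi> i \<omega>) x n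
        \<in> {s. fst s < (1 - \<epsilon>) * \<beta>}} \<le> \<eta>" by (simp only: a_def)
    qed
  qed
qed

end

section \<open>From the hypotheses H1, H2, H3 to the regularity of the tail\<close>

section \<open>Regularity of the tail integral\<close>

lemma integrable_on_at_infinity:
  fixes g k :: "real \<Rightarrow> real"
  assumes k: "k integrable_on {a..}" and k0: "\<And>x. a \<le> x \<Longrightarrow> 0 \<le> k x"
    and le: "\<And>x. x1 \<le> x \<Longrightarrow> \<bar>g x\<bar> \<le> c * k x" and cont: "continuous_on {0<..} g" and pos: "0 < x1" "a \<le> x1" and b: "0 < b"
  shows "g absolutely_integrable_on {b..}"
proof -
  have kx1: "k absolutely_integrable_on {x1..}"
  proof (rule set_integrable_subset)
    show "k absolutely_integrable_on {a..}" using k k0 by (intro nonnegative_absolutely_integrable_1) auto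
  qed (use pos in auto)
  have gx1: "g absolutely_integrable_on {x1..}"
  proof (rule measurable_bounded_by_integrable_imp_absolutely_integrable)
    show "g \<in> borel_measurable (lebesgue_on {x1..})"
      using pos by (intro continuous_imp_measurable_on_sets_lebesgue continuous_on_subset[OF cont]) auto
    show "(\<lambda>x. c * k x) integrable_on {x1..}"
      using kx1 by (intro integrable_on_mult_right) (rule set_lebesgue_integral_eq_integral(1))
  qed (use le in auto)
  have "g absolutely_integrable_on {b..x1}"
    using b by (intro absolutely_integrable_continuous_real continuous_on_subset[OF cont]) auto
  then have "g absolutely_integrable_on {b..x1} \<union> {x1..}" using gx1
    by (intro absolutely_integrable_Un) auto
  then show ?thesis by (rule set_integrable_subset) (use b in auto)
qed

context
  fixes g :: "real \<Rightarrow> real" and \<gamma> :: real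
  assumes \<gamma>: "0 < \<gamma>" and cont: "continuous_on {0<..} g" and g_pos: "\<And>x. 0 < x \<Longrightarrow> 0 < g x"
    and int: "\<And>b. 0 < b \<Longrightarrow> g absolutely_integrable_on {b..}"
begin

lemma integral_tail_split:
  assumes "0 < b" "b \<le> c"
  shows "integral {b..} g = integral {b..c} g + integral {c..} g"
proof -
  have "{b..} = {b..c} \<union> {c..}" using assms by auto
  moreover have "integral ({b..c} \<union> {c..}) g = integral {b..c} g + integral {c..} g"
  proof (rule Henstock_Kurzweil_Integration.integral_Un)
    show "g integrable_on {b..c}" using assms
      by (intro integrable_continuous_interval continuous_on_subset[OF cont]) auto
    show "g integrable_on {c..}" using int[of c] assms by (intro set_lebesgue_integral_eq_integral(1)) auto
    have "{b..c} \<inter> {c..} = {c}" using assms by auto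
    then show "negligible ({b..c} \<inter> {c..})" by simp
  qed
  ultimately show ?thesis by simp
qed

lemma integral_tail_deriv:
  assumes "0 < y" shows "((\<lambda>b. integral {b..} g) has_real_derivative - g y) (at y)"
proof -
  define a where "a = y / 2"
  have a: "0 < a" "a < y" using assms by (auto simp: a_def)
  have "((\<lambda>x. integral {a..x} g) has_real_derivative g y) (at y within {a..y + 1})"
    using a by (intro integral_has_real_derivative continuous_on_subset[OF cont]) auto
  then have "((\<lambda>x. integral {a..x} g) has_real_derivative g y) (at y)"
    using a by (subst (asm) at_within_interior) auto
  then have "((\<lambda>x. integral {a..} g - integral {a..x} g) has_real_derivative 0 - g y) (at y)"
    by (intro DERIV_diff DERIV_const)
  moreover have "\<forall>\<^sub>F x in nhds y. integral {a..} g - integral {a..x} g = integral {x..} g"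
  proof -
    have "\<forall>\<^sub>F x in nhds y. x \<in> {a<..}" using a by (intro eventually_nhds_in_open) auto
    then show ?thesis
    proof eventually_elim
      case (elim x)
      then show ?case using integral_tail_split[of a x] a by simp
    qed
  qed
  ultimately show ?thesis using DERIV_cong_ev[OF refl, of "\<lambda>x. integral {a..} g - integral {a..x} g" "\<lambda>x. integral {x..} g" y "0 - g y" "- g y"]
    by simp
qed

lemma integral_tail_pos:
  assumes "0 < y" shows "0 < integral {y..} g"
proof -
  have "integral {y + 1..} g < integral {y..} g"
  proof (rule DERIV_neg_imp_decreasing[of y "y + 1" "\<lambda>b. integral {b..} g"])
    fix x assume "y \<le> x"
    then have "0 < x" using assms by simp
    then show "\<exists>d. ((\<lambda>b. integral {b..} g) has_real_derivative d) (at x) \<and> d < 0"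
      using integral_tail_deriv[of x] g_pos[of x] by (intro exI[of _ "- g x"]) simp
  qed simp
  moreover have "0 \<le> integral {y + 1..} g"
    using g_pos assms int[of "y + 1"]
    by (intro Henstock_Kurzweil_Integration.integral_nonneg set_lebesgue_integral_eq_integral(1)) (auto intro: less_imp_le)
  ultimately show ?thesis by simp
qed

lemma integral_tail_tendsto_0: "((\<lambda>b. integral {b..} g) \<longlongrightarrow> 0) at_top"
proof -
  have "((\<lambda>b. set_lebesgue_integral lebesgue {1..b} g) \<longlongrightarrow> set_lebesgue_integral lebesgue {1..} g) at_top"
    using int[of 1] by (intro tendsto_set_lebesgue_integral_at_top) auto
  moreover have "set_lebesgue_integral lebesgue {1..b} g = integral {1..b} g" for b
    using int[of 1] by (intro set_lebesgue_integral_eq_integral(2)) (rule set_integrable_subset, auto)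
  moreover have "set_lebesgue_integral lebesgue {1..} g = integral {1..} g"
    using int[of 1] by (intro set_lebesgue_integral_eq_integral(2)) auto
  ultimately have "((\<lambda>b. integral {1..b} g) \<longlongrightarrow> integral {1..} g) at_top" by simp
  then have "((\<lambda>b. integral {1..} g - integral {1..b} g) \<longlongrightarrow> integral {1..} g - integral {1..} g) at_top"
    by (intro tendsto_diff tendsto_const)
  moreover have "\<forall>\<^sub>F b in at_top. integral {1..} g - integral {1..b} g = integral {b..} g"
    using eventually_ge_at_top[of 1]
  proof eventually_elim
    case (elim b)
    then show ?case using integral_tail_split[of 1 b] by simp
  qed
  ultimately show ?thesis by (simp add: tendsto_cong)
qed

end

lemma Limsup_at_right_imp_exists:
  fixes F :: "real \<Rightarrow> ereal"
  assumes "c < Limsup (at_right a) F"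
  obtains h where "a < h" "c < F h"
proof -
  have "\<not> (\<forall>\<^sub>F h in at_right a. F h \<le> c)"
    using Limsup_bounded[of F c "at_right a"] assms by auto
  then have "\<exists>\<^sub>F h in at_right a. c < F h" by (simp add: frequently_def not_less)
  then have "\<exists>\<^sub>F h in at_right a. c < F h \<and> a < h"
    using eventually_at_right_less[of a] by (rule frequently_eventually_frequently)
  then show ?thesis using that by (auto dest: frequently_ex)
qed

text \<open>\<open>doubling\<close> is extracted from H1, \<open>decay\<close> from H2 and
  \<open>almost_decreasing\<close> from H3. In H3 one \<open>\<rho>\<close> is fixed and
  \<open>z\<close> varies, which turns the exact step \<open>\<rho> * z\<close> into all steps
  between a cutoff and \<open>\<rho> * x\<close>.\<close>

lemma regular_tail_phi:
  assumes \<gamma>: "\<gamma> > 0" and levy: "levy_measure \<pi>"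
    and R_cont: "continuous_on {0..} R" and R_pos: "\<And>x. x > 0 \<Longrightarrow> R x > 0"
    and integral_cond: "\<exists>a>0. (\<lambda>x. 1 / (x * laplace_exponent \<gamma> \<sigma> \<pi> (1 / x) * R x)) integrable_on {a..}"
    and H1: "Limsup (at_right 1) (\<lambda>h. Liminf at_top (\<lambda>x. ereal (phi \<gamma> R (h * x) / phi \<gamma> R x))) = 1"
    and H2: "\<And>h. h > 1 \<Longrightarrow> Liminf at_top (\<lambda>x. ereal (phi \<gamma> R x / phi \<gamma> R (h * x))) > 1"
    and H3: "\<exists>Vlim :: real \<Rightarrow> ereal.
               (\<forall>\<^sub>F \<rho> in at_right 0. ((\<lambda>z. Vfun R z \<rho>) \<longlongrightarrow> Vlim \<rho>) at_top) \<and>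
               Limsup (at_right 0) Vlim = 0"
  shows "regular_tail (phi \<gamma> R) (\<lambda>x. 1 / R x) \<gamma>"
proof -
  define g where "g = (\<lambda>x. 1 / R x)"
  define \<Psi> where "\<Psi> = laplace_exponent \<gamma> \<sigma> \<pi>"
  define \<phi> where "\<phi> = phi \<gamma> R"
  have g_pos: "0 < g x" if "0 < x" for x using R_pos[OF that] by (simp add: g_def)
  have "continuous_on {0<..} R" by (rule continuous_on_subset[OF R_cont]) auto
  then have g_cont: "continuous_on {0<..} g" unfolding g_def using R_pos
    by (intro continuous_on_divide continuous_on_const) (auto simp: less_imp_neq[symmetric])
  obtain a where a: "0 < a" and k: "(\<lambda>x. 1 / (x * \<Psi> (1 / x) * R x)) integrable_on {a..}"
    using integral_cond unfolding \<Psi>_def by blast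
  have \<Psi>_ge: "\<gamma> \<le> x * \<Psi> (1 / x)" if "0 < x" for x
    using laplace_exponent_ge[OF levy, of "1 / x" \<gamma> \<sigma>] that by (simp add: \<Psi>_def field_simps)
  have "filterlim (\<lambda>x::real. 1 / x) (at_right 0) at_top"
    using filterlim_inverse_at_right_top by (simp add: inverse_eq_divide)
  from filterlim_compose[OF laplace_exponent_quotient_tendsto[OF levy] this, of \<gamma> \<sigma>]
  have "((\<lambda>x. x * \<Psi> (1 / x)) \<longlongrightarrow> \<gamma>) at_top" by (simp add: \<Psi>_def mult.commute)
  then have "\<forall>\<^sub>F x in at_top. x * \<Psi> (1 / x) < 2 * \<gamma>" using \<gamma> by (intro order_tendstoD) auto
  then obtain x0 where x0: "\<And>x. x0 \<le> x \<Longrightarrow> x * \<Psi> (1 / x) < 2 * \<gamma>" unfolding eventually_at_top_linorder by blast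
  \<comment> \<open>For large \<open>x\<close> the factor \<open>x * \<Psi> (1 / x)\<close> lies
    between \<open>\<gamma>\<close> and \<open>2 * \<gamma>\<close>, so the integral condition
    yields integrability of \<open>1 / R\<close> at infinity.\<close>
  have int: "g absolutely_integrable_on {b..}" if "0 < b" for b
  proof (rule integrable_on_at_infinity[OF k])
    show "0 \<le> 1 / (x * \<Psi> (1 / x) * R x)" if "a \<le> x" for x
    proof -
      have "0 \<le> x * \<Psi> (1 / x)" "0 \<le> R x" using \<Psi>_ge[of x] R_pos[of x] that a \<gamma> by auto
      then show ?thesis by (metis divide_nonneg_nonneg mult_nonneg_nonneg zero_le_one)
    qed
    show "\<bar>g x\<bar> \<le> 2 * \<gamma> * (1 / (x * \<Psi> (1 / x) * R x))" if "max a x0 \<le> x" for x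
    proof -
      have x: "0 < x" "0 < R x" "x * \<Psi> (1 / x) < 2 * \<gamma>" "0 < x * \<Psi> (1 / x)"
        using that a R_pos[of x] x0[of x] \<Psi>_ge[of x] \<gamma> by auto
      have "1 / R x = (x * \<Psi> (1 / x)) / (x * \<Psi> (1 / x) * R x)"
        by (rule nonzero_divide_mult_cancel_left[symmetric]) (rule less_imp_neq[OF x(4), symmetric])
      also have "\<dots> \<le> 2 * \<gamma> / (x * \<Psi> (1 / x) * R x)" by (intro divide_right_mono mult_nonneg_nonneg less_imp_le x)
      finally show ?thesis using x by (simp add: g_def)
    qed
  qed (use a that g_cont in auto)
  note tail = \<gamma> g_cont g_pos int
  have \<phi>: "\<phi> = (\<lambda>b. integral {b..} g / \<gamma>)" by (simp add: \<phi>_def phi_def g_def fun_eq_iff)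
  have \<phi>_deriv: "(\<phi> has_real_derivative - g y / \<gamma>) (at y)" if "0 < y" for y
    unfolding \<phi> by (intro DERIV_cdivide integral_tail_deriv[OF tail] that)
  have \<phi>_pos: "0 < \<phi> y" if "0 < y" for y unfolding \<phi> using integral_tail_pos[OF tail that] \<gamma> by simp
  have \<phi>_lim: "(\<phi> \<longlongrightarrow> 0) at_top" unfolding \<phi>
    using tendsto_divide[OF integral_tail_tendsto_0[OF tail] tendsto_const, of \<gamma>] \<gamma> by simp
  have \<phi>_dec: "\<phi> y \<le> \<phi> x" if "0 < x" "x \<le> y" for x y
  proof (rule DERIV_nonpos_imp_nonincreasing[OF that(2)])
    fix u assume "x \<le> u"
    then have "0 < u" using that by simp
    then show "\<exists>d. (\<phi> has_real_derivative d) (at u) \<and> d \<le> 0"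
      using \<phi>_deriv[of u] g_pos[of u] \<gamma> by (intro exI[of _ "- g u / \<gamma>"]) simp
  qed
  have doubling: "\<exists>C. \<forall>\<^sub>F y in at_top. \<phi> y \<le> C * \<phi> (r * y)" if r: "1 < r" for r
  proof -
    \<comment> \<open>Any positive constant below 1 would do: one \<open>h > 1\<close> with an
      eventual lower bound on the ratio suffices, since iteration reaches every
      \<open>r\<close>.\<close>
    have "ereal (1 / 2) < Limsup (at_right 1) (\<lambda>h. Liminf at_top (\<lambda>x. ereal (\<phi> (h * x) / \<phi> x)))"
      using H1 by (simp add: \<phi>_def one_ereal_def)
    then obtain h where h: "1 < h" "ereal (1 / 2) < Liminf at_top (\<lambda>x. ereal (\<phi> (h * x) / \<phi> x))"
      by (rule Limsup_at_right_imp_exists)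
    from less_LiminfD[OF h(2)] have "\<forall>\<^sub>F x in at_top. 1 / 2 < \<phi> (h * x) / \<phi> x" by simp
    then obtain N where N: "\<And>x. N \<le> x \<Longrightarrow> 1 / 2 < \<phi> (h * x) / \<phi> x" unfolding eventually_at_top_linorder by blast
    have step: "\<phi> x \<le> 2 * \<phi> (h * x)" if "max N 1 \<le> x" for x
    proof -
      have "0 < \<phi> x" using that by (intro \<phi>_pos) auto
      then show ?thesis using N[of x] that by (simp add: less_divide_eq)
    qed
    have iter: "\<phi> x \<le> 2 ^ k * \<phi> (h ^ k * x)" if x: "max N 1 \<le> x" for x k
    proof (induction k)
      case (Suc k)
      have "x = 1 * x" by simp
      also have "\<dots> \<le> h ^ k * x" using h x by (intro mult_right_mono one_le_power) auto
      finally have "x \<le> h ^ k * x" .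
      then have "max N 1 \<le> h ^ k * x" by (rule order_trans[OF x])
      from step[OF this] have "2 ^ k * \<phi> (h ^ k * x) \<le> 2 ^ k * (2 * \<phi> (h * (h ^ k * x)))" by (intro mult_left_mono) auto
      from order_trans[OF Suc this] show ?case by (simp add: mult_ac)
    qed simp
    obtain k where k: "r < h ^ k" using real_arch_pow[OF h(1)] by blast
    have "\<forall>\<^sub>F y in at_top. \<phi> y \<le> 2 ^ k * \<phi> (r * y)" using eventually_ge_at_top[of "max N 1"]
    proof eventually_elim
      case (elim y)
      have "r * y \<le> h ^ k * y" using k elim by (intro mult_right_mono) auto
      then have "\<phi> (h ^ k * y) \<le> \<phi> (r * y)" using r elim by (intro \<phi>_dec) auto
      then have "2 ^ k * \<phi> (h ^ k * y) \<le> 2 ^ k * \<phi> (r * y)" by (intro mult_left_mono) auto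
      from order_trans[OF iter[OF elim] this] show ?case .
    qed
    then show ?thesis by blast
  qed
  have decay: "\<exists>c>0. \<forall>\<^sub>F y in at_top. (1 + c) * \<phi> (r * y) \<le> \<phi> y" if r: "1 < r" for r
  proof -
    obtain v where v: "1 < ereal v" "ereal v < Liminf at_top (\<lambda>x. ereal (\<phi> x / \<phi> (r * x)))"
      using ereal_dense2[OF H2[OF r]] by (auto simp: \<phi>_def)
    from less_LiminfD[OF v(2)] have "\<forall>\<^sub>F x in at_top. v < \<phi> x / \<phi> (r * x)" by simp
    then have "\<forall>\<^sub>F y in at_top. (1 + (v - 1)) * \<phi> (r * y) \<le> \<phi> y" using eventually_gt_at_top[of 0]
    proof eventually_elim
      case (elim y)
      have "0 < \<phi> (r * y)" using r elim by (intro \<phi>_pos) auto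
      then show ?case using elim by (simp add: less_divide_eq)
    qed
    moreover have "0 < v - 1" using v(1) by simp
    ultimately show ?thesis by blast
  qed
  have almost_decreasing: "\<exists>\<rho>>0. \<exists>d>0. \<forall>x u. d \<le> u \<longrightarrow> u \<le> \<rho> * x \<longrightarrow> g (x + u) \<le> (1 + \<epsilon>) * g x" if \<epsilon>: "0 < \<epsilon>" for \<epsilon>
  proof -
    obtain Vlim where V: "\<forall>\<^sub>F \<rho> in at_right 0. ((\<lambda>z. Vfun R z \<rho>) \<longlongrightarrow> Vlim \<rho>) at_top" "Limsup (at_right 0) Vlim = 0"
      using H3 by blast
    have "\<forall>\<^sub>F \<rho> in at_right 0. Vlim \<rho> < ereal \<epsilon>" using V(2) \<epsilon> by (intro Limsup_lessD) simp
    then have "\<forall>\<^sub>F \<rho> in at_right (0::real). 0 < \<rho> \<and> Vlim \<rho> < ereal \<epsilon> \<and> ((\<lambda>z. Vfun R z \<rho>) \<longlongrightarrow> Vlim \<rho>) at_top"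
      using V(1) eventually_at_right_less[of 0] by eventually_elim simp
    then obtain \<rho> where \<rho>: "0 < \<rho>" "Vlim \<rho> < ereal \<epsilon>" "((\<lambda>z. Vfun R z \<rho>) \<longlongrightarrow> Vlim \<rho>) at_top"
      using eventually_happens[of _ "at_right (0::real)"] by auto
    have "\<forall>\<^sub>F z in at_top. Vfun R z \<rho> < ereal \<epsilon>" using order_tendstoD(2)[OF \<rho>(3,2)] .
    then obtain Z where Z: "\<And>z. Z \<le> z \<Longrightarrow> Vfun R z \<rho> < ereal \<epsilon>" unfolding eventually_at_top_linorder by blast
    show ?thesis
    proof (rule exI[of _ \<rho>], rule conjI[OF \<rho>(1)], rule exI[of _ "\<rho> * max Z 1"], intro conjI allI impI)
      show "0 < \<rho> * max Z 1" using \<rho> by simp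
      fix x u assume u: "\<rho> * max Z 1 \<le> u" "u \<le> \<rho> * x"
      \<comment> \<open>With this \<open>z\<close> the bound \<open>u \<le> \<rho> * x\<close>
        becomes \<open>z \<le> x\<close>, so \<open>x\<close> is among the points of the supremum in
        \<open>Vfun R z \<rho>\<close>.\<close>
      define z where "z = u / \<rho>"
      have z: "max Z 1 \<le> z" "z \<le> x" "u = \<rho> * z" using u \<rho>(1) by (simp_all add: z_def le_divide_eq divide_le_eq mult.commute)
      have x: "0 < x" "0 < x + u" using z \<rho>(1) by (auto intro!: add_pos_pos)
      have "ereal (max (R x / R (x + \<rho> * z) - 1) 0) \<le> Vfun R z \<rho>" unfolding Vfun_def using z by (intro SUP_upper) auto
      also have "\<dots> < ereal \<epsilon>" using z by (intro Z) auto
      finally have "R x / R (x + u) < 1 + \<epsilon>" using z(3) by simp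
      then have "R x / R (x + u) / R x \<le> (1 + \<epsilon>) / R x" using R_pos[OF x(1)] by (intro divide_right_mono) auto
      then show "g (x + u) \<le> (1 + \<epsilon>) * g x" using R_pos[OF x(1)] by (simp add: g_def)
    qed
  qed
  have "regular_tail \<phi> g \<gamma>"
    by unfold_locales (fact \<gamma> g_pos g_cont \<phi>_deriv \<phi>_pos \<phi>_lim doubling decay almost_decreasing)+
  then show ?thesis by (simp add: \<phi>_def g_def)
qed

section \<open>Removing the grid and the perturbed clock level\<close>

section \<open>From the sampled process to X\<close>

text \<open>The event is an increasing union of tail intersections, and each of these lies inside
  some late \<open>E n\<close>.\<close>

lemma (in prob_space) prob_eventually_le:
  fixes E :: "nat \<Rightarrow> 'a set"
  assumes E: "\<And>n. E n \<in> events" and le: "\<forall>\<^sub>F n in sequentially. prob (E n) \<le> c"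
  shows "{\<omega> \<in> space M. \<forall>\<^sub>F n in sequentially. \<omega> \<in> E n} \<in> events"
    and "prob {\<omega> \<in> space M. \<forall>\<^sub>F n in sequentially. \<omega> \<in> E n} \<le> c"
proof -
  define I where "I = (\<lambda>N. \<Inter>n\<in>{N..}. E n)"
  have I: "I N \<in> events" for N unfolding I_def using E by (intro sets.countable_INT') auto
  have eq: "{\<omega> \<in> space M. \<forall>\<^sub>F n in sequentially. \<omega> \<in> E n} = (\<Union>N. I N)"
    using sets.sets_into_space[OF E] by (auto simp: I_def eventually_sequentially)
  show "{\<omega> \<in> space M. \<forall>\<^sub>F n in sequentially. \<omega> \<in> E n} \<in> events" unfolding eq using I by auto
  have "incseq I" unfolding I_def by (intro monoI INF_superset_mono) auto
  then have lim: "(\<lambda>N. prob (I N)) \<longlonglongrightarrow> prob (\<Union>N. I N)" using I by (intro finite_Lim_measure_incseq) auto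
  have "\<exists>n0. \<forall>n\<ge>n0. prob (E n) \<le> c" using le by (simp add: eventually_sequentially)
  then obtain n0 where n0: "\<And>n. n0 \<le> n \<Longrightarrow> prob (E n) \<le> c" by blast
  have "prob (I N) \<le> c" for N
  proof -
    have "prob (I N) \<le> prob (E (max N n0))" using E by (intro finite_measure_mono) (auto simp: I_def)
    then show ?thesis using n0[of "max N n0"] by simp
  qed
  then show "prob {\<omega> \<in> space M. \<forall>\<^sub>F n in sequentially. \<omega> \<in> E n} \<le> c"
    unfolding eq by (intro LIMSEQ_le_const2[OF lim]) auto
qed

text \<open>Meant for two nested limits: the inner index refines the mesh, the outer one lets the
  clock level decrease to \<open>t\<close>. How fine the mesh must be depends on the level and the
  path, so the limits stay nested.\<close>

lemma (in prob_space) prob_le_of_eventually: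
  fixes E :: "nat \<Rightarrow> nat \<Rightarrow> 'a set"
  assumes E: "\<And>m n. E m n \<in> events" and le: "\<forall>\<^sub>F m in sequentially. \<forall>\<^sub>F n in sequentially. prob (E m n) \<le> c"
    and A: "A \<in> events" and sub: "AE \<omega> in M. \<omega> \<in> A \<longrightarrow> (\<forall>\<^sub>F m in sequentially. \<forall>\<^sub>F n in sequentially. \<omega> \<in> E m n)"
  shows "prob A \<le> c"
proof -
  define U where "U = (\<lambda>m. {\<omega> \<in> space M. \<forall>\<^sub>F n in sequentially. \<omega> \<in> E m n})"
  have U: "U m \<in> events" for m unfolding U_def by (rule prob_eventually_le(1)[of _ 1]) (use E in auto)
  have "\<forall>\<^sub>F m in sequentially. prob (U m) \<le> c" using le
    by eventually_elim (simp add: U_def prob_eventually_le(2)[OF E])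
  note V = prob_eventually_le[OF U this]
  have "AE \<omega> in M. \<omega> \<in> A \<longrightarrow> \<omega> \<in> {\<omega> \<in> space M. \<forall>\<^sub>F m in sequentially. \<omega> \<in> U m}"
    using sub AE_space by eventually_elim (auto simp: U_def)
  then have "prob A \<le> prob {\<omega> \<in> space M. \<forall>\<^sub>F m in sequentially. \<omega> \<in> U m}"
    using V(1) by (intro finite_measure_mono_AE) auto
  then show ?thesis using V(2) by simp
qed

lemma levy_increments_grid:
  assumes L: "spos_levy M L \<Psi>" and \<Delta>: "0 < \<Delta>"
  shows "levy_increments M \<Psi> \<Delta> (\<lambda>i \<omega>. L (real (Suc i) * \<Delta>) \<omega> - L (real i * \<Delta>) \<omega>) n"
proof -
  interpret prob_space M using L by (simp add: spos_levy_def)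
  define ts where "ts = map (\<lambda>i. real i * \<Delta>) [0..<Suc n]"
  have nth: "ts ! i = real i * \<Delta>" if "i \<le> n" for i using that unfolding ts_def by (subst nth_map) (auto simp del: upt_Suc)
  have "sorted ts" unfolding sorted_iff_nth_mono using nth \<Delta>
    by (auto simp: ts_def simp del: upt_Suc intro!: mult_right_mono)
  moreover have "\<forall>t\<in>set ts. 0 \<le> t" using \<Delta> by (auto simp: ts_def)
  ultimately have "indep_vars (\<lambda>_. borel) (\<lambda>i \<omega>. L (ts ! Suc i) \<omega> - L (ts ! i) \<omega>) {..<length ts - 1}"
    using L unfolding spos_levy_def by blast
  also have "{..<length ts - 1} = {..<n}" by (simp add: ts_def)
  finally have "indep_vars (\<lambda>_. borel) (\<lambda>i \<omega>. L (ts ! Suc i) \<omega> - L (ts ! i) \<omega>) {..<n}" .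
  also have "?this \<longleftrightarrow> indep_vars (\<lambda>_. borel) (\<lambda>i \<omega>. L (real (Suc i) * \<Delta>) \<omega> - L (real i * \<Delta>) \<omega>) {..<n}"
    using nth by (intro indep_vars_cong) auto
  finally have ind: "indep_vars (\<lambda>_. borel) (\<lambda>i \<omega>. L (real (Suc i) * \<Delta>) \<omega> - L (real i * \<Delta>) \<omega>) {..<n}" .
  have "(\<integral>\<^sup>+\<omega>. ennreal (exp (- lam * (L (real (Suc i) * \<Delta>) \<omega> - L (real i * \<Delta>) \<omega>))) \<partial>M) = ennreal (exp (\<Delta> * \<Psi> lam))"
    if "0 \<le> lam" for i lam
  proof -
    have "0 \<le> real i * \<Delta>" "real i * \<Delta> \<le> real (Suc i) * \<Delta>" using \<Delta> by (auto intro!: mult_right_mono)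
    then have "(\<integral>\<^sup>+\<omega>. ennreal (exp (- lam * (L (real (Suc i) * \<Delta>) \<omega> - L (real i * \<Delta>) \<omega>))) \<partial>M)
        = ennreal (exp ((real (Suc i) * \<Delta> - real i * \<Delta>) * \<Psi> lam))"
      using L that unfolding spos_levy_def by blast
    also have "real (Suc i) * \<Delta> - real i * \<Delta> = \<Delta>" by (simp add: algebra_simps)
    finally show ?thesis .
  qed
  then show ?thesis unfolding levy_increments_def using ind prob_space_axioms by simp
qed

text \<open>A weak law of large numbers through Laplace transforms: the first two moments of
  \<open>exp (- (1 / t) * L t)\<close> tend to \<open>exp \<gamma>\<close> and
  \<open>exp (2 * \<gamma>)\<close>, so it tends to \<open>exp \<gamma>\<close> in mean square. A
  path that never falls below \<open>c\<close> keeps it under \<open>exp (\<gamma> / 2)\<close> for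
  large \<open>t\<close>, which leaves a fixed squared deviation \<open>\<kappa>\<close>.\<close>

lemma levy_unbounded_below:
  assumes L: "spos_levy M L \<Psi>" and \<gamma>: "0 < \<gamma>" and lim: "((\<lambda>lam. \<Psi> lam / lam) \<longlongrightarrow> \<gamma>) (at_right 0)"
  shows "AE \<omega> in M. \<exists>s\<ge>0. L s \<omega> < c"
proof -
  interpret prob_space M using L by (simp add: spos_levy_def)
  have rv: "L t \<in> borel_measurable M" if "0 \<le> t" for t using L that by (simp add: spos_levy_def)
  have L0: "L 0 \<omega> = 0" if "\<omega> \<in> space M" for \<omega> using L that by (simp add: spos_levy_def)
  define t where "t = (\<lambda>n. real (Suc n))"
  have t: "0 < t n" for n by (simp add: t_def)
  define X where "X = (\<lambda>n \<omega>. exp (- (1 / t n) * L (t n) \<omega>))"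
  have hb: "has_bochner_integral M (\<lambda>\<omega>. exp (- l * L (t n) \<omega>)) (exp (t n * \<Psi> l))" if "0 \<le> l" for l n
  proof (rule has_bochner_integral_nn_integral)
    have "(\<integral>\<^sup>+\<omega>. ennreal (exp (- l * (L (t n) \<omega> - L 0 \<omega>))) \<partial>M) = ennreal (exp ((t n - 0) * \<Psi> l))"
    proof -
      have "\<forall>s t lam. 0 \<le> s \<and> s \<le> t \<and> 0 \<le> lam \<longrightarrow>
          (\<integral>\<^sup>+\<omega>. ennreal (exp (- lam * (L t \<omega> - L s \<omega>))) \<partial>M) = ennreal (exp ((t - s) * \<Psi> lam))"
        using L by (simp add: spos_levy_def)
      from this[rule_format, of 0 "t n" l] show ?thesis using that t[of n] by simp
    qed
    then show "(\<integral>\<^sup>+\<omega>. ennreal (exp (- l * L (t n) \<omega>)) \<partial>M) = ennreal (exp (t n * \<Psi> l))"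
      using L0 by (simp cong: nn_integral_cong_simp)
  qed (use rv[of "t n"] t[of n] in auto)
  define m1 where "m1 = (\<lambda>n. exp (t n * \<Psi> (1 / t n)))"
  define m2 where "m2 = (\<lambda>n. exp (t n * \<Psi> (2 / t n)))"
  have inv: "filterlim (\<lambda>n. c / t n) (at_right 0) sequentially" if "0 < c" for c
  proof -
    have "(\<lambda>n. c * inverse (real (Suc n))) \<longlonglongrightarrow> c * 0" by (intro tendsto_mult tendsto_const LIMSEQ_inverse_real_of_nat)
    then have "(\<lambda>n. c / t n) \<longlonglongrightarrow> 0" by (simp add: t_def divide_inverse)
    then show ?thesis unfolding filterlim_at using t that by (simp add: always_eventually less_imp_neq[symmetric])
  qed
  have "(\<lambda>n. \<Psi> (1 / t n) / (1 / t n)) \<longlonglongrightarrow> \<gamma>" by (rule filterlim_compose[OF lim inv]) simp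
  then have "(\<lambda>n. exp (\<Psi> (1 / t n) / (1 / t n))) \<longlonglongrightarrow> exp \<gamma>" by (rule tendsto_exp)
  then have m1: "m1 \<longlonglongrightarrow> exp \<gamma>" by (simp add: m1_def mult.commute)
  have "(\<lambda>n. \<Psi> (2 / t n) / (2 / t n)) \<longlonglongrightarrow> \<gamma>" by (rule filterlim_compose[OF lim inv]) simp
  then have "(\<lambda>n. exp (2 * (\<Psi> (2 / t n) / (2 / t n)))) \<longlonglongrightarrow> exp (2 * \<gamma>)" by (intro tendsto_exp tendsto_mult tendsto_const)
  then have m2: "m2 \<longlonglongrightarrow> exp (2 * \<gamma>)" by (simp add: m2_def mult.commute)
  have var: "has_bochner_integral M (\<lambda>\<omega>. (X n \<omega> - exp \<gamma>)\<^sup>2) (m2 n - 2 * exp \<gamma> * m1 n + (exp \<gamma>)\<^sup>2 * 1)" for n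
  proof -
    have one: "has_bochner_integral M (\<lambda>\<omega>. 1) (1::real)" by (simp add: has_bochner_integral_iff prob_space)
    have "(X n \<omega> - exp \<gamma>)\<^sup>2 = exp (- (2 / t n) * L (t n) \<omega>) - 2 * exp \<gamma> * exp (- (1 / t n) * L (t n) \<omega>) + (exp \<gamma>)\<^sup>2 * 1" for \<omega>
    proof -
      have "exp (- (2 / t n) * L (t n) \<omega>) = X n \<omega> * X n \<omega>" by (simp add: X_def flip: exp_add)
      then show ?thesis by (simp add: X_def power2_eq_square algebra_simps)
    qed
    then show ?thesis unfolding m1_def m2_def using t[of n]
      by (simp only:) (intro has_bochner_integral_add has_bochner_integral_diff has_bochner_integral_mult_right hb one; simp)
  qed
  define \<kappa> where "\<kappa> = (exp \<gamma> - exp (\<gamma> / 2))\<^sup>2"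
  have \<kappa>: "0 < \<kappa>" unfolding \<kappa>_def using \<gamma> by (intro zero_less_power) simp
  define B where "B = {\<omega> \<in> space M. \<forall>n. c \<le> L (t n) \<omega>}"
  have B: "B \<in> events" unfolding B_def using rv t by (intro sets.sets_Collect_countable_All borel_measurable_le) (auto intro: less_imp_le)
  have "(\<lambda>n. exp (- (c * inverse (real (Suc n))))) \<longlonglongrightarrow> exp (- (c * 0))"
    by (intro tendsto_exp tendsto_minus tendsto_mult tendsto_const LIMSEQ_inverse_real_of_nat)
  then have "\<forall>\<^sub>F n in sequentially. exp (- (c * inverse (real (Suc n)))) < exp (\<gamma> / 2)" using \<gamma> by (intro order_tendstoD) auto
  then have bound: "\<forall>\<^sub>F n in sequentially. \<kappa> * prob B \<le> m2 n - 2 * exp \<gamma> * m1 n + (exp \<gamma>)\<^sup>2 * 1"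
  proof eventually_elim
    case (elim n)
    have "\<kappa> * prob B = (\<integral>\<omega>. \<kappa> * indicator B \<omega> \<partial>M)" using B by simp
    also have "\<dots> \<le> (\<integral>\<omega>. (X n \<omega> - exp \<gamma>)\<^sup>2 \<partial>M)"
    proof (rule integral_mono)
      show "integrable M (\<lambda>\<omega>. \<kappa> * indicator B \<omega>)" using B by (intro integrable_mult_right integrable_real_indicator) (auto simp: emeasure_eq_measure)
      show "integrable M (\<lambda>\<omega>. (X n \<omega> - exp \<gamma>)\<^sup>2)" using var by (auto simp: has_bochner_integral_iff)
      fix \<omega> assume "\<omega> \<in> space M"
      show "\<kappa> * indicator B \<omega> \<le> (X n \<omega> - exp \<gamma>)\<^sup>2"
      proof (cases "\<omega> \<in> B")
        case True
        then have "c * (1 / t n) \<le> L (t n) \<omega> * (1 / t n)" using t[of n] by (intro mult_right_mono) (auto simp: B_def)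
        then have "X n \<omega> \<le> exp (- (c * inverse (real (Suc n))))" by (simp add: X_def t_def inverse_eq_divide)
        then have "exp \<gamma> - exp (\<gamma> / 2) \<le> exp \<gamma> - X n \<omega>" using elim by linarith
        then have "\<kappa> \<le> (exp \<gamma> - X n \<omega>)\<^sup>2" unfolding \<kappa>_def using \<gamma> by (intro power_mono) auto
        then show ?thesis using True by (simp add: power2_commute)
      qed simp
    qed
    also have "\<dots> = m2 n - 2 * exp \<gamma> * m1 n + (exp \<gamma>)\<^sup>2 * 1" using var by (auto simp: has_bochner_integral_iff)
    finally show ?case .
  qed
  have "(\<lambda>n. m2 n - 2 * exp \<gamma> * m1 n + (exp \<gamma>)\<^sup>2 * 1) \<longlonglongrightarrow> exp (2 * \<gamma>) - 2 * exp \<gamma> * exp \<gamma> + (exp \<gamma>)\<^sup>2 * 1"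
    by (intro tendsto_add tendsto_diff tendsto_mult tendsto_const m1 m2)
  also have "exp (2 * \<gamma>) - 2 * exp \<gamma> * exp \<gamma> + (exp \<gamma>)\<^sup>2 * 1 = 0" by (simp add: power2_eq_square flip: exp_add)
  finally have "\<kappa> * prob B \<le> 0" using bound by (intro tendsto_lowerbound[OF _ bound]) auto
  then have "prob B = 0" using \<kappa> measure_nonneg[of M B] by (simp add: mult_le_0_iff) 
  then have "B \<in> null_sets M" using B by (simp add: emeasure_eq_measure null_sets_def)
  then show ?thesis by (rule AE_I') (use t in \<open>auto simp: B_def not_less intro: less_imp_le\<close>)
qed

lemma Xproc_infinite_imp:
  assumes "Xproc R L x t \<omega> = \<infinity>" "0 \<le> s" shows "0 \<le> x + L s \<omega>"
proof (rule ccontr)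
  assume "\<not> 0 \<le> x + L s \<omega>"
  then have "tau0 L x \<omega> \<le> ereal s" unfolding tau0_def using assms(2) by (intro Inf_lower) auto
  then have "min (eta_inv R L x \<omega> t) (tau0 L x \<omega>) \<noteq> \<infinity>" by (auto simp: min_def)
  then show False using assms(1) by (simp add: Xproc_def Let_def)
qed

lemma Xproc_finite:
  assumes L: "spos_levy M L \<Psi>" and \<gamma>: "0 < \<gamma>" and lim: "((\<lambda>lam. \<Psi> lam / lam) \<longlongrightarrow> \<gamma>) (at_right 0)"
  shows "AE \<omega> in M. Xproc R L x t \<omega> \<noteq> \<infinity>"
  using levy_unbounded_below[OF L \<gamma> lim, of "- x"]
proof eventually_elim
  case (elim \<omega>)
  then obtain s where "0 \<le> s" "L s \<omega> < - x" by blast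
  then show ?case using Xproc_infinite_imp[of R L x t \<omega> s] by fastforce
qed

text \<open>The set is open, for use with right-continuity, and contains \<open>\<infinity>\<close>,
  so that an infinite value counts as a deviation.\<close>

definition outside :: "real \<Rightarrow> real \<Rightarrow> ereal set" where
  "outside c2 c1 = {..<ereal c2} \<union> {ereal c1<..}"

text \<open>Either the path falls below \<open>a\<close> while its clock is at most
  \<open>t\<close>, which is bad whatever follows, or \<open>Xproc\<close> at time \<open>t\<close>
  is the position of the path when its clock equals \<open>t\<close>, and leaving the interval there
  is seen by the chains.\<close>

lemma grid_chain_eventually_bad:
  assumes R_cont: "continuous_on {0..} R" and R_pos: "\<And>y. 0 < y \<Longrightarrow> 0 < R y"
    and z_cont: "\<And>s. 0 \<le> s \<Longrightarrow> continuous (at_right s) (\<lambda>s. x + L s \<omega>)"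
    and a: "0 < a" "a \<le> c2" "c2 \<le> c1" and t: "0 \<le> t"
    and bound: "\<And>y. 1 / R (max y a) \<le> C" and hit: "0 \<le> s" "x + L s \<omega> < a"
    and out: "Xproc R L x t \<omega> \<in> outside c2 c1"
  shows "\<exists>T0>t. \<forall>T. t < T \<and> T < T0 \<longrightarrow> (\<forall>\<^sub>F n in sequentially.
    grid_chain (\<lambda>s. x + L s \<omega>) (\<lambda>y. 1 / R (max y a)) a T n \<in> bad_state c1 c2 T)"
proof -
  define z where "z = (\<lambda>s. x + L s \<omega>)"
  define g where "g = (\<lambda>y. 1 / R (max y a))"
  have "continuous_on {0<..} R" by (rule continuous_on_subset[OF R_cont]) auto
  then have "continuous_on UNIV (\<lambda>y. R (max y a))"
    by (rule continuous_on_compose2) (use a in \<open>auto intro!: continuous_intros\<close>)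
  then have Rc: "isCont (\<lambda>y. R (max y a)) y" for y by (simp add: continuous_on_eq_continuous_at)
  have Rmax: "0 < R (max y a)" for y using a by (intro R_pos) simp
  have gc: "isCont g y" for y unfolding g_def
    by (intro isCont_divide continuous_const Rc) (rule less_imp_neq[OF Rmax, symmetric])
  have gp: "0 < g y" for y using Rmax by (simp add: g_def)
  have gl: "g y \<le> C" for y unfolding g_def by (rule bound)
  have zc: "continuous (at_right s) z" if "0 \<le> s" for s unfolding z_def by (rule z_cont[OF that])
  note ctx = zc gc gp gl t a
  show ?thesis
  proof (cases "\<exists>s0\<ge>0. z s0 < a \<and> clock (\<lambda>r. g (z r)) s0 \<le> t")
    case True
    then obtain s0 where "0 \<le> s0" "z s0 < a" "clock (\<lambda>r. g (z r)) s0 \<le> t" by blast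
    then have "\<forall>\<^sub>F n in sequentially. grid_chain z g a T n \<in> bad_state c1 c2 T" if "t < T" for T
      using that by (intro grid_chain_early_crossing[OF ctx]) auto
    then show ?thesis unfolding z_def[symmetric] g_def[symmetric] by (intro exI[of _ "t + 1"]) auto
  next
    case False
    then have no_early: "t < clock (\<lambda>r. g (z r)) s" if "0 \<le> s" "z s < a" for s using that by (auto simp: not_le)
    have "z s < a" using hit by (simp add: z_def)
    from exists_clock_time[OF ctx hit(1) this no_early]
    obtain u where u: "0 \<le> u" "clock (\<lambda>r. g (z r)) u = t" "\<And>r. 0 \<le> r \<Longrightarrow> r \<le> u \<Longrightarrow> a \<le> z r" by blast
    have "Xproc R L x t \<omega> = ereal (z u)" unfolding z_def
      by (rule Xproc_eq_at_clock_time[where L = L and x = x and \<omega> = \<omega>, OF z_cont R_cont R_pos a(1) bound u(1)]) (use u in \<open>auto simp: g_def z_def\<close>)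
    then have "z u < c2 \<or> c1 < z u" using out by (simp add: outside_def)
    from grid_chain_exit[OF ctx u this] show ?thesis unfolding z_def g_def by simp
  qed
qed

section \<open>Transfer to the process started at infinity\<close>

section \<open>Entrance from infinity\<close>

text \<open>\<open>x0\<close> may depend on \<open>\<beta>\<close>, that is on the time
  \<open>\<phi> \<beta>\<close>: the starting point goes to infinity before the time goes to
  zero.\<close>

lemma Xproc_outside_small:
  assumes tail: "levy_tail \<phi> (\<lambda>x. 1 / R x) \<gamma> \<Psi>" and L: "spos_levy M L \<Psi>"
    and R_cont: "continuous_on {0..} R" and R_pos: "\<And>x. 0 < x \<Longrightarrow> 0 < R x"
    and \<epsilon>: "0 < \<epsilon>" "\<epsilon> < 1 / 2" and \<eta>: "0 < \<eta>"
  obtains \<beta>0 where "0 < \<beta>0" "\<And>\<beta>. \<beta>0 \<le> \<beta> \<Longrightarrow> \<exists>x0. \<forall>x\<ge>x0.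
    emeasure M {\<omega> \<in> space M. Xproc R L x (\<phi> \<beta>) \<omega> \<in> outside ((1 - \<epsilon>) * \<beta>) ((1 + \<epsilon>) * \<beta>)} \<le> ennreal (2 * \<eta>)"
proof -
  interpret levy_tail \<phi> "\<lambda>x. 1 / R x" \<gamma> \<Psi> by (rule tail)
  interpret prob_space M using L by (simp add: spos_levy_def)
  obtain \<beta>1 where up: "\<And>\<beta> T \<Delta> \<xi> n x (M :: 'a measure). \<beta>1 \<le> \<beta> \<Longrightarrow> \<phi> \<beta> \<le> T \<Longrightarrow> 0 < \<Delta> \<Longrightarrow> \<Delta> \<le> 1 \<Longrightarrow>
    levy_increments M \<Psi> \<Delta> \<xi> n \<Longrightarrow>
    measure M {\<omega> \<in> space M. chain (\<lambda>y. 1 / R (max y (\<beta> / 2))) (\<beta> / 2) T \<Delta> (\<lambda>i. \<xi> i \<omega>) x n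
      \<in> {s. (1 + \<epsilon>) * \<beta> < fst s \<and> T < snd s}} \<le> \<eta>"
    using upper_deviation[OF \<epsilon>(1) \<eta>] by blast
  obtain \<beta>2 \<delta> where \<delta>: "0 < \<delta>" and low: "\<And>\<beta>. \<beta>2 \<le> \<beta> \<Longrightarrow> \<exists>x0. \<exists>\<Delta>0>0. \<forall>T \<Delta> \<xi> n x. \<forall>M :: 'a measure. x0 \<le> x \<longrightarrow>
    \<phi> \<beta> \<le> T \<longrightarrow> T \<le> (1 + \<delta>) * \<phi> \<beta> \<longrightarrow> 0 < \<Delta> \<longrightarrow> \<Delta> \<le> \<Delta>0 \<longrightarrow> levy_increments M \<Psi> \<Delta> \<xi> n \<longrightarrow>
    measure M {\<omega> \<in> space M. chain (\<lambda>y. 1 / R (max y (\<beta> / 2))) (\<beta> / 2) T \<Delta> (\<lambda>i. \<xi> i \<omega>) x n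
      \<in> {s. fst s < (1 - \<epsilon>) * \<beta>}} \<le> \<eta>"
    by (rule lower_deviation[OF \<epsilon> \<eta>]) (rule that; assumption)
  obtain cg y2 where "0 < cg" and cg: "\<And>y. y2 \<le> y \<Longrightarrow> 1 / R y \<le> cg"
    by (rule g_eventually_bounded) (rule that; assumption)
  show ?thesis
  proof (rule that[of "max (max \<beta>1 \<beta>2) (max (2 * y2) 1)"])
    fix \<beta> assume "max (max \<beta>1 \<beta>2) (max (2 * y2) 1) \<le> \<beta>"
    then have \<beta>: "\<beta>1 \<le> \<beta>" "\<beta>2 \<le> \<beta>" "y2 \<le> \<beta> / 2" "0 < \<beta>" by auto
    define a where "a = \<beta> / 2"
    define c2 where "c2 = (1 - \<epsilon>) * \<beta>"
    define c1 where "c1 = (1 + \<epsilon>) * \<beta>"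
    define t where "t = \<phi> \<beta>"
    define g where "g = (\<lambda>y. 1 / R (max y a))"
    have t: "0 < t" unfolding t_def using \<beta>(4) by (rule \<phi>_pos)
    have a: "0 < a" "a \<le> c2" "c2 \<le> c1" using \<beta> \<epsilon> mult_right_mono[of "1 / 2" "1 - \<epsilon>" \<beta>] mult_right_mono[of "1 - \<epsilon>" "1 + \<epsilon>" \<beta>]
      by (auto simp: a_def c2_def c1_def)
    have bound: "1 / R (max y a) \<le> cg" for y using \<beta>(3) by (intro cg) (auto simp: a_def)
    have g_meas: "g \<in> borel_measurable borel" unfolding g_def by (rule measurable_truncated_g[OF a(1)])
    obtain x0 \<Delta>0 where \<Delta>0: "0 < \<Delta>0" and low': "\<And>T \<Delta> \<xi> n x. \<And>M :: 'a measure. x0 \<le> x \<Longrightarrow>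
      t \<le> T \<Longrightarrow> T \<le> (1 + \<delta>) * t \<Longrightarrow> 0 < \<Delta> \<Longrightarrow> \<Delta> \<le> \<Delta>0 \<Longrightarrow> levy_increments M \<Psi> \<Delta> \<xi> n \<Longrightarrow>
      measure M {\<omega> \<in> space M. chain g a T \<Delta> (\<lambda>i. \<xi> i \<omega>) x n \<in> {s. fst s < c2}} \<le> \<eta>"
      using low[OF \<beta>(2)] unfolding t_def g_def a_def c2_def by blast
    show "\<exists>x0. \<forall>x\<ge>x0. emeasure M {\<omega> \<in> space M. Xproc R L x (\<phi> \<beta>) \<omega> \<in> outside ((1 - \<epsilon>) * \<beta>) ((1 + \<epsilon>) * \<beta>)} \<le> ennreal (2 * \<eta>)"
    proof (intro exI[of _ x0] allI impI)
      fix x assume x: "x0 \<le> x"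
      define A where "A = {\<omega> \<in> space M. Xproc R L x t \<omega> \<in> outside c2 c1}"
      define \<Delta> where "\<Delta> = (\<lambda>n. 1 / real (Suc n))"
      \<comment> \<open>Strictly above \<open>t\<close>, since bad endpoints are detected only at
        clock levels beyond \<open>t\<close>, and tending to \<open>t\<close>, so that the cap
        \<open>(1 + \<delta>) * t\<close> of the lower deviation bound is met.\<close>
      define T where "T = (\<lambda>m. t + 1 / real (Suc m))"
      define \<xi> where "\<xi> = (\<lambda>n i \<omega>. L (real (Suc i) * \<Delta> n) \<omega> - L (real i * \<Delta> n) \<omega>)"
      define Z where "Z = (\<lambda>m n \<omega>. chain g a (T m) (\<Delta> n) (\<lambda>i. \<xi> n i \<omega>) x ((Suc n)\<^sup>2))"
      define E where "E = (\<lambda>m n. {\<omega> \<in> space M. Z m n \<omega> \<in> bad_state c1 c2 (T m)})"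
      have \<Delta>: "0 < \<Delta> n" "\<Delta> n \<le> 1" for n by (auto simp: \<Delta>_def)
      have inc: "levy_increments M \<Psi> (\<Delta> n) (\<xi> n) k" for n k unfolding \<xi>_def by (rule levy_increments_grid[OF L \<Delta>(1)])
      have Z_meas: "Z m n \<in> M \<rightarrow>\<^sub>M borel \<Otimes>\<^sub>M borel" for m n unfolding Z_def
      proof (rule measurable_chain[OF g_meas])
        show "\<xi> n i \<in> borel_measurable M" if "i < (Suc n)\<^sup>2" for i
          using inc[of n "(Suc n)\<^sup>2"] that by (simp add: levy_increments_def indep_vars_def)
      qed
      have E_eq: "E m n = {\<omega> \<in> space M. Z m n \<omega> \<in> {s. c1 < fst s \<and> T m < snd s}} \<union> {\<omega> \<in> space M. Z m n \<omega> \<in> {s. fst s < c2}}" for m n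
        unfolding E_def by (auto simp: bad_state_def)
      have ev: "{\<omega> \<in> space M. Z m n \<omega> \<in> {s. c1 < fst s \<and> T m < snd s}} \<in> events" "{\<omega> \<in> space M. Z m n \<omega> \<in> {s. fst s < c2}} \<in> events" for m n
        using measurable_sets[OF Z_meas sets_states(1)] measurable_sets[OF Z_meas sets_states(2)]
        by (simp_all add: vimage_def Int_def conj_commute)
      have E: "E m n \<in> events" for m n unfolding E_eq using ev by blast
      have le: "\<forall>\<^sub>F m in sequentially. \<forall>\<^sub>F n in sequentially. prob (E m n) \<le> 2 * \<eta>"
      proof -
        have "\<forall>\<^sub>F m in sequentially. 1 / real (Suc m) < \<delta> * t"
          using \<delta> t order_tendstoD(2)[OF LIMSEQ_inverse_real_of_nat, of "\<delta> * t"] by (simp add: inverse_eq_divide)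
        then show ?thesis
        proof eventually_elim
          case (elim m)
          have Tm: "t \<le> T m" "T m \<le> (1 + \<delta>) * t" using elim by (auto simp: T_def algebra_simps)
          have "\<forall>\<^sub>F n in sequentially. \<Delta> n < \<Delta>0" unfolding \<Delta>_def
            using \<Delta>0 order_tendstoD(2)[OF LIMSEQ_inverse_real_of_nat, of \<Delta>0] by (simp add: inverse_eq_divide)
          then show ?case
          proof eventually_elim
            case (elim n)
            have "prob (E m n) \<le> prob {\<omega> \<in> space M. Z m n \<omega> \<in> {s. c1 < fst s \<and> T m < snd s}} + prob {\<omega> \<in> space M. Z m n \<omega> \<in> {s. fst s < c2}}"
              unfolding E_eq by (rule measure_Un_le[OF ev])
            also have "\<dots> \<le> \<eta> + \<eta>"
            proof (rule add_mono)
              show "prob {\<omega> \<in> space M. Z m n \<omega> \<in> {s. c1 < fst s \<and> T m < snd s}} \<le> \<eta>"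
                using up[OF \<beta>(1) Tm(1)[unfolded t_def] \<Delta> inc] unfolding Z_def g_def a_def c1_def .
              show "prob {\<omega> \<in> space M. Z m n \<omega> \<in> {s. fst s < c2}} \<le> \<eta>"
                using low'[OF x Tm \<Delta>(1) less_imp_le[OF elim] inc] unfolding Z_def .
            qed
            finally show ?case by simp
          qed
        qed
      qed
      have sub: "AE \<omega> in M. \<omega> \<in> A \<longrightarrow> (\<forall>\<^sub>F m in sequentially. \<forall>\<^sub>F n in sequentially. \<omega> \<in> E m n)"
      proof -
        have cadlag: "AE \<omega> in M. cadlag_on_nonneg (\<lambda>s. L s \<omega>)" using L by (simp add: spos_levy_def)
        show ?thesis using cadlag levy_unbounded_below[OF L \<gamma>_pos \<Psi>_lim, of "a - x"] AE_space
        proof eventually_elim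
          case (elim \<omega>)
          show ?case
          proof
            assume "\<omega> \<in> A"
            then have out: "Xproc R L x t \<omega> \<in> outside c2 c1" by (simp add: A_def)
            obtain s where s: "0 \<le> s" "x + L s \<omega> < a" using elim(2) by (auto simp: less_diff_eq add.commute)
            have zc: "continuous (at_right s) (\<lambda>s. x + L s \<omega>)" if "0 \<le> s" for s
              using elim(1) that unfolding cadlag_on_nonneg_def by (intro continuous_add continuous_const) auto
            obtain T0 where T0: "t < T0" "\<And>T. t < T \<Longrightarrow> T < T0 \<Longrightarrow> \<forall>\<^sub>F n in sequentially.
                grid_chain (\<lambda>s. x + L s \<omega>) (\<lambda>y. 1 / R (max y a)) a T n \<in> bad_state c1 c2 T"
              using grid_chain_eventually_bad[where L = L and x = x and \<omega> = \<omega>, OF R_cont R_pos zc a less_imp_le[OF t] bound s out] by blast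
            have L0: "L 0 \<omega> = 0" using L elim(3) by (simp add: spos_levy_def)
            have grid: "grid_chain (\<lambda>s. x + L s \<omega>) (\<lambda>y. 1 / R (max y a)) a (T m) n = Z m n \<omega>" for m n
              by (simp add: grid_chain_def Z_def \<xi>_def \<Delta>_def g_def L0)
            have "\<forall>\<^sub>F m in sequentially. 1 / real (Suc m) < T0 - t"
              using T0(1) order_tendstoD(2)[OF LIMSEQ_inverse_real_of_nat, of "T0 - t"] by (simp add: inverse_eq_divide)
            then show "\<forall>\<^sub>F m in sequentially. \<forall>\<^sub>F n in sequentially. \<omega> \<in> E m n"
            proof eventually_elim
              case (elim m)
              have Tm: "t < T m" "T m < T0" using elim by (auto simp: T_def)
              have "\<forall>\<^sub>F n in sequentially. Z m n \<omega> \<in> bad_state c1 c2 (T m)"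
                using T0(2)[OF Tm] unfolding grid .
              then show ?case using \<open>\<omega> \<in> A\<close> by (simp add: E_def A_def)
            qed
          qed
        qed
      qed
      have "emeasure M A \<le> ennreal (2 * \<eta>)"
      proof (cases "A \<in> events")
        case True
        then have "prob A \<le> 2 * \<eta>" by (rule prob_le_of_eventually[OF E le _ sub])
        then show ?thesis by (simp add: emeasure_eq_measure ennreal_leI)
      next
        case False \<comment> \<open>\<open>emeasure\<close> vanishes on non-measurable sets, and only upper bounds are needed.\<close>
        then show ?thesis by (simp add: emeasure_notin_sets)
      qed
      then show "emeasure M {\<omega> \<in> space M. Xproc R L x (\<phi> \<beta>) \<omega> \<in> outside ((1 - \<epsilon>) * \<beta>) ((1 + \<epsilon>) * \<beta>)} \<le> ennreal (2 * \<eta>)"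
        by (simp add: A_def t_def c2_def c1_def)
    qed
  qed simp
qed

text \<open>The strong Markov property at the constant time \<open>s\<close>. The set
  \<open>Q\<close> enters through the stopped event and is used to exclude small starting
  points.\<close>

lemma entrance_markov:
  assumes Y: "entrance_from_infinity M L R N F Y" and s: "0 \<le> s" "0 \<le> t"
    and Q: "Q \<in> sets borel" and B: "B \<in> sets borel"
  shows "emeasure N {\<omega> \<in> space N. Y s \<omega> \<in> Q \<and> Y s \<omega> < \<infinity> \<and> Y (s + t) \<omega> \<in> B} =
    (\<integral>\<^sup>+\<omega>. indicator {\<omega> \<in> space N. Y s \<omega> \<in> Q \<and> Y s \<omega> < \<infinity>} \<omega> *
      emeasure M {\<omega>' \<in> space M. Xproc R L (real_of_ereal (Y s \<omega>)) t \<omega>' \<in> B} \<partial>N)"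
proof -
  have F: "\<And>t. space (F t) = space N" "\<And>t. sets (F t) \<subseteq> sets N" "\<And>s t. s \<le> t \<Longrightarrow> sets (F s) \<subseteq> sets (F t)"
    using Y unfolding entrance_from_infinity_def is_filtration_def by auto
  have Ys: "Y s \<in> measurable (F s) borel" using Y s unfolding entrance_from_infinity_def by auto
  define T where "T = (\<lambda>_ :: 'b. ereal s)"
  define A where "A = {\<omega> \<in> space N. Y s \<omega> \<in> Q}"
  have A: "A \<in> sets (F s)" using measurable_sets[OF Ys Q] by (simp add: A_def F(1) vimage_def Int_def conj_commute)
  have T: "is_stopping_time F T" unfolding is_stopping_time_def
  proof (intro conjI allI ballI impI)
    show "{\<omega> \<in> space (F t). T \<omega> \<le> ereal t} \<in> sets (F t)" for t by (cases "s \<le> t") (auto simp: T_def)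
  qed (use s in \<open>auto simp: T_def\<close>)
  have "{\<omega> \<in> A. T \<omega> \<le> ereal t} \<in> sets (F t)" for t using A F(3)[of s t] by (cases "s \<le> t") (auto simp: T_def)
  then have A_stop: "A \<in> stopped_sets N F T" using A F(2) by (auto simp: stopped_sets_def)
  have strong: "\<forall>T. is_stopping_time F T \<longrightarrow>
        (\<forall>A \<in> stopped_sets N F T. \<forall>tBs :: (real \<times> ereal set) list.
           (\<forall>(t, B) \<in> set tBs. 0 \<le> t \<and> B \<in> sets borel) \<longrightarrow>
           emeasure N {\<omega> \<in> A. T \<omega> < \<infinity> \<and> Y (real_of_ereal (T \<omega>)) \<omega> < \<infinity> \<and>
               (\<forall>(t, B) \<in> set tBs. Y (real_of_ereal (T \<omega>) + t) \<omega> \<in> B)}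
           = (\<integral>\<^sup>+\<omega>. indicator {\<omega> \<in> A. T \<omega> < \<infinity> \<and> Y (real_of_ereal (T \<omega>)) \<omega> < \<infinity>} \<omega> *
                emeasure M {\<omega>' \<in> space M. \<forall>(t, B) \<in> set tBs.
                   Xproc R L (real_of_ereal (Y (real_of_ereal (T \<omega>)) \<omega>)) t \<omega>' \<in> B} \<partial>N))"
    using Y unfolding entrance_from_infinity_def by (elim conjE)
  note bspec[OF mp[OF spec[OF strong] T] A_stop, THEN spec, THEN mp, of "[(t, B)]"]
  then show ?thesis using s B by (simp add: T_def A_def conj_assoc)
qed

lemma entrance_measurable:
  assumes Y: "entrance_from_infinity M L R N F Y" and "0 \<le> t"
  shows "Y t \<in> borel_measurable N"
proof -
  have "Y t \<in> measurable (F t) borel" "is_filtration N F" using assms by (auto simp: entrance_from_infinity_def)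
  then show ?thesis unfolding is_filtration_def measurable_def by auto
qed

text \<open>Leaving infinity instantaneously and right-continuity give a rational time before
  \<open>s\<close> with a finite value. From a finite value at a fixed time the Markov property and
  \<open>Xproc_finite\<close> exclude \<open>\<infinity>\<close> at time \<open>s\<close> almost
  surely; rationality leaves only countably many null sets.\<close>

lemma entrance_finite:
  assumes Y: "entrance_from_infinity M L R N F Y" and L: "spos_levy M L \<Psi>" and \<gamma>: "0 < \<gamma>"
    and lim: "((\<lambda>lam. \<Psi> lam / lam) \<longlongrightarrow> \<gamma>) (at_right 0)" and s: "0 < s"
  shows "AE \<omega> in N. Y s \<omega> < \<infinity>"
proof -
  interpret prob_space N using Y by (simp add: entrance_from_infinity_def)
  have cadlag: "AE \<omega> in N. cadlag_on_nonneg (\<lambda>t. Y t \<omega>)" using Y by (simp add: entrance_from_infinity_def)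
  have leave: "AE \<omega> in N. \<forall>\<epsilon>>0. \<exists>t. 0 < t \<and> t < \<epsilon> \<and> Y t \<omega> < \<infinity>" using Y by (simp add: entrance_from_infinity_def)
  note YM = entrance_measurable[OF Y]
  have "AE \<omega> in N. \<forall>q\<in>\<rat>. 0 < q \<and> q < s \<longrightarrow> \<not> (Y q \<omega> < \<infinity> \<and> Y s \<omega> = \<infinity>)"
  proof (rule AE_ball_countable[OF countable_rat, THEN iffD2], rule ballI)
    fix q :: real assume "q \<in> \<rat>"
    show "AE \<omega> in N. 0 < q \<and> q < s \<longrightarrow> \<not> (Y q \<omega> < \<infinity> \<and> Y s \<omega> = \<infinity>)"
    proof (cases "0 < q \<and> q < s")
      case True
      have null: "emeasure M {\<omega>' \<in> space M. Xproc R L x (s - q) \<omega>' = \<infinity>} = 0" for x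
        using emeasure_eq_0_AE[of "\<lambda>\<omega>'. Xproc R L x (s - q) \<omega>' = \<infinity>" M] Xproc_finite[OF L \<gamma> lim, of R x "s - q"] by simp
      have "emeasure N {\<omega> \<in> space N. Y q \<omega> \<in> UNIV \<and> Y q \<omega> < \<infinity> \<and> Y (q + (s - q)) \<omega> \<in> {\<infinity>}} = 0"
        using True by (subst entrance_markov[OF Y]) (auto simp: null)
      then have null_q: "emeasure N {\<omega> \<in> space N. Y q \<omega> < \<infinity> \<and> Y s \<omega> = \<infinity>} = 0" by simp
      have [measurable]: "Y q \<in> borel_measurable N" "Y s \<in> borel_measurable N"
        using YM True by auto
      have "{\<omega> \<in> space N. Y q \<omega> < \<infinity> \<and> Y s \<omega> = \<infinity>} \<in> events" by measurable
      with null_q have "AE \<omega> in N. \<not> (Y q \<omega> < \<infinity> \<and> Y s \<omega> = \<infinity>)"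
        by (intro AE_I[of _ _ "{\<omega> \<in> space N. Y q \<omega> < \<infinity> \<and> Y s \<omega> = \<infinity>}"]) auto
      then show ?thesis by simp
    next
      case False
      then show ?thesis by (intro AE_I2) blast
    qed
  qed
  with cadlag leave show ?thesis
  proof eventually_elim
    case (elim \<omega>)
    obtain t where t: "0 < t" "t < s" "Y t \<omega> < \<infinity>" using elim(2) s by blast
    have "((\<lambda>t. Y t \<omega>) \<longlongrightarrow> Y t \<omega>) (at_right t)"
      using elim(1) t unfolding cadlag_on_nonneg_def continuous_within by auto
    then have "\<forall>\<^sub>F r in at_right t. Y r \<omega> < \<infinity>" using t(3) by (rule order_tendstoD(2))
    then obtain b where b: "t < b" "\<And>r. t < r \<Longrightarrow> r < b \<Longrightarrow> Y r \<omega> < \<infinity>" unfolding eventually_at_right_field by auto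
    obtain q where q: "q \<in> \<rat>" "t < q" "q < min b s" using Rats_dense_in_real[of t "min b s"] b t by auto
    then have "\<not> (Y q \<omega> < \<infinity> \<and> Y s \<omega> = \<infinity>)" using elim(3) t by auto
    then show ?case using b(2)[of q] q by auto
  qed
qed

text \<open>The bound on \<open>Xproc\<close> needs a finite start that is at least
  \<open>x0\<close>. Along \<open>s n\<close> finiteness holds by \<open>entrance_finite\<close>,
  and the size because \<open>Y 0\<close> is infinite. Openness of \<open>outside c2 c1\<close>
  turns convergence of \<open>Y (s n + t)\<close> into eventual membership, so the event lies in the
  lower limit of the \<open>E n\<close>.\<close>

lemma entrance_outside_le:
  assumes Y: "entrance_from_infinity M L R N F Y" and L: "spos_levy M L \<Psi>" and \<gamma>: "0 < \<gamma>"
    and lim: "((\<lambda>lam. \<Psi> lam / lam) \<longlongrightarrow> \<gamma>) (at_right 0)" and t: "0 < t" and \<eta>: "0 \<le> \<eta>"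
    and X: "\<And>x. x0 \<le> x \<Longrightarrow> emeasure M {\<omega> \<in> space M. Xproc R L x t \<omega> \<in> outside c2 c1} \<le> ennreal \<eta>"
  shows "measure N {\<omega> \<in> space N. Y t \<omega> \<in> outside c2 c1} \<le> \<eta>"
proof -
  interpret prob_space N using Y by (simp add: entrance_from_infinity_def)
  have cadlag: "AE \<omega> in N. cadlag_on_nonneg (\<lambda>t. Y t \<omega>)" using Y by (simp add: entrance_from_infinity_def)
  have nonneg: "0 \<le> Y s \<omega>" if "0 \<le> s" "\<omega> \<in> space N" for s \<omega> using Y that by (simp add: entrance_from_infinity_def)
  have Y0: "Y 0 \<omega> = \<infinity>" if "\<omega> \<in> space N" for \<omega> using Y that by (simp add: entrance_from_infinity_def)
  note YM = entrance_measurable[OF Y]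
  have open_out: "open (outside c2 c1)" unfolding outside_def by auto
  then have out: "outside c2 c1 \<in> sets borel" by auto
  define s where "s = (\<lambda>n. inverse (real (Suc n)))"
  have s: "0 < s n" for n by (simp add: s_def)
  have slim: "s \<longlonglongrightarrow> 0" unfolding s_def by (rule LIMSEQ_inverse_real_of_nat)
  define E where "E = (\<lambda>n. {\<omega> \<in> space N. Y (s n) \<omega> \<in> {ereal x0..} \<and> Y (s n) \<omega> < \<infinity> \<and> Y (s n + t) \<omega> \<in> outside c2 c1})"
  have E: "E n \<in> events" for n
  proof -
    have [measurable]: "Y (s n) \<in> borel_measurable N" "Y (s n + t) \<in> borel_measurable N" "outside c2 c1 \<in> sets borel"
      using YM s[of n] t out by auto
    show ?thesis unfolding E_def by measurable
  qed
  have E_le: "prob (E n) \<le> \<eta>" for n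
  proof -
    have "emeasure N (E n) = (\<integral>\<^sup>+\<omega>. indicator {\<omega> \<in> space N. Y (s n) \<omega> \<in> {ereal x0..} \<and> Y (s n) \<omega> < \<infinity>} \<omega> *
      emeasure M {\<omega>' \<in> space M. Xproc R L (real_of_ereal (Y (s n) \<omega>)) t \<omega>' \<in> outside c2 c1} \<partial>N)"
      unfolding E_def using s[of n] t by (intro entrance_markov[OF Y _ _ _ out]) auto
    also have "\<dots> \<le> (\<integral>\<^sup>+\<omega>. ennreal \<eta> \<partial>N)"
    proof (rule nn_integral_mono)
      fix \<omega> assume \<omega>: "\<omega> \<in> space N"
      show "indicator {\<omega> \<in> space N. Y (s n) \<omega> \<in> {ereal x0..} \<and> Y (s n) \<omega> < \<infinity>} \<omega> *
        emeasure M {\<omega>' \<in> space M. Xproc R L (real_of_ereal (Y (s n) \<omega>)) t \<omega>' \<in> outside c2 c1} \<le> ennreal \<eta>"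
      proof (cases "\<omega> \<in> {\<omega> \<in> space N. Y (s n) \<omega> \<in> {ereal x0..} \<and> Y (s n) \<omega> < \<infinity>}")
        case True
        then have "x0 \<le> real_of_ereal (Y (s n) \<omega>)" using nonneg[of "s n" \<omega>] \<omega> s[of n] by (cases "Y (s n) \<omega>") auto
        then show ?thesis using X True by simp
      qed simp
    qed
    also have "\<dots> = ennreal \<eta>" by (simp add: emeasure_space_1)
    finally show ?thesis using \<eta> by (simp add: emeasure_eq_measure)
  qed
  have A: "{\<omega> \<in> space N. Y t \<omega> \<in> outside c2 c1} \<in> events"
    using measurable_sets[OF YM[of t] out] t by (simp add: vimage_def Int_def conj_commute)
  have fin: "AE \<omega> in N. \<forall>n. Y (s n) \<omega> < \<infinity>"
    unfolding AE_all_countable using entrance_finite[OF Y L \<gamma> lim s] by blast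
  have "AE \<omega> in N. \<omega> \<in> {\<omega> \<in> space N. Y t \<omega> \<in> outside c2 c1} \<longrightarrow> (\<forall>\<^sub>F m in sequentially. \<forall>\<^sub>F n in sequentially. \<omega> \<in> E n)"
    using cadlag fin
  proof eventually_elim
    case (elim \<omega>)
    have rc: "((\<lambda>r. Y r \<omega>) \<longlongrightarrow> Y u \<omega>) (at_right u)" if "0 \<le> u" for u
      using elim(1) that unfolding cadlag_on_nonneg_def continuous_within by auto
    have seq: "filterlim (\<lambda>n. s n + u) (at_right u) sequentially" for u
    proof -
      have "(\<lambda>n. s n + u) \<longlonglongrightarrow> 0 + u" by (intro tendsto_add slim tendsto_const)
      then show ?thesis unfolding filterlim_at using s by (simp add: always_eventually less_imp_neq[symmetric])
    qed
    have ylim: "(\<lambda>n. Y (s n + u) \<omega>) \<longlonglongrightarrow> Y u \<omega>" if "0 \<le> u" for u by (rule filterlim_compose[OF rc[OF that] seq])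
    show ?case
    proof
      assume \<omega>: "\<omega> \<in> {\<omega> \<in> space N. Y t \<omega> \<in> outside c2 c1}"
      have "\<forall>\<^sub>F n in sequentially. Y (s n + t) \<omega> \<in> outside c2 c1"
        using topological_tendstoD[OF ylim open_out] t \<omega> by simp
      moreover have "\<forall>\<^sub>F n in sequentially. ereal x0 < Y (s n) \<omega>"
        using order_tendstoD(1)[OF ylim[of 0], of "ereal x0"] Y0 \<omega> by simp
      ultimately have "\<forall>\<^sub>F n in sequentially. \<omega> \<in> E n"
        by eventually_elim (use \<omega> elim(2) in \<open>auto simp: E_def\<close>)
      then show "\<forall>\<^sub>F m in sequentially. \<forall>\<^sub>F n in sequentially. \<omega> \<in> E n" by simp
    qed
  qed
  \<comment> \<open>The outer index is constant here; the only limit is that of the Markov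
    times.\<close>
  from prob_le_of_eventually[OF E always_eventually A this] E_le show ?thesis by simp
qed

theorem theorem3p3:
  fixes \<gamma> \<sigma> :: real and \<pi> :: "real measure" and R :: "real \<Rightarrow> real"
    and M :: "'a measure" and L :: "real \<Rightarrow> 'a \<Rightarrow> real"
    and N :: "'b measure" and F :: "real \<Rightarrow> 'b measure" and Y :: "real \<Rightarrow> 'b \<Rightarrow> ereal"
  assumes gamma_pos: "\<gamma> > 0" and sigma_nonneg: "\<sigma> \<ge> 0"
    and levy: "levy_measure \<pi>"
    and R_cont: "continuous_on {0..} R" and R_pos: "\<And>x. x > 0 \<Longrightarrow> R x > 0"
    and Z: "spos_levy M L (laplace_exponent \<gamma> \<sigma> \<pi>)"
    and integral_cond: "\<exists>a>0. (\<lambda>x. 1 / (x * laplace_exponent \<gamma> \<sigma> \<pi> (1 / x) * R x)) integrable_on {a..}"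
    and H1: "Limsup (at_right 1) (\<lambda>h. Liminf at_top (\<lambda>x. ereal (phi \<gamma> R (h * x) / phi \<gamma> R x))) = 1"
    and H2: "\<And>h. h > 1 \<Longrightarrow> Liminf at_top (\<lambda>x. ereal (phi \<gamma> R x / phi \<gamma> R (h * x))) > 1"
    and H3: "\<exists>Vlim :: real \<Rightarrow> ereal.
               (\<forall>\<^sub>F \<rho> in at_right 0. ((\<lambda>z. Vfun R z \<rho>) \<longlongrightarrow> Vlim \<rho>) at_top) \<and>
               Limsup (at_right 0) Vlim = 0"
    and Pinf: "entrance_from_infinity M L R N F Y"
  shows "\<forall>\<epsilon>>0. ((\<lambda>t. measure N {\<omega> \<in> space N. Y t \<omega> = \<infinity> \<or>
            \<bar>real_of_ereal (Y t \<omega>) / phi_inv \<gamma> R t - 1\<bar> > \<epsilon>}) \<longlongrightarrow> 0) (at_right 0)"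
proof (intro allI impI tendstoI)
  fix \<epsilon> e :: real assume \<epsilon>: "0 < \<epsilon>" and e: "0 < e"
  define \<Psi> where "\<Psi> = laplace_exponent \<gamma> \<sigma> \<pi>"
  define \<phi> where "\<phi> = phi \<gamma> R"
  have lim: "((\<lambda>lam. \<Psi> lam / lam) \<longlongrightarrow> \<gamma>) (at_right 0)"
    unfolding \<Psi>_def by (rule laplace_exponent_quotient_tendsto[OF levy])
  interpret regular_tail \<phi> "\<lambda>x. 1 / R x" \<gamma>
    unfolding \<phi>_def by (rule regular_tail_phi[OF gamma_pos levy R_cont R_pos integral_cond H1 H2 H3])
  have tail: "levy_tail \<phi> (\<lambda>x. 1 / R x) \<gamma> \<Psi>"
    by unfold_locales (use lim laplace_exponent_ge[OF levy] in \<open>auto simp: \<Psi>_def\<close>)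
  interpret N: prob_space N using Pinf by (simp add: entrance_from_infinity_def)
  define d where "d = min \<epsilon> (1 / 4)"
  have d: "0 < d" "d < 1 / 2" "d \<le> \<epsilon>" using \<epsilon> by (auto simp: d_def)
  define \<eta> where "\<eta> = e / 4"
  have \<eta>: "0 < \<eta>" using e by (simp add: \<eta>_def)
  obtain \<beta>0 where \<beta>0: "0 < \<beta>0" and small: "\<And>\<beta>. \<beta>0 \<le> \<beta> \<Longrightarrow> \<exists>x0. \<forall>x\<ge>x0.
    emeasure M {\<omega> \<in> space M. Xproc R L x (\<phi> \<beta>) \<omega> \<in> outside ((1 - d) * \<beta>) ((1 + d) * \<beta>)} \<le> ennreal (2 * \<eta>)"
    using Xproc_outside_small[OF tail Z[folded \<Psi>_def] R_cont R_pos d(1,2) \<eta>] by blast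
  have "\<forall>\<^sub>F t in at_right 0. 0 < t \<and> t < \<phi> \<beta>0"
    using \<phi>_pos[OF \<beta>0] by (intro eventually_conj eventually_at_right_less order_tendstoD(2)[OF tendsto_ident_at])
  then show "\<forall>\<^sub>F t in at_right 0. dist (measure N {\<omega> \<in> space N. Y t \<omega> = \<infinity> \<or>
      \<epsilon> < \<bar>real_of_ereal (Y t \<omega>) / phi_inv \<gamma> R t - 1\<bar>}) 0 < e"
  proof eventually_elim
    case (elim t)
    define \<beta> where "\<beta> = phi_inv \<gamma> R t"
    have "\<forall>\<^sub>F y in at_top. \<phi> y < t" using elim by (intro order_tendstoD(2)[OF \<phi>_lim]) simp
    then obtain y where y: "\<beta>0 \<le> y" "\<phi> y < t"
      using eventually_happens[OF eventually_conj[OF eventually_ge_at_top[of \<beta>0]]] by (auto simp: eventually_at_top_linorder)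
    have "continuous_on {\<beta>0..y} \<phi>"
      using \<beta>0 by (intro continuous_at_imp_continuous_on ballI DERIV_isCont[OF \<phi>_deriv]) auto
    then obtain b where "\<beta>0 \<le> b" "b \<le> y" "\<phi> b = t" using IVT2'[of \<phi> y t \<beta>0] y elim by auto
    \<comment> \<open>\<open>inv_into\<close> inverts \<open>\<phi>\<close> only on its range, hence
      the intermediate value argument.\<close>
    then have "t \<in> \<phi> ` {0<..}" using \<beta>0 by auto
    then have \<beta>: "\<phi> \<beta> = t" "0 < \<beta>" unfolding \<beta>_def phi_inv_def \<phi>_def[symmetric]
      using f_inv_into_f[of t \<phi> "{0<..}"] inv_into_into[of t \<phi> "{0<..}"] by auto
    have "\<beta>0 \<le> \<beta>"
    proof (rule ccontr)
      assume "\<not> \<beta>0 \<le> \<beta>"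
      then show False using \<phi>_decreasing[of \<beta> \<beta>0] \<beta> elim by simp
    qed
    then obtain x0 where x0: "\<And>x. x0 \<le> x \<Longrightarrow>
        emeasure M {\<omega> \<in> space M. Xproc R L x t \<omega> \<in> outside ((1 - d) * \<beta>) ((1 + d) * \<beta>)} \<le> ennreal (2 * \<eta>)"
      using small[of \<beta>] \<beta>(1) by blast
    have le: "measure N {\<omega> \<in> space N. Y t \<omega> \<in> outside ((1 - d) * \<beta>) ((1 + d) * \<beta>)} \<le> 2 * \<eta>"
      using elim \<eta> by (intro entrance_outside_le[OF Pinf Z[folded \<Psi>_def] gamma_pos lim _ _ x0]) auto
    have Yt: "Y t \<in> borel_measurable N" using entrance_measurable[OF Pinf] elim by simp
    have sub: "{\<omega> \<in> space N. Y t \<omega> = \<infinity> \<or> \<epsilon> < \<bar>real_of_ereal (Y t \<omega>) / \<beta> - 1\<bar>}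
        \<subseteq> {\<omega> \<in> space N. Y t \<omega> \<in> outside ((1 - d) * \<beta>) ((1 + d) * \<beta>)}"
    proof safe
      fix \<omega> assume "\<epsilon> < \<bar>real_of_ereal (Y t \<omega>) / \<beta> - 1\<bar>" "\<omega> \<in> space N"
      show "Y t \<omega> \<in> outside ((1 - d) * \<beta>) ((1 + d) * \<beta>)"
      \<comment> \<open>Infinite values lie in \<open>outside\<close> themselves, so the default
        value of \<open>real_of_ereal\<close> there does no harm.\<close>
      proof (cases "Y t \<omega>")
        case (real r)
        then have "d < \<bar>r / \<beta> - 1\<bar>" using \<open>\<epsilon> < _\<close> d by simp
        then have "r / \<beta> < 1 - d \<or> 1 + d < r / \<beta>" by linarith
        then have "r < (1 - d) * \<beta> \<or> (1 + d) * \<beta> < r" using \<beta>(2) by (simp add: divide_less_eq less_divide_eq)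
        then show ?thesis using real by (simp add: outside_def)
      qed (auto simp: outside_def)
    qed (auto simp: outside_def)
    have "outside ((1 - d) * \<beta>) ((1 + d) * \<beta>) \<in> sets borel" by (simp add: outside_def)
    from measurable_sets[OF Yt this] have "{\<omega> \<in> space N. Y t \<omega> \<in> outside ((1 - d) * \<beta>) ((1 + d) * \<beta>)} \<in> sets N"
      by (simp add: vimage_def Int_def conj_commute)
    from N.finite_measure_mono[OF sub this] le
    have "measure N {\<omega> \<in> space N. Y t \<omega> = \<infinity> \<or> \<epsilon> < \<bar>real_of_ereal (Y t \<omega>) / \<beta> - 1\<bar>} \<le> e / 2" by (simp add: \<eta>_def)
    then show ?case using e by (simp add: \<beta>_def)
  qed
qed

end
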